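(* Let $\Lambda\subset\mathbb{C}$ be an algebraic Delone set. (a) There exist sets $U$ of four pairwise nonparallel $\Lambda$-directions such that the convex subsets of $\Lambda$ are determined by the X-rays in the directions of $U$. In addition, fewer than four pairwise nonparallel $\Lambda$-directions never suffice for this purpose, i.e., for no set $U$ of fewer than four pairwise nonparallel $\Lambda$-directions are the convex subsets of $\Lambda$ determined by the X-rays in the directions of $U$. (b) There is a natural number $c_{\Lambda}$ such that, for every set $U$ of $c_{\Lambda}$ pairwise nonparallel $\Lambda$-directions, the convex subsets of $\Lambda$ are determined by the X-rays in the directions of $U$.
   Context: The Euclidean plane is identified with $\mathbb{C}$; natural numbers are positive. For $r>0$, $B_r(z)$ is the open ball of radius $r$ about $z\in\mathbb{C}$. A set $\Lambda\subset\mathbb{C}$ is uniformly discrete if there is $r>0$ such that every $B_r(z)$, $z\in\mathbb{C}$, contains at most one point of $\Lambda$; it is relatively dense if there is $R>0$ such that every $B_R(z)$, $z\in\mathbb{C}$, contains at least one point of $\Lambda$; it is a Delone set if it is both. Let $\Lambda-\Lambda=\{v-w : v,w\in\Lambda\}$ and let $K_\Lambda:=\mathbb{Q}\big((\Lambda-\Lambda)\cup\overline{(\Lambda-\Lambda)}\big)\subset\mathbb{C}$, the field generated over $\mathbb{Q}$ by all differences of points of $\Lambda$ and their complex conjugates. A homothety of the complex plane is a map $z\mapsto\lambda z+t$ with $\lambda\in\mathbb{R}$, $\lambda>0$, $t\in\mathbb{C}$. A Delone set $\Lambda\subset\mathbb{C}$ is an algebraic Delone set if: (Alg) $[K_\Lambda:\mathbb{Q}]<\infty$;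 and (Hom) for any finite subset $F$ of $K_\Lambda$ there is a homothety $h$ of the complex plane with $h(F)\subset\Lambda$. Elements of the unit circle $\mathbb{S}^1\subset\mathbb{C}$ are called directions. A direction is a $\Lambda$-direction if it is parallel to a nonzero element of $\Lambda-\Lambda$. A convex subset of $\Lambda$ is a bounded subset $C\subset\Lambda$ with $C=\operatorname{conv}(C)\cap\Lambda$ (such a set is finite). For a finite set $F\subset\mathbb{C}$ and a direction $u$, the (discrete parallel) X-ray $X_uF$ is the function on the set of lines $\ell$ in $\mathbb{C}$ in direction $u$ given by $X_uF(\ell)=\operatorname{card}(F\cap\ell)$. For a finite set $U$ of directions, the elements of a collection $\mathcal{F}$ of finite subsets of $\mathbb{C}$ are determined by the X-rays in the directions of $U$ if for all $F,F'\in\mathcal{F}$: $X_uF=X_uF'$ for all $u\in U$ implies $F=F'$. *)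

theory Defs
  imports
    "HOL-Analysis.Analysis"
    "HOL-Algebra.Embedded_Algebras"
    "HOL-Algebra.Generated_Fields"
    "HOL-Algebra.Algebraic_Closure_Type"
begin

section \<open>Delone sets\<close>

definition relatively_dense :: "complex set \<Rightarrow> bool" where
  "relatively_dense \<Lambda> \<longleftrightarrow> (\<exists>R>0. \<forall>z. ball z R \<inter> \<Lambda> \<noteq> {})"

definition Delone :: "complex set \<Rightarrow> bool" where
  "Delone \<Lambda> \<longleftrightarrow> uniform_discrete \<Lambda> \<and> relatively_dense \<Lambda>"

text \<open>The library's notion of uniform discreteness bounds distances from below; it agrees with
  the condition that balls of some fixed radius contain at most one point.\<close>

lemma uniform_discrete_iff_ball:
  fixes \<Lambda> :: "complex set"
  shows "uniform_discrete \<Lambda> \<longleftrightarrow>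
    (\<exists>r>0. \<forall>z. \<forall>x \<in> ball z r \<inter> \<Lambda>. \<forall>y \<in> ball z r \<inter> \<Lambda>. x = y)"
proof
  assume "uniform_discrete \<Lambda>"
  then obtain e where "e > 0" and e: "\<And>x y. x \<in> \<Lambda> \<Longrightarrow> y \<in> \<Lambda> \<Longrightarrow> dist x y < e \<Longrightarrow> x = y"
    unfolding uniform_discrete_def by blast
  have "x = y" if "x \<in> ball z (e/2) \<inter> \<Lambda>" "y \<in> ball z (e/2) \<inter> \<Lambda>" for x y z
    using that by (intro e) (auto intro: dist_triangle_half_r)
  with \<open>e > 0\<close> show "\<exists>r>0. \<forall>z. \<forall>x \<in> ball z r \<inter> \<Lambda>. \<forall>y \<in> ball z r \<inter> \<Lambda>. x = y"
    by (intro exI[of _ "e/2"]) auto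
next
  assume "\<exists>r>0. \<forall>z. \<forall>x \<in> ball z r \<inter> \<Lambda>. \<forall>y \<in> ball z r \<inter> \<Lambda>. x = y"
  then obtain r where "r > 0"
    and r: "\<And>z x y. x \<in> ball z r \<inter> \<Lambda> \<Longrightarrow> y \<in> ball z r \<inter> \<Lambda> \<Longrightarrow> x = y"
    by blast
  have "x = y" if "x \<in> \<Lambda>" "y \<in> \<Lambda>" "dist x y < r" for x y
    using that \<open>r > 0\<close> by (intro r[where z = x]) auto
  with \<open>r > 0\<close> show "uniform_discrete \<Lambda>"
    unfolding uniform_discrete_def by blast
qed


section \<open>Algebraic Delone sets\<close>

definition difference_set :: "complex set \<Rightarrow> complex set" where
  "difference_set \<Lambda> = {v - w | v w. v \<in> \<Lambda> \<and> w \<in> \<Lambda>}"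

abbreviation complex_ring :: "complex ring" where
  "complex_ring \<equiv> ring_of_type_algebra"

definition difference_field :: "complex set \<Rightarrow> complex set" where
  "difference_field \<Lambda> =
    generate_field complex_ring (\<rat> \<union> (difference_set \<Lambda> \<union> cnj ` difference_set \<Lambda>))"

definition homothety :: "(complex \<Rightarrow> complex) \<Rightarrow> bool" where
  "homothety h \<longleftrightarrow> (\<exists>(c::real) t. c > 0 \<and> h = (\<lambda>z. of_real c * z + t))"

definition algebraic_Delone :: "complex set \<Rightarrow> bool" where
  "algebraic_Delone \<Lambda> \<longleftrightarrow>
    Delone \<Lambda> \<and>
    ring.finite_dimension complex_ring \<rat> (difference_field \<Lambda>) \<and>
    (\<forall>F. finite F \<and> F \<subseteq> difference_field \<Lambda> \<longrightarrow> (\<exists>h. homothety h \<and> h ` F \<subseteq> \<Lambda>))"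


section \<open>Directions\<close>

text \<open>Parallelism of nonzero vectors; opposite vectors are parallel.\<close>

definition parallel :: "complex \<Rightarrow> complex \<Rightarrow> bool" where
  "parallel u v \<longleftrightarrow> (\<exists>c::real. c \<noteq> 0 \<and> v = c *\<^sub>R u)"

definition direction_of :: "complex set \<Rightarrow> complex \<Rightarrow> bool" where
  "direction_of \<Lambda> u \<longleftrightarrow>
    u \<in> sphere 0 1 \<and> (\<exists>v \<in> difference_set \<Lambda>. v \<noteq> 0 \<and> parallel u v)"

definition nonparallel_directions_of :: "complex set \<Rightarrow> complex set \<Rightarrow> bool" where
  "nonparallel_directions_of \<Lambda> U \<longleftrightarrow>
    (\<forall>u\<in>U. direction_of \<Lambda> u) \<and> pairwise (\<lambda>u v. \<not> parallel u v) U"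


section \<open>Convex subsets and X-rays\<close>

definition convex_subsets_of :: "complex set \<Rightarrow> complex set set" where
  "convex_subsets_of \<Lambda> = {C. C \<subseteq> \<Lambda> \<and> bounded C \<and> C = convex hull C \<inter> \<Lambda>}"

definition lines_in_direction :: "complex \<Rightarrow> complex set set" where
  "lines_in_direction u = {range (\<lambda>t::real. z + t *\<^sub>R u) | z. True}"

text \<open>An X-ray is a function on the lines in direction \<open>u\<close> only, hence the restriction:
  equality of two X-rays is equality on these lines.\<close>

definition X_ray :: "complex \<Rightarrow> complex set \<Rightarrow> complex set \<Rightarrow> nat" where
  "X_ray u F = (\<lambda>l \<in> lines_in_direction u. card (F \<inter> l))"

definition determined_by_X_rays :: "complex set set \<Rightarrow> complex set \<Rightarrow> bool" where
  "determined_by_X_rays \<F> U \<longleftrightarrow>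
    (\<forall>F\<in>\<F>. \<forall>F'\<in>\<F>. (\<forall>u\<in>U. X_ray u F = X_ray u F') \<longrightarrow> F = F')"

end

theory Submission
  imports
    "HOL-Number_Theory.Number_Theory"
    "HOL-Computational_Algebra.Field_as_Ring"
    "Jordan_Normal_Form.Char_Poly"
    Defs
begin

text \<open>Let two convex subsets of \<open>\<Lambda>\<close> have the same X-rays in the directions of \<open>U\<close>, and let \<open>X\<close>, \<open>Y\<close> be
  their two set differences. Neither set meets the convex hull of the other, so \<open>X \<union> Y\<close> falls into
  cyclically ordered runs of alternating colour, and every \<open>u \<in> U\<close> induces a reflection of the cycle of
  runs that preserves the levels of \<open>Im (cnj u * _)\<close>. The first Fourier coefficient of the polygon of the
  centroids of the runs, which is nondegenerate by the Cauchy--Binet formula, therefore gives a fractional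
  linear map that sends \<open>cnj u / u\<close>, for \<open>u \<in> U\<close>, to roots of unity. Hence cross ratios of directions are
  cross ratios of roots of unity.

  For (a), the rational cross ratio 8 does not occur: in the ring generated by roots of unity, \<open>1 - \<alpha>\<close>
  divides a prime number for every root of unity \<open>\<alpha> \<noteq> 1\<close>, and 8 does not divide a product of two primes.
  Three directions are realised by the edges of an affinely regular hexagon.

  For (b), the cross ratios have degree at most \<open>D\<close> over the rationals, so the conjugation
  \<open>\<zeta> \<mapsto> \<zeta> ^ (t ^ fact D)\<close> fixes them and acts on the roots of unity in question as a Moebius map.
  If there are many roots, additive relations between such exponents become identities between Moebius
  maps, and this forces the common order of the roots to be bounded.\<close>

hide_const (open) Divisibility.prime Coset.order Polynomials.lead_coeff Polynomials.degree
  up_ring.monom up_ring.coeff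
no_notation var (\<open>X\<index>\<close>)

section \<open>The ring generated by the roots of unity\<close>

text \<open>No bound on the number of runs enters, so both parts rest on facts about roots of unity
  of arbitrary order: one rational value that their cross ratios never take, and a bound on the
  number of roots that does not mention the order. The runs are constructed from one direction at a
  time, as blocks of consecutive levels on two sides; before the reflections of different directions
  can be compared in one Fourier coefficient, the runs must be shown to be the same sets in the same
  cyclic order for every direction. Cross ratios are formed from \<open>cnj u / u\<close> because
  this number lies in the difference field, while the normalised vector \<open>u\<close> need not.
  In (b) one exponent has to serve all cross ratios of degree at most \<open>D\<close> at once: the
  conjugates of each repeat with some period at most \<open>D\<close>, and \<open>fact D\<close> is
  a common multiple of these periods. The exponents \<open>(1 + i * R) ^ fact D\<close> are
  polynomial in \<open>i\<close>, which is the source of the additive relations; the freedom in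
  \<open>R\<close> is spent on making all \<open>1 + i * R\<close> coprime to the order.\<close>

inductive_set root_ring :: "nat \<Rightarrow> complex set" for m :: nat where
  root: "w ^ m = 1 \<Longrightarrow> w \<in> root_ring m"
| add: "x \<in> root_ring m \<Longrightarrow> y \<in> root_ring m \<Longrightarrow> x + y \<in> root_ring m"
| neg: "x \<in> root_ring m \<Longrightarrow> - x \<in> root_ring m"

lemma root_ring_1: "1 \<in> root_ring m"
  by (rule root_ring.root) simp

lemma root_ring_diff: "x \<in> root_ring m \<Longrightarrow> y \<in> root_ring m \<Longrightarrow> x - y \<in> root_ring m"
  using root_ring.add[OF _ root_ring.neg] by fastforce

lemma root_ring_0: "0 \<in> root_ring m"
  using root_ring_diff[OF root_ring_1 root_ring_1] by simp

lemma root_ring_mult: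
  assumes "x \<in> root_ring m" "y \<in> root_ring m"
  shows "x * y \<in> root_ring m"
  using assms(1)
proof induction
  case (root w)
  show ?case using assms(2)
  proof induction
    case (root v)
    then show ?case using \<open>w ^ m = 1\<close> by (intro root_ring.root) (simp add: power_mult_distrib)
  qed (simp_all add: distrib_left root_ring.add root_ring.neg)
qed (simp_all add: distrib_right root_ring.add root_ring.neg)

lemma root_ring_power: "x \<in> root_ring m \<Longrightarrow> x ^ n \<in> root_ring m"
  by (induction n) (auto intro: root_ring_1 root_ring_mult)

lemma root_ring_sum: "(\<And>i. i \<in> A \<Longrightarrow> f i \<in> root_ring m) \<Longrightarrow> sum f A \<in> root_ring m"
  by (induction A rule: infinite_finite_induct) (auto intro: root_ring_0 root_ring.add)

lemma root_ring_prod: "(\<And>i. i \<in> A \<Longrightarrow> f i \<in> root_ring m) \<Longrightarrow> prod f A \<in> root_ring m"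
  by (induction A rule: infinite_finite_induct) (auto intro: root_ring_1 root_ring_mult)

lemma root_ring_of_nat: "of_nat n \<in> root_ring m"
  by (induction n) (auto intro: root_ring_0 root_ring_1 root_ring.add)

lemma root_ring_of_int: "of_int n \<in> root_ring m"
  by (cases n rule: int_cases2) (auto intro: root_ring_of_nat root_ring.neg)

lemma cis_root_power: "0 < m \<Longrightarrow> cis (2 * pi / m) ^ m = 1"
  by (simp add: Complex.DeMoivre)

lemma root_of_unity_eq_power:
  assumes "0 < m" "w ^ m = 1"
  obtains k where "k < m" "w = cis (2 * pi / m) ^ k"
proof -
  have "w \<in> {z. z ^ m = 1}" using assms by simp
  then have "w \<in> (\<lambda>k. cis (2 * pi * real k / real m)) ` {..<m}"
    using Complex.bij_betw_roots_unity[OF assms(1)] by (simp add: bij_betw_def)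
  then obtain k where "k < m" "w = cis (2 * pi * real k / real m)" by auto
  then show ?thesis using that[of k] by (simp add: Complex.DeMoivre mult_ac)
qed

lemma root_ring_representation:
  assumes "0 < m" "x \<in> root_ring m"
  shows "\<exists>a :: nat \<Rightarrow> int. x = (\<Sum>i<m. of_int (a i) * cis (2 * pi / m) ^ i)"
  using assms(2)
proof induction
  case (root w)
  then obtain k where k: "k < m" "w = cis (2 * pi / m) ^ k" using root_of_unity_eq_power assms(1) by metis
  have "(\<Sum>i<m. of_int (if i = k then 1 else 0) * cis (2 * pi / m) ^ i) = (\<Sum>i<m. if i = k then w else 0)"
    using k by (intro sum.cong) auto
  then show ?case using k by (intro exI[of _ "\<lambda>i. if i = k then 1 else 0"]) simp
next
  case (add x y)
  then obtain a b :: "nat \<Rightarrow> int" where "x = (\<Sum>i<m. of_int (a i) * cis (2 * pi / m) ^ i)"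
    "y = (\<Sum>i<m. of_int (b i) * cis (2 * pi / m) ^ i)" by blast
  then show ?case by (intro exI[of _ "\<lambda>i. a i + b i"]) (simp add: sum.distrib distrib_right)
next
  case (neg x)
  then obtain a :: "nat \<Rightarrow> int" where "x = (\<Sum>i<m. of_int (a i) * cis (2 * pi / m) ^ i)" by blast
  then show ?case by (intro exI[of _ "\<lambda>i. - a i"]) (simp add: sum_negf)
qed

text \<open>Multiplication by \<open>x\<close> acts on the powers of the primitive root by an integral circulant matrix,
  so \<open>x\<close> is an eigenvalue of that matrix.\<close>

lemma root_ring_algebraic_int:
  assumes m: "0 < m" and x: "x \<in> root_ring m"
  shows "algebraic_int x"
proof -
  obtain a :: "nat \<Rightarrow> int" where a: "x = (\<Sum>i<m. of_int (a i) * cis (2 * pi / m) ^ i)"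
    using root_ring_representation[OF m x] by blast
  define z where "z = cis (2 * pi / m)"
  have zm: "z ^ m = 1" using cis_root_power[OF m] by (simp add: z_def)
  have zmod: "z ^ (n mod m) = z ^ n" for n
  proof -
    have "z ^ n = (z ^ m) ^ (n div m) * z ^ (n mod m)" by (simp add: power_mult[symmetric] power_add[symmetric])
    then show ?thesis using zm by simp
  qed
  \<comment> \<open>Since \<open>x * z ^ j\<close> is the sum of the terms
    \<open>a k * z ^ (k + j)\<close>, the entry in row \<open>j\<close> and column \<open>i\<close>
    is the coefficient with index \<open>i - j\<close> modulo \<open>m\<close>; the added
    \<open>m\<close> keeps the natural subtraction from truncating.\<close>
  define M where "M = Matrix.mat m m (\<lambda>(j, i). a ((i + m - j) mod m))"
  define v where "v = Matrix.vec m (\<lambda>i. z ^ i)"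
  have Mc: "M \<in> carrier_mat m m" by (simp add: M_def)
  have Mc': "map_mat complex_of_int M \<in> carrier_mat m m" using Mc by simp
  have "map_mat complex_of_int M *\<^sub>v v = x \<cdot>\<^sub>v v"
  proof (rule eq_vecI)
    show "dim_vec (map_mat complex_of_int M *\<^sub>v v) = dim_vec (x \<cdot>\<^sub>v v)" by (simp add: M_def v_def)
    fix j assume "j < dim_vec (x \<cdot>\<^sub>v v)"
    then have j: "j < m" by (simp add: v_def)
    have "vec_index (map_mat complex_of_int M *\<^sub>v v) j = (\<Sum>i<m. of_int (a ((i + m - j) mod m)) * z ^ i)"
      using j by (simp add: M_def v_def scalar_prod_def lessThan_atLeast0)
    also have "\<dots> = (\<Sum>k<m. of_int (a k) * z ^ ((k + j) mod m))"
    proof (rule sum.reindex_bij_witness[of _ "\<lambda>k. (k + j) mod m" "\<lambda>i. (i + m - j) mod m"])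
      fix i assume i: "i \<in> {..<m}"
      show e: "((i + m - j) mod m + j) mod m = i" using i j by (simp add: mod_add_left_eq)
      show "(i + m - j) mod m \<in> {..<m}" using m by simp
      show "of_int (a ((i + m - j) mod m)) * z ^ (((i + m - j) mod m + j) mod m) = of_int (a ((i + m - j) mod m)) * z ^ i"
        unfolding e ..
    next
      fix k assume k: "k \<in> {..<m}"
      show "(k + j) mod m \<in> {..<m}" using m by simp
      show "((k + j) mod m + m - j) mod m = k"
      proof (cases "k + j < m")
        case True
        then show ?thesis using k by simp
      next
        case False
        then have "(k + j) mod m = k + j - m" using k j by (simp add: le_mod_geq)
        then show ?thesis using False k j by simp
      qed
    qed
    also have "\<dots> = x * z ^ j"
      unfolding a z_def[symmetric] sum_distrib_right zmod by (simp add: power_add mult_ac)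
    finally show "vec_index (map_mat complex_of_int M *\<^sub>v v) j = vec_index (x \<cdot>\<^sub>v v) j" using j by (simp add: v_def)
  qed
  moreover have "v \<noteq> 0\<^sub>v m"
  proof
    assume "v = 0\<^sub>v m"
    then have "vec_index v 0 = 0" using m by simp
    then show False using m by (simp add: v_def)
  qed
  ultimately have "eigenvector (map_mat complex_of_int M) v x"
    unfolding eigenvector_def using Mc by (simp add: v_def)
  then have "eigenvalue (map_mat complex_of_int M) x" unfolding eigenvalue_def by blast
  then have "poly (char_poly (map_mat complex_of_int M)) x = 0" using eigenvalue_root_char_poly[OF Mc'] by simp
  then have "poly (map_poly of_int (char_poly M)) x = 0" by (simp only: of_int_hom.char_poly_hom[OF Mc])
  moreover have "lead_coeff (char_poly M) = 1" using degree_monic_char_poly[OF Mc] by simp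
  ultimately show ?thesis unfolding algebraic_int_altdef_ipoly by blast
qed

lemma root_ring_rational:
  assumes "0 < m" "x \<in> root_ring m" "x \<in> \<rat>"
  shows "x \<in> \<int>"
  using rational_algebraic_int_is_int[OF root_ring_algebraic_int] assms by blast

text \<open>Divisibility in the ring descends to the natural numbers, because a rational algebraic
  integer is an integer.\<close>

lemma root_ring_dvd:
  assumes "0 < m" "x \<in> root_ring m" "of_nat a = of_nat b * x" "b \<noteq> 0"
  shows "b dvd a"
proof -
  have x: "x = of_nat a / of_nat b" using assms by simp
  then have "x \<in> \<rat>" by (simp add: Rats_divide)
  then have "x \<in> \<int>" using root_ring_rational assms by blast
  then obtain k :: int where "x = of_int k" by (auto elim: Ints_cases)
  then have "of_int (int a) = (of_int (int b * k) :: complex)" using assms(3) by simp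
  then have "int a = int b * k" by (simp only: of_int_eq_iff)
  then show ?thesis by (metis dvd_triv_left int_dvd_int_iff)
qed

text \<open>If \<open>n\<close> is the order of \<alpha> and \<open>r\<close> a prime factor of
  \<open>n\<close>, then the power \<rho> of \<alpha> with exponent \<open>n div r\<close> has order
  \<open>r\<close>. Its \<open>r\<close> powers sum to 0, so \<open>r\<close> is the sum of the
  terms \<open>1 - \<rho> ^ k\<close>, each of which is divisible by
  \<open>1 - \<alpha>\<close>.\<close>

lemma one_minus_root_dvd_prime:
  assumes m: "0 < m" and al: "\<alpha> ^ m = 1" "\<alpha> \<noteq> 1"
  obtains r z where "prime (r::nat)" "z \<in> root_ring m" "of_nat r = (1 - \<alpha>) * z"
proof -
  define n where "n = (LEAST n. 0 < n \<and> \<alpha> ^ n = 1)"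
  have n: "0 < n" "\<alpha> ^ n = 1" using LeastI[of "\<lambda>n. 0 < n \<and> \<alpha> ^ n = 1" m] m al by (simp_all add: n_def)
  have nmin: "n \<le> k" if "0 < k" "\<alpha> ^ k = 1" for k using that by (simp add: n_def Least_le)
  have "n \<noteq> 1" using n al by auto
  then obtain r where r: "prime r" "r dvd n" using prime_factor_nat by blast
  then obtain d where d: "n = r * d" by blast
  have rd: "1 < r" "0 < d" using prime_gt_1_nat[OF r(1)] n d by auto
  define \<rho> where "\<rho> = \<alpha> ^ d"
  have "\<rho> \<noteq> 1"
  proof
    assume "\<rho> = 1"
    then have "n \<le> d" using nmin[of d] rd by (simp add: \<rho>_def)
    then show False using d rd by simp
  qed
  moreover have "\<rho> ^ r = 1" using n d by (simp add: \<rho>_def power_mult[symmetric] mult.commute)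
  ultimately have s: "(\<Sum>k<r. \<rho> ^ k) = 0" by (simp add: sum_gp_strict)
  have "of_nat r = (\<Sum>k<r. 1 - \<rho> ^ k)" using s by (simp add: sum_subtractf)
  also have "\<dots> = (\<Sum>k<r. (1 - \<alpha>) * (\<Sum>i<d * k. \<alpha> ^ i))"
    by (simp add: \<rho>_def power_mult[symmetric] one_diff_power_eq)
  also have "\<dots> = (1 - \<alpha>) * (\<Sum>k<r. \<Sum>i<d * k. \<alpha> ^ i)" by (simp add: sum_distrib_left)
  finally have "of_nat r = (1 - \<alpha>) * (\<Sum>k<r. \<Sum>i<d * k. \<alpha> ^ i)" .
  moreover have "(\<Sum>k<r. \<Sum>i<d * k. \<alpha> ^ i) \<in> root_ring m"
    by (intro root_ring_sum root_ring_power root_ring.root al)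
  ultimately show ?thesis using that r by blast
qed

text \<open>Two primes contribute at most two factors 2; 8 is the least number with three prime
  factors counted with multiplicity.\<close>

lemma eight_not_dvd_prime_mult_prime:
  assumes "prime (r::nat)" "prime s"
  shows "\<not> 8 dvd r * s"
proof
  assume d: "8 dvd r * s"
  have "r = 2 \<or> s = 2"
  proof (rule ccontr)
    assume "\<not> ?thesis"
    then have "odd r" "odd s" using assms primes_dvd_imp_eq two_is_prime_nat by blast+
    then have "odd (r * s)" by simp
    moreover have "even (r * s)" using d by (metis dvd_trans even_numeral)
    ultimately show False by simp
  qed
  moreover have False if "prime p" "8 dvd 2 * p" for p :: nat
  proof -
    have "4 dvd p" using that(2) by presburger
    then have "2 dvd p" by (rule dvd_trans[rotated]) simp
    then have "p = 2" using primes_dvd_imp_eq[OF two_is_prime_nat that(1)] by simp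
    then show False using \<open>4 dvd p\<close> by simp
  qed
  ultimately show False using d assms by (auto simp: mult.commute)
qed

text \<open>Roots of unity are units of the ring, so each difference of two distinct ones divides a
  prime, and the left-hand product divides a product of two primes. The equation would make 8 divide
  that product.\<close>

lemma cross_ratio_of_roots_ne_8:
  fixes w1 w2 w3 w4 :: complex
  assumes m: "0 < m" and w: "w1 ^ m = 1" "w2 ^ m = 1" "w3 ^ m = 1" "w4 ^ m = 1" "w1 \<noteq> w2" "w3 \<noteq> w4"
  shows "(w1 - w2) * (w3 - w4) \<noteq> 8 * ((w1 - w3) * (w2 - w4))"
proof
  assume eq: "(w1 - w2) * (w3 - w4) = 8 * ((w1 - w3) * (w2 - w4))"
  have nz: "w1 \<noteq> 0" "w3 \<noteq> 0" using w m by (auto simp: power_0_left)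
  have iv: "inverse w1 ^ m = 1" "inverse w3 ^ m = 1" using w by (simp_all add: power_inverse)
  obtain r z where r: "prime r" "z \<in> root_ring m" "of_nat r = (1 - w2 * inverse w1) * z"
    using one_minus_root_dvd_prime[OF m, of "w2 * inverse w1"] w nz iv by (auto simp: power_mult_distrib field_simps)
  obtain s y where s: "prime s" "y \<in> root_ring m" "of_nat s = (1 - w4 * inverse w3) * y"
    using one_minus_root_dvd_prime[OF m, of "w4 * inverse w3"] w nz iv by (auto simp: power_mult_distrib field_simps)
  define t where "t = (w1 - w3) * (w2 - w4) * (z * y * (inverse w1 * inverse w3))"
  have "t \<in> root_ring m" unfolding t_def
    by (intro root_ring_mult root_ring_diff r(2) s(2) root_ring.root[OF w(1)] root_ring.root[OF w(2)]
      root_ring.root[OF w(3)] root_ring.root[OF w(4)] root_ring.root[OF iv(1)] root_ring.root[OF iv(2)])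
  moreover have "of_nat (r * s) = of_nat 8 * t"
  proof -
    have "of_nat (r * s) = ((w1 - w2) * (w3 - w4)) * (z * y * (inverse w1 * inverse w3))"
      unfolding of_nat_mult r(3) s(3) using nz by (simp add: field_simps)
    then show ?thesis unfolding eq t_def by simp
  qed
  ultimately have "8 dvd r * s" using root_ring_dvd[OF m, of t "r * s" 8] by simp
  then show False using eight_not_dvd_prime_mult_prime r s by blast
qed

section \<open>Conjugates of roots of unity\<close>

abbreviation cpoly :: "rat poly \<Rightarrow> complex poly" where
  "cpoly \<equiv> map_poly of_rat"

lemma cpoly_mult: "cpoly (p * q) = cpoly p * cpoly q"
  by (rule poly_eqI) (simp add: coeff_map_poly coeff_mult of_rat_sum of_rat_mult)

lemma cpoly_add: "cpoly (p + q) = cpoly p + cpoly q"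
  by (rule poly_eqI) (simp add: coeff_map_poly of_rat_add)

section \<open>The Frobenius congruence modulo a prime\<close>

lemma root_ring_binomial_prime:
  assumes p: "prime p" and "x \<in> root_ring m" "y \<in> root_ring m"
  shows "\<exists>z\<in>root_ring m. (x + y) ^ p = x ^ p + y ^ p + of_nat p * z"
proof -
  have p1: "1 < p" using prime_gt_1_nat[OF p] .
  define c where "c = (\<lambda>k. (p choose k) div p)"
  have c: "p choose k = p * c k" if "k \<in> {1..p-1}" for k
  proof -
    have "p dvd p choose k" using p that p1 by (intro dvd_choose_prime) auto
    then show ?thesis by (simp add: c_def)
  qed
  define z where "z = (\<Sum>k\<in>{1..p-1}. of_nat (c k) * x ^ k * y ^ (p - k))"
  have "(x + y) ^ p = (\<Sum>k\<le>p. of_nat (p choose k) * x ^ k * y ^ (p - k))" by (rule binomial_ring)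
  also have "{..p} = insert 0 (insert p {1..p-1})" using p1 by auto
  also have "(\<Sum>k\<in>insert 0 (insert p {1..p-1}). of_nat (p choose k) * x ^ k * y ^ (p - k)) =
      y ^ p + (x ^ p + (\<Sum>k\<in>{1..p-1}. of_nat (p choose k) * x ^ k * y ^ (p - k)))"
    using p1 by (subst sum.insert; simp)+
  also have "(\<Sum>k\<in>{1..p-1}. of_nat (p choose k) * x ^ k * y ^ (p - k)) = of_nat p * z"
    unfolding z_def sum_distrib_left by (intro sum.cong refl) (simp add: c mult_ac)
  finally have "(x + y) ^ p = x ^ p + y ^ p + of_nat p * z" by (simp add: add_ac)
  moreover have "z \<in> root_ring m"
    unfolding z_def using assms by (intro root_ring_sum root_ring_mult root_ring_power root_ring_of_nat)
  ultimately show ?thesis by blast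
qed

lemma fermat_int:
  assumes "prime (p::nat)"
  shows "\<exists>k. (a::int) ^ p = a + of_nat p * k"
proof -
  have base: "int p dvd int n ^ p - int n" for n
  proof (cases "p dvd n")
    case True
    then have "int p dvd int n" by simp
    moreover have "int n dvd int n ^ p" using assms prime_gt_0_nat by (simp add: dvd_power)
    ultimately show ?thesis by (meson dvd_diff dvd_trans)
  next
    case False
    then have "[n ^ (p - 1) = 1] (mod p)" using fermat_theorem assms by blast
    then have "[n * n ^ (p - 1) = n * 1] (mod p)" by (rule cong_scalar_left)
    then have "[n ^ p = n] (mod p)" using prime_gt_0_nat[OF assms] by (simp add: power_eq_if)
    then have "[int (n ^ p) = int n] (mod int p)" by (simp only: cong_int_iff)
    then show ?thesis by (simp add: cong_iff_dvd_diff)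
  qed
  define n where "n = nat (a mod int p)"
  have "int n = a mod int p" using prime_gt_0_nat[OF assms] by (simp add: n_def)
  then have "[a = int n] (mod int p)" by (simp add: Cong.cong_def)
  then have "[a ^ p - a = int n ^ p - int n] (mod int p)" by (intro cong_diff cong_pow)
  then have "int p dvd a ^ p - a" using base[of n] by (simp add: cong_dvd_iff)
  then obtain k where "a ^ p - a = int p * k" by blast
  then show ?thesis by (intro exI[of _ k]) simp
qed

text \<open>Modulo \<open>p\<close> the Frobenius map is additive and multiplicative on the ring and
  fixes the integers by Fermat, so it commutes with integer polynomials. The induction follows
  Horner's scheme.\<close>

lemma frobenius_int_poly:
  assumes p: "prime p" and x: "x \<in> root_ring m"
  shows "\<exists>z\<in>root_ring m. poly (map_poly of_int g) (x ^ p) = poly (map_poly of_int g) x ^ p + of_nat p * z"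
proof (induction g)
  case 0
  then show ?case using root_ring_0 prime_gt_0_nat[OF p] by (intro bexI[of _ 0]) auto
next
  case (pCons a q)
  define Q where "Q = poly (map_poly of_int q :: complex poly)"
  obtain z where z: "z \<in> root_ring m" "Q (x ^ p) = Q x ^ p + of_nat p * z" using pCons(2) by (auto simp: Q_def)
  have Qx: "Q x \<in> root_ring m"
    unfolding Q_def poly_altdef
    by (intro root_ring_sum root_ring_mult root_ring_power x) (simp add: coeff_map_poly root_ring_of_int)
  obtain y where y: "y \<in> root_ring m" "(of_int a + x * Q x) ^ p = of_int a ^ p + (x * Q x) ^ p + of_nat p * y"
    using root_ring_binomial_prime[OF p root_ring_of_int root_ring_mult[OF x Qx]] by blast
  obtain k where k: "a ^ p = a + of_nat p * k" using fermat_int[OF p] by blast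
  have pc: "poly (map_poly of_int (pCons a q)) w = of_int a + w * Q w" for w :: complex
    using pCons(1) by (simp add: map_poly_pCons Q_def)
  have ak: "(of_int a :: complex) ^ p = of_int a + of_nat p * of_int k"
    using arg_cong[OF k, of "of_int :: int \<Rightarrow> complex"] by simp
  have "poly (map_poly of_int (pCons a q)) (x ^ p) =
      poly (map_poly of_int (pCons a q)) x ^ p + of_nat p * (x ^ p * z - y - of_int k)"
    unfolding pc y(2) z(2) ak by (simp add: algebra_simps power_mult_distrib)
  moreover have "x ^ p * z - y - of_int k \<in> root_ring m"
    using y(1) z(1) x by (intro root_ring_diff root_ring_mult root_ring_power root_ring_of_int)
  ultimately show ?case by blast
qed

text \<open>The derivative vanishes only at 0, which is not a root, so all roots are simple.\<close>

lemma unity_poly_eq_prod: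
  assumes "0 < m"
  shows "monom 1 m - 1 = (\<Prod>w\<in>{w::complex. w ^ m = 1}. [:- w, 1:])"
proof -
  define P where "P = (monom 1 m - 1 :: complex poly)"
  have pP: "poly P z = z ^ m - 1" for z by (simp add: P_def poly_monom)
  have d: "degree P = m" "lead_coeff P = 1"
  proof -
    have "P = monom 1 m + (- 1)" by (simp add: P_def)
    then have "degree P = degree (monom (1::complex) m)"
      using assms by (simp only:) (rule degree_add_eq_left, simp add: degree_monom_eq)
    then show "degree P = m" by (simp add: degree_monom_eq)
    then show "lead_coeff P = 1" using assms by (simp add: P_def coeff_1)
  qed
  have "rsquarefree P"
    unfolding rsquarefree_roots
  proof (intro allI notI, elim conjE)
    fix a assume "poly P a = 0" "poly (pderiv P) a = 0"
    then have "a ^ m = 1" "of_nat m * a ^ (m - 1) = 0"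
      by (simp_all add: pP) (simp add: P_def pderiv_diff pderiv_monom poly_monom)
    then show False using assms by (auto simp: power_0_left)
  qed
  then have "smult (lead_coeff P) (\<Prod>z | poly P z = 0. [:- z, 1:]) = P" by (rule complex_poly_decompose_rsquarefree)
  then show ?thesis using d by (simp add: pP flip: P_def)
qed

text \<open>Both sides are the derivative of \<open>monom 1 m - 1\<close> at \<eta>, computed from
  the factorisation on the left and termwise on the right.\<close>

lemma prod_diff_other_roots:
  assumes m: "0 < m" and e: "(\<eta>::complex) ^ m = 1"
  shows "(\<Prod>w\<in>{w. w ^ m = 1} - {\<eta>}. \<eta> - w) = of_nat m * \<eta> ^ (m - 1)"
proof -
  have fin: "finite {w::complex. w ^ m = 1}" using m by (intro finite_roots_unity) simp
  define Q where "Q = (\<Prod>w\<in>{w::complex. w ^ m = 1} - {\<eta>}. [:- w, 1:])"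
  have "monom 1 m - 1 = [:- \<eta>, 1:] * Q"
    unfolding unity_poly_eq_prod[OF m] Q_def using fin e by (simp add: prod.remove[of _ \<eta>])
  then have "pderiv (monom 1 m - 1) = pderiv ([:- \<eta>, 1:] * Q)" by simp
  then have "poly (pderiv (monom 1 m - 1)) \<eta> = poly (pderiv ([:- \<eta>, 1:] * Q)) \<eta>" by simp
  also have "\<dots> = poly Q \<eta>" unfolding pderiv_mult by (simp add: pderiv_pCons)
  finally have "of_nat m * \<eta> ^ (m - 1) = poly Q \<eta>"
    by (simp add: pderiv_diff pderiv_monom poly_monom)
  then show ?thesis by (simp add: Q_def poly_prod)
qed

text \<open>If \<open>\<zeta>\<^sup>p\<close> were not a root of \<open>f\<close>, then \<open>f(\<zeta>\<^sup>p)\<close>, which is divisible by \<open>p\<close> by Frobenius,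
  would divide \<open>m\<close> up to a unit.\<close>

lemma prime_power_root_of_unity_divisor:
  assumes m: "0 < m" and z: "\<zeta> ^ m = 1" and p: "prime p" "\<not> p dvd m"
    and f: "lead_coeff f = 1" "cpoly f dvd monom 1 m - 1" "poly (cpoly f) \<zeta> = 0"
  shows "poly (cpoly f) (\<zeta> ^ p) = 0"
proof (rule ccontr)
  define R where "R = {w::complex. w ^ m = 1}"
  define Z where "Z = {w. poly (cpoly f) w = 0}"
  define \<eta> where "\<eta> = \<zeta> ^ p"
  assume "poly (cpoly f) (\<zeta> ^ p) \<noteq> 0"
  then have ne: "\<eta> \<notin> Z" by (simp add: Z_def \<eta>_def)
  have finR: "finite R" unfolding R_def using m by (intro finite_roots_unity) simp
  have eR: "\<eta> \<in> R" using z by (simp add: R_def \<eta>_def) (metis power_mult mult.commute power_one)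
  have e1: "\<eta> ^ m = 1" using eR by (simp add: R_def)
  have sub: "Z \<subseteq> R"
  proof
    fix w assume "w \<in> Z"
    then have "poly (cpoly f) w = 0" by (simp add: Z_def)
    then have "poly (monom 1 m - 1) w = 0" using f(2) by (metis dvdE poly_mult mult_zero_left)
    then show "w \<in> R" by (simp add: R_def poly_monom)
  qed
  have "rsquarefree (cpoly f)"
    unfolding rsquarefree_roots
  proof (intro allI notI, elim conjE)
    fix a assume a: "poly (cpoly f) a = 0" "poly (pderiv (cpoly f)) a = 0"
    obtain g where g: "monom 1 m - 1 = cpoly f * g" using f(2) by blast
    have "poly (pderiv (monom 1 m - 1)) a = 0" unfolding g pderiv_mult using a by simp
    then have "of_nat m * a ^ (m - 1) = 0" by (simp add: pderiv_diff pderiv_monom poly_monom)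
    moreover have "a ^ m = 1" using sub a(1) by (auto simp: Z_def R_def)
    ultimately show False using m by (auto simp: power_0_left)
  qed
  moreover have "lead_coeff (cpoly f) = 1" using f(1) by (simp add: lead_coeff_map_poly_nz)
  ultimately have fac: "cpoly f = (\<Prod>w\<in>Z. [:- w, 1:])"
    using complex_poly_decompose_rsquarefree[of "cpoly f"] by (simp add: Z_def)
  \<comment> \<open>This takes the place of Gauss's lemma: coefficients of products of linear
    factors with roots in \<open>R\<close> lie in \<open>root_ring m\<close>, so those of
    \<open>f\<close>, being rational as well, are integers.\<close>
  have "coeff (\<Prod>w\<in>A. [:- w, 1:]) i \<in> root_ring m" if "A \<subseteq> R" for A i
    using finite_subset[OF that finR] that
  proof (induction A arbitrary: i rule: finite_induct)
    case empty
    then show ?case by (auto simp: coeff_1 intro: root_ring_0 root_ring_1)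
  next
    case (insert w A)
    then have "coeff (\<Prod>w\<in>A. [:- w, 1:]) k \<in> root_ring m" for k by simp
    moreover have "w \<in> root_ring m" using insert by (auto simp: R_def intro: root_ring.root)
    ultimately show ?case using insert
      by (cases i) (auto simp: coeff_pCons intro!: root_ring_diff root_ring_mult root_ring.neg)
  qed
  then have "coeff (cpoly f) i \<in> root_ring m" for i unfolding fac using sub by simp
  then have ints: "coeff (cpoly f) i \<in> \<int>" for i using root_ring_rational[OF m] by (simp add: coeff_map_poly)
  define g where "g = map_poly (\<lambda>c. \<lfloor>c\<rfloor>) f"
  have "coeff f i \<in> \<int>" for i using ints[of i] by (simp add: coeff_map_poly) (metis Ints_cases Ints_of_int of_rat_eq_iff of_rat_of_int_eq)
  then have fg: "cpoly f = map_poly of_int g"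
  proof (intro poly_eqI)
    fix n
    obtain k where "coeff f n = of_int k" using \<open>\<And>i. coeff f i \<in> \<int>\<close>[of n] by (auto elim: Ints_cases)
    then show "coeff (cpoly f) n = coeff (map_poly of_int g) n" by (simp add: coeff_map_poly g_def)
  qed
  have zr: "\<zeta> \<in> root_ring m" using z by (rule root_ring.root)
  obtain \<beta> where b: "\<beta> \<in> root_ring m" "poly (cpoly f) \<eta> = of_nat p * \<beta>"
    using frobenius_int_poly[OF p(1) zr, of g] f(3) prime_gt_0_nat[OF p(1)] by (auto simp: fg \<eta>_def power_0_left)
  \<comment> \<open>The cofactor of the value of \<open>f\<close> at \<eta> in the product over all
    other roots of unity; since \<eta> is not in \<open>Z\<close>, the two factors together make up
    the whole product.\<close>
  define \<gamma> where "\<gamma> = (\<Prod>w\<in>R - {\<eta>} - Z. \<eta> - w)"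
  have g: "\<gamma> \<in> root_ring m" unfolding \<gamma>_def
    using eR by (intro root_ring_prod root_ring_diff root_ring.root) (auto simp: R_def)
  have "of_nat m * \<eta> ^ (m - 1) = (\<Prod>w\<in>R - {\<eta>}. \<eta> - w)" using prod_diff_other_roots[OF m e1] by (simp add: R_def)
  also have "\<dots> = \<gamma> * (\<Prod>w\<in>Z. \<eta> - w)" unfolding \<gamma>_def
    using finR sub ne by (intro prod.subset_diff) auto
  also have "(\<Prod>w\<in>Z. \<eta> - w) = poly (cpoly f) \<eta>" unfolding fac by (simp add: poly_prod)
  finally have "of_nat m * \<eta> ^ (m - 1) = of_nat p * (\<beta> * \<gamma>)" using b by simp
  then have "of_nat m * (\<eta> ^ (m - 1) * \<eta>) = of_nat p * (\<beta> * \<gamma> * \<eta>)" by (simp only: mult.assoc[symmetric])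
  moreover have "\<eta> ^ (m - 1) * \<eta> = 1" using e1 m by (metis power_minus_mult)
  ultimately have "of_nat m = of_nat p * (\<beta> * \<gamma> * \<eta>)" by (simp only: mult_1_right)
  moreover have "\<beta> * \<gamma> * \<eta> \<in> root_ring m" using b g root_ring.root[OF e1] by (intro root_ring_mult)
  ultimately have "p dvd m" using root_ring_dvd[OF m] prime_gt_0_nat[OF p(1)] by blast
  then show False using p by simp
qed

text \<open>A greatest common divisor of \<open>g\<close> and the polynomial of the roots of unity
  still vanishes at \<zeta>, by Bezout. Made monic, it satisfies the hypotheses of the previous
  lemma, and its roots are roots of \<open>g\<close>.\<close>

lemma rat_poly_root_power_prime:
  assumes m: "0 < m" and z: "\<zeta> ^ m = 1" and p: "prime p" "\<not> p dvd m" and g: "poly (cpoly g) \<zeta> = 0"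
  shows "poly (cpoly g) (\<zeta> ^ p) = 0"
proof -
  define h :: "rat poly" where "h = monom 1 m - 1"
  have ch: "cpoly h = monom 1 m - 1"
    by (rule poly_eqI) (auto simp: h_def coeff_map_poly of_rat_diff coeff_1)
  have "h \<noteq> 0"
  proof
    assume "h = 0"
    then have "cpoly h = 0" by simp
    then have "poly (cpoly h) 0 = 0" by simp
    then show False using m unfolding ch by (simp add: poly_monom power_0_left)
  qed
  define d where "d = gcd g h"
  have d0: "d \<noteq> 0" using \<open>h \<noteq> 0\<close> by (simp add: d_def)
  define f where "f = smult (inverse (lead_coeff d)) d"
  have lc: "lead_coeff d \<noteq> 0" using d0 by simp
  have fl: "lead_coeff f = 1" using lc by (simp add: f_def)
  have fd: "f dvd g" "f dvd h" using lc by (simp_all add: f_def d_def smult_dvd_iff)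
  have cdvd: "cpoly f dvd cpoly k" if "f dvd k" for k using that by (auto simp: cpoly_mult elim!: dvdE)
  obtain a b where ab: "bezout_coefficients g h = (a, b)" by fastforce
  have "a * g + b * h = d" using bezout_coefficients[OF ab] by (simp add: d_def)
  then have "cpoly d = cpoly a * cpoly g + cpoly b * cpoly h" by (simp flip: cpoly_mult cpoly_add)
  then have "poly (cpoly d) \<zeta> = 0" using g z by (simp add: ch poly_monom)
  moreover have "cpoly f = smult (of_rat (inverse (lead_coeff d))) (cpoly d)"
    by (rule poly_eqI) (simp add: f_def coeff_map_poly of_rat_mult)
  ultimately have "poly (cpoly f) \<zeta> = 0" by simp
  then have "poly (cpoly f) (\<zeta> ^ p) = 0"
    using prime_power_root_of_unity_divisor[OF m z p fl] cdvd[OF fd(2)] by (simp add: ch)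
  then show ?thesis using cdvd[OF fd(1)] by (auto elim!: dvdE)
qed

text \<open>The irreducibility of the cyclotomic polynomials in the form used later: a rational
  polynomial relation passes from \<zeta>, of any order dividing \<open>m\<close>, to
  \<open>\<zeta> ^ t\<close>. The prime factors of \<open>t\<close> are split off one at a
  time.\<close>

theorem rat_poly_root_power_coprime:
  assumes m: "0 < m" and z: "\<zeta> ^ m = 1" and t: "coprime t m" and g: "poly (cpoly g) \<zeta> = 0"
  shows "poly (cpoly g) (\<zeta> ^ t) = 0"
  using t
proof (induction t rule: less_induct)
  case (less t)
  consider "t = 0" | "t = 1" | "t \<noteq> 0" "t \<noteq> 1" by blast
  then show ?case
  proof cases
    case 1
    then have "m = 1" using less.prems by simp
    then show ?thesis using z g 1 by simp
  next
    case 2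
    then show ?thesis using g by simp
  next
    case 3
    then obtain p s where p: "prime p" "t = p * s" using prime_factor_nat by (metis dvdE)
    have "s < t" using p 3 prime_gt_1_nat[OF p(1)] by simp
    moreover have "coprime s m" "\<not> p dvd m" using less.prems p
      by (simp_all add: prime_imp_coprime_nat coprime_mult_left_iff) (metis coprime_absorb_left coprime_mult_left_iff not_prime_unit p(1))
    ultimately have "poly (cpoly g) (\<zeta> ^ s) = 0" by (intro less.IH)
    moreover have "(\<zeta> ^ s) ^ m = 1" using z by (metis power_mult mult.commute power_one)
    ultimately have "poly (cpoly g) ((\<zeta> ^ s) ^ p) = 0" using rat_poly_root_power_prime[OF m] p(1) \<open>\<not> p dvd m\<close> by blast
    then show ?thesis by (simp add: p(2) power_mult[symmetric] mult.commute)
  qed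
qed

text \<open>Stands in for automorphisms of a cyclotomic field: an identity between powers of \<zeta>
  is written as the vanishing of such a function at \<zeta>, and passing to
  \<open>\<zeta> ^ t\<close> is then a statement about rational polynomials.\<close>

definition rat_fun :: "(complex \<Rightarrow> complex) \<Rightarrow> bool" where
  "rat_fun F \<longleftrightarrow> (\<exists>g. \<forall>z. F z = poly (cpoly g) z)"

lemma rat_fun_const: "rat_fun (\<lambda>z. of_rat c)"
  unfolding rat_fun_def by (intro exI[of _ "[:c:]"]) (cases "c = 0"; simp)

lemma rat_fun_power: "rat_fun (\<lambda>z. z ^ n)"
  unfolding rat_fun_def by (intro exI[of _ "monom 1 n"]) (simp add: map_poly_monom poly_monom)

lemma rat_fun_add: "rat_fun F \<Longrightarrow> rat_fun G \<Longrightarrow> rat_fun (\<lambda>z. F z + G z)"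
  unfolding rat_fun_def by (metis cpoly_add poly_add)

lemma rat_fun_mult: "rat_fun F \<Longrightarrow> rat_fun G \<Longrightarrow> rat_fun (\<lambda>z. F z * G z)"
  unfolding rat_fun_def by (metis cpoly_mult poly_mult)

lemma rat_fun_diff: 
  assumes "rat_fun F" "rat_fun G"
  shows "rat_fun (\<lambda>z. F z - G z)"
  using rat_fun_add[OF assms(1) rat_fun_mult[OF rat_fun_const[of "-1"] assms(2)]] by simp

lemma rat_fun_pow: "rat_fun F \<Longrightarrow> rat_fun (\<lambda>z. F z ^ n)"
  by (induction n) (use rat_fun_const[of 1] in \<open>auto intro: rat_fun_mult\<close>)

lemma rat_fun_sum: "(\<And>i. i \<in> A \<Longrightarrow> rat_fun (F i)) \<Longrightarrow> rat_fun (\<lambda>z. \<Sum>i\<in>A. F i z)"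
  by (induction A rule: infinite_finite_induct) (use rat_fun_const[of 0] in \<open>auto intro: rat_fun_add\<close>)

lemma rat_fun_conjugate:
  assumes "0 < m" "\<zeta> ^ m = 1" "coprime t m" "rat_fun F" "F \<zeta> = 0"
  shows "F (\<zeta> ^ t) = 0"
  using assms rat_poly_root_power_coprime unfolding rat_fun_def by metis

definition degree_at_most :: "nat \<Rightarrow> complex \<Rightarrow> bool" where
  "degree_at_most D x \<longleftrightarrow> (\<exists>g :: rat poly. g \<noteq> 0 \<and> degree g \<le> D \<and> poly (cpoly g) x = 0)"

text \<open>Raising to an inverse of \<open>t\<close> modulo \<open>m\<close> undoes the power
  \<open>t\<close>.\<close>

lemma coprime_power_inj:
  assumes "0 < m" "coprime t m" "(v::complex) ^ m = 1" "w ^ m = 1" "v ^ t = w ^ t"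
  shows "v = w"
proof (cases "m = 1")
  case True
  then show ?thesis using assms by simp
next
  case False
  obtain t' where "[t * t' = 1] (mod m)" using cong_solve_coprime_nat[OF assms(2)] by auto
  then have e: "(t * t') mod m = 1" using False assms(1) by (simp add: Cong.cong_def)
  have "u ^ (t * t') = u" if "u ^ m = 1" for u :: complex
  proof -
    have "u ^ (t * t') = (u ^ m) ^ ((t * t') div m) * u ^ ((t * t') mod m)"
      by (simp add: power_mult[symmetric] power_add[symmetric])
    then show ?thesis using that e by simp
  qed
  then show ?thesis using assms(3-5) by (metis power_mult)
qed

text \<open>The conjugates \<open>y k\<close> of the cross ratio under \<open>\<zeta> \<mapsto> \<zeta> ^ (t ^ k)\<close> take at most \<open>D\<close> values,
  so two of the first \<open>D + 1\<close> agree, and their distance divides \<open>fact D\<close>.\<close>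

lemma cross_ratio_power_fact:
  fixes w1 w2 w3 w4 :: complex
  assumes m: "0 < m" and w: "w1 ^ m = 1" "w2 ^ m = 1" "w3 ^ m = 1" "w4 ^ m = 1" "w1 \<noteq> w3" "w2 \<noteq> w4"
    and x: "degree_at_most D x" and eq: "(w1 - w2) * (w3 - w4) = x * ((w1 - w3) * (w2 - w4))"
    and t: "coprime t m" and s: "s = t ^ fact D"
  shows "(w1 ^ s - w2 ^ s) * (w3 ^ s - w4 ^ s) = x * ((w1 ^ s - w3 ^ s) * (w2 ^ s - w4 ^ s))"
proof -
  define \<zeta> where "\<zeta> = cis (2 * pi / m)"
  have z: "\<zeta> ^ m = 1" using cis_root_power[OF m] by (simp add: \<zeta>_def)
  obtain a1 a2 a3 a4 where a: "w1 = \<zeta> ^ a1" "w2 = \<zeta> ^ a2" "w3 = \<zeta> ^ a3" "w4 = \<zeta> ^ a4"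
    using root_of_unity_eq_power[OF m] w(1-4) unfolding \<zeta>_def by metis
  define A B where "A = (\<lambda>z::complex. (z ^ a1 - z ^ a2) * (z ^ a3 - z ^ a4))"
    and "B = (\<lambda>z::complex. (z ^ a1 - z ^ a3) * (z ^ a2 - z ^ a4))"
  have rAB: "rat_fun A" "rat_fun B" unfolding A_def B_def by (intro rat_fun_mult rat_fun_diff rat_fun_power)+
  define Z where "Z = (\<lambda>k. \<zeta> ^ (t ^ k))"
  have Zm: "Z k ^ m = 1" for k using z by (simp add: Z_def power_mult[symmetric] mult.commute) (simp add: power_mult)
  have ct: "coprime (t ^ k) m" for k using t by simp
  have sw: "(\<zeta> ^ n) ^ a = (\<zeta> ^ a) ^ n" for n a by (metis power_mult mult.commute)
  have B0: "B (Z k) \<noteq> 0" for k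
    using coprime_power_inj[OF m ct[of k] w(1,3)] coprime_power_inj[OF m ct[of k] w(2,4)] w(5,6)
    by (auto simp: B_def Z_def sw a)
  define y where "y = (\<lambda>k. A (Z k) / B (Z k))"
  have y0: "y 0 = x" using eq B0[of 0] by (simp add: y_def A_def B_def Z_def a)
  obtain g :: "rat poly" where g: "g \<noteq> 0" "degree g \<le> D" "poly (cpoly g) x = 0" using x by (auto simp: degree_at_most_def)
  \<comment> \<open>The homogenised \<open>g\<close>: where \<open>B z\<close> is nonzero it equals
    \<open>B z ^ degree g\<close> times the value of \<open>g\<close> at \<open>A z / B z\<close>,
    but it contains no division and is therefore a \<open>rat_fun\<close>.\<close>
  define H where "H = (\<lambda>z. \<Sum>i\<le>degree g. of_rat (coeff g i) * (A z ^ i * B z ^ (degree g - i)))"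
  have rH: "rat_fun H" unfolding H_def using rAB by (intro rat_fun_sum rat_fun_mult rat_fun_const rat_fun_pow)
  have Hy: "H (Z k) = B (Z k) ^ degree g * poly (cpoly g) (y k)" for k
  proof -
    have "degree (cpoly g) = degree g" by (rule degree_map_poly) simp
    then have "B (Z k) ^ degree g * poly (cpoly g) (y k) = (\<Sum>i\<le>degree g. of_rat (coeff g i) * (B (Z k) ^ degree g * y k ^ i))"
      by (simp add: poly_altdef coeff_map_poly sum_distrib_left mult_ac)
    also have "\<dots> = H (Z k)" unfolding H_def
    proof (intro sum.cong refl)
      fix i assume "i \<in> {..degree g}"
      then have "B (Z k) ^ degree g = B (Z k) ^ (degree g - i) * B (Z k) ^ i" by (simp add: power_add[symmetric])
      then have "B (Z k) ^ degree g * y k ^ i = A (Z k) ^ i * B (Z k) ^ (degree g - i)"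
        using B0[of k] by (simp add: y_def power_divide)
      then show "of_rat (coeff g i) * (B (Z k) ^ degree g * y k ^ i) = of_rat (coeff g i) * (A (Z k) ^ i * B (Z k) ^ (degree g - i))"
        by simp
    qed
    finally show ?thesis by simp
  qed
  have "H \<zeta> = 0" using Hy[of 0] g(3) y0 by (simp add: Z_def)
  then have "H (Z k) = 0" for k unfolding Z_def by (intro rat_fun_conjugate[OF m z ct rH])
  then have root: "poly (cpoly g) (y k) = 0" for k using Hy[of k] B0[of k] by simp
  have cg: "cpoly g \<noteq> 0" using g(1) by (simp add: map_poly_eq_0_iff)
  have "\<not> inj_on y {..D}"
  proof
    assume "inj_on y {..D}"
    then have "card (y ` {..D}) = Suc D" by (simp add: card_image)
    moreover have "card (y ` {..D}) \<le> card {v. poly (cpoly g) v = 0}"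
      using root poly_roots_finite[OF cg] by (intro card_mono) auto
    moreover have "card {v. poly (cpoly g) v = 0} \<le> degree (cpoly g)" by (rule card_poly_roots_bound[OF cg])
    moreover have "degree (cpoly g) = degree g" by (rule degree_map_poly) simp
    ultimately show False using g(2) by simp
  qed
  then obtain i j where ij: "i < j" "j \<le> D" "y i = y j" by (metis atMost_iff inj_onI linorder_neqE_nat)
  define d where "d = j - i"
  \<comment> \<open>The cross-multiplied form of \<open>y k = y (k + d)\<close>, again free of
    denominators.\<close>
  define E where "E = (\<lambda>z. A z * B (z ^ (t ^ d)) - A (z ^ (t ^ d)) * B z)"
  have rE: "rat_fun E"
  proof -
    have "rat_fun (\<lambda>z. A (z ^ n))" "rat_fun (\<lambda>z. B (z ^ n))" for n
      unfolding A_def B_def power_mult[symmetric] by (intro rat_fun_mult rat_fun_diff rat_fun_power)+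
    then show ?thesis unfolding E_def using rAB by (intro rat_fun_diff rat_fun_mult)
  qed
  have ZE: "Z k ^ (t ^ d) = Z (k + d)" for k by (simp add: Z_def power_mult[symmetric] power_add[symmetric])
  have Ey: "E (Z k) = 0 \<longleftrightarrow> y k = y (k + d)" for k
    using B0[of k] B0[of "k + d"] by (simp add: E_def ZE y_def field_simps)
  \<comment> \<open>The coincidence \<open>y i = y j\<close> is transported from \<open>Z i\<close>
    back to \<zeta> by an inverse of \<open>t\<close> modulo \<open>m\<close>, and from there to
    every \<open>Z k\<close>. Hence \<open>y\<close> is periodic from index 0 on, and the value at 0
    recurs.\<close>
  obtain t' where t': "[t * t' = 1] (mod m)" using cong_solve_coprime_nat[OF t] by auto
  then have ct': "coprime t' m" using t by (metis cong_imp_coprime cong_sym coprime_1_left coprime_mult_left_iff)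
  have "(Z i) ^ (t' ^ i) = \<zeta>"
  proof -
    have c: "[t ^ i * t' ^ i = 1] (mod m)" using cong_pow[OF t', of i] by (simp add: power_mult_distrib)
    have "\<zeta> ^ n = \<zeta> ^ n'" if "[n = n'] (mod m)" for n n'
    proof -
      have *: "\<zeta> ^ n = \<zeta> ^ (n mod m)" for n
      proof -
        have "\<zeta> ^ n = (\<zeta> ^ m) ^ (n div m) * \<zeta> ^ (n mod m)" by (simp add: power_mult[symmetric] power_add[symmetric])
        then show ?thesis using z by simp
      qed
      show ?thesis using *[of n] *[of n'] that by (simp add: Cong.cong_def)
    qed
    from this[OF c] show ?thesis by (simp add: Z_def power_mult[symmetric])
  qed
  moreover have "E (Z i) = 0" using ij Ey[of i] by (simp add: d_def)
  ultimately have "E \<zeta> = 0" using rat_fun_conjugate[OF m Zm, of "t' ^ i" E i] ct' rE by simp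
  then have "E (Z k) = 0" for k unfolding Z_def by (intro rat_fun_conjugate[OF m z ct rE])
  then have per: "y k = y (k + d)" for k using Ey by blast
  have yk: "y (k * d) = x" for k
  proof (induction k)
    case (Suc k)
    then show ?case using per[of "k * d"] by (simp add: add.commute)
  qed (simp add: y0)
  have "d dvd fact D" using ij by (intro dvd_fact) (auto simp: d_def)
  then have "y (fact D) = x" using yk by (metis dvd_def mult.commute)
  then have "A (Z (fact D)) = x * B (Z (fact D))" using B0[of "fact D"] by (simp add: y_def field_simps)
  then show ?thesis by (simp add: A_def B_def Z_def s a sw)
qed

text \<open>With \<open>z1\<close>, \<open>z2\<close>, \<open>z3\<close> fixed, equality of the
  cross ratios is an equation that is affine in each of \<open>w\<close> and \<open>f w\<close>.
  Solving it for \<open>f w\<close> gives the coefficients, with determinant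
  \<open>P * Q * (f z2 - f z3) * (z2 - z3)\<close>.\<close>

lemma moebius_interpolation:
  fixes f :: "complex \<Rightarrow> complex"
  assumes W: "3 \<le> card W" "inj_on f W"
    and cr: "\<And>w1 w2 w3 w4. w1 \<in> W \<Longrightarrow> w2 \<in> W \<Longrightarrow> w3 \<in> W \<Longrightarrow> w4 \<in> W \<Longrightarrow>
      (w1 - w2) * (w3 - w4) * ((f w1 - f w3) * (f w2 - f w4)) =
      (f w1 - f w2) * (f w3 - f w4) * ((w1 - w3) * (w2 - w4))"
  shows "\<exists>a b c d. a * d - b * c \<noteq> 0 \<and> (\<forall>w\<in>W. f w * (c * w + d) = a * w + b)"
proof -
  obtain T where T: "T \<subseteq> W" "card T = 3" using W(1) by (metis obtain_subset_with_card_n)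
  then obtain z1 z2 z3 where z: "T = {z1, z2, z3}" "z1 \<noteq> z2" "z1 \<noteq> z3" "z2 \<noteq> z3" by (auto simp: card_3_iff)
  then have zW: "z1 \<in> W" "z2 \<in> W" "z3 \<in> W" using T by auto
  define P Q where "P = (z1 - z2) * (f z1 - f z3)" and "Q = (f z1 - f z2) * (z1 - z3)"
  have fz: "f z1 \<noteq> f z2" "f z1 \<noteq> f z3" "f z2 \<noteq> f z3" using z zW W(2) by (auto dest: inj_onD)
  have "(P * f z2 - Q * f z3) * (Q * z2 - P * z3) - (Q * f z3 * z2 - P * f z2 * z3) * (P - Q) =
      P * Q * (f z2 - f z3) * (z2 - z3)" by (simp add: algebra_simps)
  moreover have "P * Q * (f z2 - f z3) * (z2 - z3) \<noteq> 0" using fz z by (simp add: P_def Q_def)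
  moreover have "f w * ((P - Q) * w + (Q * z2 - P * z3)) = (P * f z2 - Q * f z3) * w + (Q * f z3 * z2 - P * f z2 * z3)" if "w \<in> W" for w
  proof -
    have "P * ((z3 - w) * (f z2 - f w)) - Q * ((f z3 - f w) * (z2 - w)) = 0"
      using cr[OF zW that] by (simp add: P_def Q_def mult_ac)
    moreover have "f w * ((P - Q) * w + (Q * z2 - P * z3)) - ((P * f z2 - Q * f z3) * w + (Q * f z3 * z2 - P * f z2 * z3)) =
        P * ((z3 - w) * (f z2 - f w)) - Q * ((f z3 - f w) * (z2 - w))"
      by (simp add: algebra_simps)
    ultimately show ?thesis by simp
  qed
  ultimately show ?thesis by metis
qed

section \<open>Finite differences of bounded integer sequences\<close>

definition fdiff :: "(nat \<Rightarrow> int) \<Rightarrow> nat \<Rightarrow> int" where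
  "fdiff f k = f (Suc k) - f k"

text \<open>A shift of the argument preserves the leading coefficient, so each difference lowers the
  degree.\<close>

lemma fdiff_power_poly:
  "p = 0 \<or> degree p < n \<Longrightarrow> (fdiff ^^ n) (\<lambda>k. poly p (of_nat k)) = (\<lambda>k. 0)"
proof (induction n arbitrary: p)
  case (Suc n)
  define q where "q = pcompose p [:1, 1:] - p"
  have "fdiff (\<lambda>k. poly p (of_nat k)) = (\<lambda>k. poly q (of_nat k))"
    by (simp add: fdiff_def q_def poly_pcompose fun_eq_iff add.commute)
  moreover have "q = 0 \<or> degree q < n"
  proof (cases "p = 0 \<or> degree p = 0")
    case True
    then have "q = 0" unfolding q_def by (auto elim: degree_eq_zeroE simp: pcompose_pCons)
    then show ?thesis ..
  next
    case False
    have dp: "degree (pcompose p [:1, 1:]) = degree p" by simp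
    then have "degree q \<le> degree p" unfolding q_def by (intro degree_diff_le) auto
    moreover have "coeff q (degree p) = 0"
      using lead_coeff_comp[of "[:1, 1:]" p] dp by (simp add: q_def)
    ultimately have "q = 0 \<or> degree q < degree p" using eq_zero_or_degree_less by blast
    then show ?thesis using Suc.prems False by auto
  qed
  ultimately show ?case using Suc.IH[of q] by (simp add: funpow_swap1)
qed simp

text \<open>By induction the first difference, which is bounded by \<open>2 * B\<close>, is
  constant, so \<open>v\<close> is an arithmetic progression; a nonzero integer step would leave a
  range of width \<open>2 * B\<close> within \<open>2 * B + 1\<close> steps. The bound doubles with
  each difference, hence the power of 2 in the required length.\<close>

lemma fdiff_bounded_constant:
  assumes "1 \<le> n" "\<And>i. i \<le> L \<Longrightarrow> \<bar>v i\<bar> \<le> int B" "\<And>k. k + n \<le> L \<Longrightarrow> (fdiff ^^ n) v k = 0"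
    "n + 2 ^ Suc n * B \<le> L" "i + n \<le> L"
  shows "v (Suc i) = v i"
  using assms
proof (induction n arbitrary: v L B i rule: nat_induct_at_least)
  case base
  then show ?case by (simp add: fdiff_def)
next
  case (Suc n)
  define w where "w = fdiff v"
  have step: "w (Suc i) = w i" if "i + n \<le> L - 1" for i
  proof (rule Suc.IH[of "L - 1" w "2 * B"])
    show "\<bar>w i\<bar> \<le> int (2 * B)" if "i \<le> L - 1" for i
    proof -
      have "i \<le> L" "Suc i \<le> L" using that Suc.prems(3) by simp_all
      then show ?thesis using Suc.prems(1)[of i] Suc.prems(1)[of "Suc i"] by (simp add: w_def fdiff_def)
    qed
    show "(fdiff ^^ n) w k = 0" if "k + n \<le> L - 1" for k
      using Suc.prems(2)[of k] Suc.prems(3) that by (simp add: w_def funpow_swap1)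
    show "n + 2 ^ Suc n * (2 * B) \<le> L - 1" using Suc.prems(3) by simp
  qed (use that in auto)
  have w0: "w i = w 0" if "i + n \<le> L" for i
    using that
  proof (induction i)
    case (Suc i)
    then show ?case using step[of i] by simp
  qed simp
  have lin: "v i = v 0 + int i * w 0" if "i + n \<le> Suc L" for i
    using that
  proof (induction i)
    case (Suc i)
    then show ?case using w0[of i] by (simp add: w_def fdiff_def algebra_simps)
  qed simp
  have "w 0 = 0"
  proof (rule ccontr)
    assume "w 0 \<noteq> 0"
    define N where "N = 2 * B + 1"
    have le: "2 * B \<le> 2 ^ Suc (Suc n) * B" by (intro mult_right_mono) auto
    then have NL: "N + n \<le> Suc L" "N \<le> L" using Suc.prems(3) Suc.hyps unfolding N_def by linarith+
    have "int N * 1 \<le> int N * \<bar>w 0\<bar>" using \<open>w 0 \<noteq> 0\<close> by (intro mult_left_mono) auto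
    also have "\<dots> = \<bar>v N - v 0\<bar>" using lin[OF NL(1)] by (simp add: abs_mult)
    also have "\<dots> \<le> 2 * int B" using Suc.prems(1)[of N] Suc.prems(1)[of 0] NL by simp
    finally show False by (simp add: N_def)
  qed
  then show ?case using w0[of i] Suc.prems(4) by (simp add: w_def fdiff_def)
qed

section \<open>Roots of unity whose cross ratios have bounded degree\<close>

text \<open>Numerator and denominator of the iterated quotients \<open>f (k + 1) / f k\<close>,
  starting from the fractions \<open>f k = N k / D k\<close>: the multiplicative analogue of
  \<open>fdiff\<close>. Nothing is cancelled, so degrees stay explicit, and zeros and poles are read
  off as differences of orders.\<close>

fun fdiff_num :: "(nat \<Rightarrow> complex poly) \<Rightarrow> (nat \<Rightarrow> complex poly) \<Rightarrow> nat \<Rightarrow> nat \<Rightarrow> complex poly"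
  and fdiff_den :: "(nat \<Rightarrow> complex poly) \<Rightarrow> (nat \<Rightarrow> complex poly) \<Rightarrow> nat \<Rightarrow> nat \<Rightarrow> complex poly" where
  "fdiff_num N D 0 k = N k"
| "fdiff_den N D 0 k = D k"
| "fdiff_num N D (Suc n) k = fdiff_num N D n (Suc k) * fdiff_den N D n k"
| "fdiff_den N D (Suc n) k = fdiff_den N D n (Suc k) * fdiff_num N D n k"

lemma fdiff_Suc: "(fdiff ^^ Suc n) f k = (fdiff ^^ n) f (Suc k) - (fdiff ^^ n) f k"
  by (simp add: fdiff_def)

context
  fixes N D :: "nat \<Rightarrow> complex poly"
  assumes nz: "\<And>k. N k \<noteq> 0" "\<And>k. D k \<noteq> 0"
begin

lemma fdiff_num_den_nz: "fdiff_num N D n k \<noteq> 0 \<and> fdiff_den N D n k \<noteq> 0"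
  by (induction n arbitrary: k) (use nz in auto)

text \<open>\<open>order\<close> turns products into sums, so iterated quotients become ordinary
  differences.\<close>

lemma order_fdiff_num_den:
  "int (order a (fdiff_num N D n k)) - int (order a (fdiff_den N D n k)) =
   (fdiff ^^ n) (\<lambda>k. int (order a (N k)) - int (order a (D k))) k"
proof (induction n arbitrary: k)
  case (Suc n)
  show ?case
    using fdiff_num_den_nz[of n k] fdiff_num_den_nz[of n "Suc k"] Suc[of k] Suc[of "Suc k"]
    by (simp add: order_mult fdiff_Suc del: funpow.simps)
qed simp

lemma degree_fdiff_num_den:
  assumes "\<And>k. degree (N k) \<le> 1" "\<And>k. degree (D k) \<le> 1"
  shows "degree (fdiff_num N D n k) \<le> 2 ^ n \<and> degree (fdiff_den N D n k) \<le> 2 ^ n"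
proof (induction n arbitrary: k)
  case (Suc n)
  have d: "degree (fdiff_num N D n (Suc k)) \<le> 2 ^ n" "degree (fdiff_den N D n (Suc k)) \<le> 2 ^ n"
    "degree (fdiff_num N D n k) \<le> 2 ^ n" "degree (fdiff_den N D n k) \<le> 2 ^ n"
    using Suc[of k] Suc[of "Suc k"] by simp_all
  have "degree (fdiff_num N D (Suc n) k) \<le> 2 ^ n + 2 ^ n"
    unfolding fdiff_num.simps by (rule order_trans[OF degree_mult_le add_mono[OF d(1) d(4)]])
  moreover have "degree (fdiff_den N D (Suc n) k) \<le> 2 ^ n + 2 ^ n"
    unfolding fdiff_den.simps by (rule order_trans[OF degree_mult_le add_mono[OF d(2) d(3)]])
  ultimately show ?case by simp
qed (use assms in simp)

text \<open>At a point where the fractions take the values \<open>w ^ s k\<close>, the iterated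
  quotients are powers of \<open>w\<close> whose exponents are the differences of \<open>s\<close>.
  These may be negative, hence \<open>powi\<close>.\<close>

lemma poly_fdiff_num_den:
  assumes "w \<noteq> 0" "\<And>k. k \<le> L \<Longrightarrow> w ^ s k * poly (D k) w = poly (N k) w" "k + n \<le> L"
  shows "w powi ((fdiff ^^ n) (\<lambda>k. int (s k)) k) * poly (fdiff_den N D n k) w = poly (fdiff_num N D n k) w"
  using assms(3)
proof (induction n arbitrary: k)
  case (Suc n)
  have 1: "w powi ((fdiff ^^ n) (\<lambda>k. int (s k)) k) * poly (fdiff_den N D n k) w = poly (fdiff_num N D n k) w"
    using Suc by simp
  have 2: "w powi ((fdiff ^^ n) (\<lambda>k. int (s k)) (Suc k)) * poly (fdiff_den N D n (Suc k)) w = poly (fdiff_num N D n (Suc k)) w"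
    using Suc by simp
  show ?case
    using assms(1) by (simp add: fdiff_Suc power_int_diff flip: 1 2 del: funpow.simps)
qed (use assms(2) in simp)

end

lemma poly_eqI_card:
  fixes p q :: "complex poly"
  assumes "finite W" "\<And>w. w \<in> W \<Longrightarrow> poly p w = poly q w" "degree p < card W" "degree q < card W"
  shows "p = q"
proof (rule ccontr)
  assume "p \<noteq> q"
  then have nz: "p - q \<noteq> 0" by simp
  have "card W \<le> card {w. poly (p - q) w = 0}"
    using assms(2) poly_roots_finite[OF nz] by (intro card_mono) auto
  also have "\<dots> \<le> degree (p - q)" by (rule card_poly_roots_bound[OF nz])
  also have "\<dots> \<le> max (degree p) (degree q)" by (rule degree_diff_le_max)
  finally show False using assms(3,4) by simp
qed



text \<open>The vanishing of the \<open>(e + 1)\<close>-st differences of \<open>(1 + i R) ^ e\<close> turns into an identity between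
  products of the Moebius maps, valid on \<open>W\<close> and hence everywhere. So the order of these maps at a
  fixed point is a bounded sequence with vanishing differences, that is, it is constant in \<open>i\<close>;
  all of them have the divisor of the identity map, the one for \<open>i = 0\<close>.\<close>

lemma moebius_powers_trivial:
  fixes W :: "complex set"
  assumes W: "finite W" "1 \<in> W" "0 \<notin> W" "2 ^ (e + 1) < card W" "3 < card W" and e: "1 \<le> e"
    and L: "(e + 1) + 2 ^ (e + 2) \<le> L"
    and M: "\<And>i. i \<le> L \<Longrightarrow> \<exists>a b c d. a * d - b * c \<noteq> 0 \<and> (\<forall>w\<in>W. w ^ ((1 + i * R) ^ e) * (c * w + d) = a * w + b)"
    and w: "w \<in> W"
  shows "w ^ ((1 + R) ^ e) = w"
proof -
  define s where "s = (\<lambda>i. (1 + i * R) ^ e)"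
  \<comment> \<open>Beyond \<open>L\<close> the identity map serves as a default, since the lemmas
    on \<open>fdiff_num\<close> and \<open>fdiff_den\<close> ask for nonzero polynomials at every
    index.\<close>
  have "\<exists>a b c d :: complex. a * d - b * c \<noteq> 0 \<and> (i \<le> L \<longrightarrow> (\<forall>w\<in>W. w ^ s i * (c * w + d) = a * w + b))" for i
  proof (cases "i \<le> L")
    case True
    then show ?thesis using M[OF True] by (simp add: s_def)
  next
    case False
    then show ?thesis by (rule_tac x = 1 in exI, rule_tac x = 0 in exI, rule_tac x = 0 in exI, rule_tac x = 1 in exI) simp
  qed
  then obtain a b c d :: "nat \<Rightarrow> complex" where det: "\<And>i. a i * d i - b i * c i \<noteq> 0"
    and eq: "\<And>i w. i \<le> L \<Longrightarrow> w \<in> W \<Longrightarrow> w ^ s i * (c i * w + d i) = a i * w + b i"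
    by metis
  define N D where "N = (\<lambda>i. [:b i, a i:])" and "D = (\<lambda>i. [:d i, c i:])"
  have nz: "N i \<noteq> 0" "D i \<noteq> 0" for i using det[of i] by (auto simp: N_def D_def)
  have deg: "degree (N i) \<le> 1" "degree (D i) \<le> 1" for i by (simp_all add: N_def D_def)
  have rel: "w ^ s k * poly (D k) w = poly (N k) w" if "w \<in> W" "k \<le> L" for w k
    using eq[OF that(2,1)] by (simp add: N_def D_def add.commute mult.commute)
  have ds: "(fdiff ^^ (e + 1)) (\<lambda>k. int (s k)) = (\<lambda>k. 0)"
  proof -
    have "(\<lambda>k. int (s k)) = (\<lambda>k. poly ([:1, int R:] ^ e) (of_nat k))"
      by (simp add: s_def fun_eq_iff)
    moreover have "degree ([:1, int R:] ^ e) \<le> degree [:1, int R:] * e" by (rule degree_power_le)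
    moreover have "degree [:1, int R:] \<le> 1" by simp
    ultimately show ?thesis using fdiff_power_poly[of "[:1, int R:] ^ e" "e + 1"]
      by (simp only:) (metis add.commute le_imp_less_Suc le_trans mult_le_mono1 mult_1 plus_1_eq_Suc)
  qed
  define v where "v = (\<lambda>\<alpha> k. int (order \<alpha> (N k)) - int (order \<alpha> (D k)))"
  have v0: "(fdiff ^^ (e + 1)) (v \<alpha>) k = 0" if k: "k + (e + 1) \<le> L" for \<alpha> k
  proof -
    have "fdiff_num N D (e + 1) k = fdiff_den N D (e + 1) k"
    proof (rule poly_eqI_card[OF W(1)])
      fix w assume "w \<in> W"
      then have "w \<noteq> 0" using W(3) by auto
      from poly_fdiff_num_den[of N D w L s k "e + 1", OF nz this rel[OF \<open>w \<in> W\<close>] k]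
      show "poly (fdiff_num N D (e + 1) k) w = poly (fdiff_den N D (e + 1) k) w" unfolding ds by (simp only: power_int_0_right mult_1)
    next
      have dg: "degree (fdiff_num N D (e + 1) k) \<le> 2 ^ (e + 1)" "degree (fdiff_den N D (e + 1) k) \<le> 2 ^ (e + 1)"
        using degree_fdiff_num_den[of N D, OF nz deg, where n = "e + 1" and k = k] by blast+
      show "degree (fdiff_num N D (e + 1) k) < card W" using dg(1) W(4) by (rule order.strict_trans1)
      show "degree (fdiff_den N D (e + 1) k) < card W" using dg(2) W(4) by (rule order.strict_trans1)
    qed
    then show ?thesis using order_fdiff_num_den[of N D, OF nz, where a = \<alpha> and n = "e + 1" and k = k] by (simp only: v_def diff_self)
  qed
  have ord1: "order \<alpha> (N k) \<le> 1" "order \<alpha> (D k) \<le> 1" for \<alpha> k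
    using order_degree[OF nz(1)] order_degree[OF nz(2)] deg le_trans by blast+
  have v1: "v \<alpha> 1 = v \<alpha> 0" for \<alpha>
  proof -
    \<comment> \<open>Polynomials of degree at most 1 have order at most 1 at \<alpha>, so the
      sequence is bounded by 1, and \<open>L\<close> was taken long enough for that bound.\<close>
    have "v \<alpha> (Suc 0) = v \<alpha> 0"
    proof (rule fdiff_bounded_constant[of "e + 1" L "v \<alpha>" 1])
      show "\<bar>v \<alpha> i\<bar> \<le> int 1" for i using ord1[of \<alpha> i] by (simp add: v_def)
    qed (use v0 L in auto)
    then show ?thesis by simp
  qed
  \<comment> \<open>\<open>s 0 = 1\<close>, so the map with index 0 agrees with the identity on
    \<open>W\<close>; both sides have degree at most 2, and \<open>W\<close> has more than 3
    points.\<close>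
  have N0: "N 0 = [:0, 1:] * D 0"
  proof (rule poly_eqI_card[OF W(1)])
    show "poly (N 0) w = poly ([:0, 1:] * D 0) w" if "w \<in> W" for w using rel[OF that, of 0] by (simp add: s_def)
    have "degree ([:0, 1:] * D 0) \<le> degree [:0, 1::complex:] + degree (D 0)" by (rule degree_mult_le)
    also have "\<dots> \<le> 2" using deg(2)[of 0] by simp
    finally show "degree ([:0, 1:] * D 0) < card W" using W(5) by simp
    show "degree (N 0) < card W" using deg(1)[of 0] W(5) by simp
  qed
  have v00: "v \<alpha> 0 = int (order \<alpha> [:0, 1:])" for \<alpha>
  proof -
    have "order \<alpha> (N 0) = order \<alpha> [:0, 1:] + order \<alpha> (D 0)"
      unfolding N0 by (rule order_mult) (use nz(1)[of 0] in \<open>simp only: N0 not_False_eq_True\<close>)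
    then show ?thesis by (simp add: v_def)
  qed
  have "order 0 [:0, 1::complex:] \<noteq> 0" using order_root[of "[:0, 1::complex:]" 0] by simp
  then have "order 0 (N 1) \<noteq> 0" using v1[of 0] v00[of 0] by (auto simp: v_def)
  then have "poly (N 1) 0 = 0" by (simp add: order_root)
  then have b: "b 1 = 0" by (simp add: N_def)
  then have ad: "a 1 \<noteq> 0" "d 1 \<noteq> 0" using det[of 1] by auto
  \<comment> \<open>A pole other than 0 would also be a zero, because the orders of
    \<open>N 1\<close> and \<open>D 1\<close> agree there; but \<open>N 1\<close> vanishes only at
    0.\<close>
  have c: "c 1 = 0"
  proof (rule ccontr)
    assume c: "c 1 \<noteq> 0"
    define \<alpha> where "\<alpha> = - d 1 / c 1"
    have al: "\<alpha> \<noteq> 0" "poly (D 1) \<alpha> = 0" using c ad by (simp_all add: \<alpha>_def D_def)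
    then have "order \<alpha> [:0, 1::complex:] = 0" by (intro order_0I) simp
    then have "int (order \<alpha> (N 1)) = int (order \<alpha> (D 1))" using v1[of \<alpha>] v00[of \<alpha>] by (simp add: v_def)
    moreover have "order \<alpha> (D 1) \<noteq> 0" using al(2) nz(2)[of 1] by (simp add: order_root)
    ultimately have "poly (N 1) \<alpha> = 0" by (simp add: order_root)
    then show False using b ad al by (simp add: N_def)
  qed
  have L1: "1 \<le> L" using L by simp
  have "d 1 = a 1" using eq[OF L1 W(2)] b c by simp
  then show ?thesis using eq[OF L1 w] b c ad by (simp add: s_def)
qed

section \<open>A bound for the order of the roots\<close>

lemma coprime_part_split:
  "0 < m \<Longrightarrow> \<exists>m1 m2 k. m = m1 * m2 \<and> coprime m2 P \<and> m1 dvd (P::nat) ^ k"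
proof (induction m rule: less_induct)
  case (less m)
  show ?case
  proof (cases "coprime m P")
    case True
    then show ?thesis by (intro exI[of _ 1] exI[of _ m] exI[of _ 0]) simp
  next
    case False
    define g where "g = gcd m P"
    have g: "g dvd m" "g dvd P" "g \<noteq> 1" using False coprime_iff_gcd_eq_1 unfolding g_def by blast+
    then obtain m' where m': "m = g * m'" by blast
    have g0: "0 < g" "0 < m'" using m' less.prems by auto
    then have "m' < m" using g(3) m' by simp
    then obtain m1 m2 k where h: "m' = m1 * m2" "coprime m2 P" "m1 dvd P ^ k" using less.IH g0 by blast
    then have "g * m1 dvd P ^ Suc k" using g by (simp add: mult_dvd_mono)
    then show ?thesis using h m' by (intro exI[of _ "g * m1"] exI[of _ m2] exI[of _ "Suc k"]) simp
  qed
qed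

lemma power_gcd_eq_1:
  fixes w :: "'a::field"
  assumes "w ^ a = 1" "w ^ b = 1" "0 < a"
  shows "w ^ gcd a b = 1"
proof -
  obtain x y where xy: "a * x = b * y + gcd a b" using bezout_nat[of a b] assms(3) by auto
  have "1 = w ^ (a * x)" using assms(1) by (simp add: power_mult)
  also have "\<dots> = (w ^ b) ^ y * w ^ gcd a b" unfolding xy by (simp add: power_add power_mult)
  finally show ?thesis using assms(2) by simp
qed

text \<open>With \<open>P = fact (L + 1)\<close>, split \<open>m\<close> into \<open>m1\<close>, all
  of whose primes divide \<open>P\<close>, and \<open>m2\<close>, coprime to \<open>P\<close>, and
  choose \<open>R\<close> congruent to \<open>P\<close> modulo \<open>m1\<close> and to 1 modulo
  \<open>m2\<close>. A prime of \<open>m1\<close> divides \<open>R\<close>, and a prime of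
  \<open>m2\<close> divides none of the numbers \<open>1 + i\<close> up to \<open>L + 1\<close>; so
  all \<open>1 + i * R\<close> are coprime to \<open>m\<close>. The resulting congruence says that
  \<open>m1\<close> divides \<open>(1 + P) ^ e - 1\<close> and \<open>m2\<close> divides
  \<open>2 ^ e - 1\<close>, both positive.\<close>

lemma modulus_bounded:
  assumes m: "0 < m" and e: "1 \<le> e"
    and R: "\<And>R. (\<And>i. i \<le> L \<Longrightarrow> coprime (1 + i * R) m) \<Longrightarrow> [(1 + R) ^ e = 1] (mod m)"
  shows "m \<le> (1 + fact (L + 1)) ^ e * 2 ^ e"
proof -
  define P :: nat where "P = fact (L + 1)"
  obtain m1 m2 k where sp: "m = m1 * m2" "coprime m2 P" "m1 dvd P ^ k" using coprime_part_split[OF m] by blast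
  have pos: "0 < m1" "0 < m2" using m sp by auto
  have "coprime m1 m2" using sp(2,3) by (meson coprime_commute coprime_divisors coprime_power_left_iff dvd_refl)
  then obtain R where Rc: "[R = P] (mod m1)" "[R = 1] (mod m2)" using binary_chinese_remainder_nat by blast
  have "coprime (1 + i * R) m" if "i \<le> L" for i
  proof (rule ccontr)
    assume "\<not> coprime (1 + i * R) m"
    then have "gcd (1 + i * R) m \<noteq> 1" using coprime_iff_gcd_eq_1 by blast
    then obtain p where p: "prime p" "p dvd gcd (1 + i * R) m" using prime_factor_nat by blast
    then have pd: "p dvd 1 + i * R" "p dvd m1 \<or> p dvd m2" using sp(1) prime_dvd_mult_nat by auto
    show False
    proof (cases "p dvd m1")
      case True
      then have "p dvd P" using sp(3) p(1) prime_dvd_power by (meson dvd_trans)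
      moreover have "[R = P] (mod p)" using Rc(1) True cong_dvd_modulus_nat by blast
      ultimately have "p dvd R" using cong_dvd_iff by blast
      then have "p dvd 1" using pd(1) by (metis dvd_add_left_iff dvd_mult)
      then show False using p(1) not_prime_unit by blast
    next
      case False
      then have pm2: "p dvd m2" using pd by blast
      then have "[R = 1] (mod p)" using Rc(2) cong_dvd_modulus_nat by blast
      then have "[1 + i * R = 1 + i * 1] (mod p)" by (intro cong_add cong_mult cong_refl)
      then have "p dvd 1 + i" using pd(1) cong_dvd_iff by fastforce
      moreover have "1 + i dvd P" unfolding P_def using that by (intro dvd_fact) auto
      ultimately have "p dvd P" using dvd_trans by blast
      then show False using pm2 sp(2) p(1) by (meson coprime_common_divisor not_prime_unit)
    qed
  qed
  then have c: "[(1 + R) ^ e = 1] (mod m)" using R by blast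
  have bnd: "n \<le> (1 + Q) ^ e" if "n dvd m" "[R = Q] (mod n)" "0 < Q" for n Q :: nat
  proof -
    have "[(1 + Q) ^ e = (1 + R) ^ e] (mod n)" using that(2) by (intro cong_pow cong_add cong_refl) (rule cong_sym)
    also have "[(1 + R) ^ e = 1] (mod n)" using c that(1) cong_dvd_modulus_nat by blast
    finally have "n dvd (1 + Q) ^ e - 1" by (simp add: cong_altdef_nat)
    moreover have "1 < (1 + Q) ^ e" using that(3) e by (intro one_less_power) auto
    ultimately have "n \<le> (1 + Q) ^ e - 1" by (intro dvd_imp_le) auto
    then show ?thesis by simp
  qed
  have "m1 \<le> (1 + P) ^ e" using sp(1) Rc(1) by (intro bnd) (auto simp: P_def)
  moreover have "m2 \<le> 2 ^ e" using bnd[of m2 1] sp(1) Rc(2) by (simp add: numeral_2_eq_2)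
  ultimately have "m1 * m2 \<le> (1 + P) ^ e * 2 ^ e" by (rule mult_le_mono)
  then show ?thesis unfolding sp(1)[symmetric] P_def .
qed

theorem card_roots_of_unity_bounded:
  obtains B where "\<And>W m. finite W \<Longrightarrow> 0 < m \<Longrightarrow> (\<And>w. w \<in> W \<Longrightarrow> w ^ m = 1) \<Longrightarrow>
    (\<And>w1 w2 w3 w4. w1 \<in> W \<Longrightarrow> w2 \<in> W \<Longrightarrow> w3 \<in> W \<Longrightarrow> w4 \<in> W \<Longrightarrow> w1 \<noteq> w3 \<Longrightarrow> w2 \<noteq> w4 \<Longrightarrow>
      \<exists>x. degree_at_most D x \<and> (w1 - w2) * (w3 - w4) = x * ((w1 - w3) * (w2 - w4))) \<Longrightarrow> card W \<le> B"
proof -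
  define e :: nat where "e = fact D"
  define L where "L = (e + 1) + 2 ^ (e + 2)"
  have e1: "1 \<le> e" by (simp add: e_def)
  \<comment> \<open>The summands serve the three uses of a large \<open>W\<close>: enough points to
    fix a Moebius map, enough points to identify polynomials of degree \<open>2 ^ (e + 1)\<close>,
    and more points than there are roots of unity of an order allowed by
    \<open>modulus_bounded\<close>.\<close>
  define B :: nat where "B = 3 + 2 ^ (e + 1) + (1 + fact (L + 1)) ^ e * 2 ^ e"
  have normalised: "card W \<le> B"
    if W: "finite W" "1 \<in> W" and m0: "0 < m0" "\<And>w. w \<in> W \<Longrightarrow> w ^ m0 = 1"
    and x: "\<And>w1 w2 w3 w4. w1 \<in> W \<Longrightarrow> w2 \<in> W \<Longrightarrow> w3 \<in> W \<Longrightarrow> w4 \<in> W \<Longrightarrow> w1 \<noteq> w3 \<Longrightarrow> w2 \<noteq> w4 \<Longrightarrow>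
      \<exists>x. degree_at_most D x \<and> (w1 - w2) * (w3 - w4) = x * ((w1 - w3) * (w2 - w4))"
    for W :: "complex set" and m0
  proof (rule ccontr)
    assume "\<not> card W \<le> B"
    then have big: "3 < card W" "2 ^ (e + 1) < card W" "(1 + fact (L + 1)) ^ e * 2 ^ e < card W" by (simp_all add: B_def)
    \<comment> \<open>The least common exponent is taken so that every exponent that kills all of
      \<open>W\<close> is a multiple of it; this turns triviality on \<open>W\<close> into a
      congruence modulo \<open>m\<close>.\<close>
    define m where "m = (LEAST m. 0 < m \<and> (\<forall>w\<in>W. w ^ m = 1))"
    have m: "0 < m" "\<And>w. w \<in> W \<Longrightarrow> w ^ m = 1"
      using LeastI[of "\<lambda>m. 0 < m \<and> (\<forall>w\<in>W. w ^ m = 1)" m0] m0 unfolding m_def by blast+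
    have mmin: "m \<le> k" if "0 < k" "\<And>w. w \<in> W \<Longrightarrow> w ^ k = 1" for k
      unfolding m_def using that by (intro Least_le) blast
    have W0: "0 \<notin> W"
    proof
      assume "0 \<in> W"
      then have "(0::complex) ^ m = 1" by (rule m(2))
      then show False using m(1) by (simp add: power_0_left)
    qed
    have mdvd: "m dvd k" if "\<And>w. w \<in> W \<Longrightarrow> w ^ k = 1" for k
    proof -
      have "m \<le> gcd m k" using m that by (intro mmin power_gcd_eq_1) auto
      then have "gcd m k = m" using dvd_imp_le[OF gcd_dvd1 m(1), of k] by linarith
      then show ?thesis by (metis gcd_dvd2)
    qed
    have "[(1 + R) ^ e = 1] (mod m)" if cop: "\<And>i. i \<le> L \<Longrightarrow> coprime (1 + i * R) m" for R
    proof -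
      have "w ^ ((1 + R) ^ e) = w" if w: "w \<in> W" for w
      proof (rule moebius_powers_trivial[OF W W0 big(2,1) e1 _ _ w])
        show "e + 1 + 2 ^ (e + 2) \<le> L" by (simp add: L_def)
        fix i assume "i \<le> L"
        define s where "s = (1 + i * R) ^ e"
        have cs: "coprime s m" using cop[OF \<open>i \<le> L\<close>] by (simp add: s_def)
        have "\<exists>a b c d. a * d - b * c \<noteq> 0 \<and> (\<forall>w\<in>W. w ^ s * (c * w + d) = a * w + b)"
        proof (rule moebius_interpolation)
          show "inj_on (\<lambda>w. w ^ s) W" using coprime_power_inj[OF m(1) cs] m(2) by (intro inj_onI) blast
          fix w1 w2 w3 w4 assume w: "w1 \<in> W" "w2 \<in> W" "w3 \<in> W" "w4 \<in> W"
          show "(w1 - w2) * (w3 - w4) * ((w1 ^ s - w3 ^ s) * (w2 ^ s - w4 ^ s)) =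
            (w1 ^ s - w2 ^ s) * (w3 ^ s - w4 ^ s) * ((w1 - w3) * (w2 - w4))"
          proof (cases "w1 = w3 \<or> w2 = w4")
            case False
            then obtain x where "degree_at_most D x" "(w1 - w2) * (w3 - w4) = x * ((w1 - w3) * (w2 - w4))"
              using x[OF w] by blast
            moreover from this have "(w1 ^ s - w2 ^ s) * (w3 ^ s - w4 ^ s) = x * ((w1 ^ s - w3 ^ s) * (w2 ^ s - w4 ^ s))"
              using cross_ratio_power_fact[OF m(1) m(2)[OF w(1)] m(2)[OF w(2)] m(2)[OF w(3)] m(2)[OF w(4)]] False
                cop[OF \<open>i \<le> L\<close>] by (simp add: s_def e_def)
            ultimately show ?thesis by simp
          qed auto
        qed (use big in simp)
        then show "\<exists>a b c d. a * d - b * c \<noteq> 0 \<and> (\<forall>w\<in>W. w ^ ((1 + i * R) ^ e) * (c * w + d) = a * w + b)"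
          by (simp add: s_def)
      qed
      then have "w ^ ((1 + R) ^ e - 1) = 1" if "w \<in> W" for w
      proof -
        have "w \<noteq> 0" using that W0 by auto
        have "w ^ ((1 + R) ^ e - 1) * w = w ^ ((1 + R) ^ e)" by (rule power_minus_mult) simp
        then show ?thesis using \<open>w \<noteq> 0\<close> \<open>\<And>w. w \<in> W \<Longrightarrow> w ^ ((1 + R) ^ e) = w\<close>[OF that] by simp
      qed
      then have "m dvd (1 + R) ^ e - 1" by (rule mdvd)
      then show ?thesis by (simp add: cong_altdef_nat)
    qed
    then have "m \<le> (1 + fact (L + 1)) ^ e * 2 ^ e" by (rule modulus_bounded[OF m(1) e1])
    moreover have "card W \<le> card {z::complex. z ^ m = 1}"
      using m by (intro card_mono finite_roots_unity) auto
    moreover have "card {z::complex. z ^ m = 1} = m" using m(1) by (simp add: card_roots_unity_eq)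
    ultimately show False using big(3) by simp
  qed
  show ?thesis
  proof (rule that[of B])
    fix W :: "complex set" and m :: nat
    assume W: "finite W" "0 < m" "\<And>w. w \<in> W \<Longrightarrow> w ^ m = 1"
      and x: "\<And>w1 w2 w3 w4. w1 \<in> W \<Longrightarrow> w2 \<in> W \<Longrightarrow> w3 \<in> W \<Longrightarrow> w4 \<in> W \<Longrightarrow> w1 \<noteq> w3 \<Longrightarrow> w2 \<noteq> w4 \<Longrightarrow>
        \<exists>x. degree_at_most D x \<and> (w1 - w2) * (w3 - w4) = x * ((w1 - w3) * (w2 - w4))"
    show "card W \<le> B"
    proof (cases "W = {}")
      case False
      then obtain w0 where w0: "w0 \<in> W" by blast
      then have "w0 \<noteq> 0" using W(2) W(3)[OF w0] by (auto simp: power_0_left)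
      \<comment> \<open>Division by an element of \<open>W\<close> puts 1 into the set and leaves
        cross ratios unchanged.\<close>
      define f where "f = (\<lambda>w. w / w0)"
      have "card (f ` W) \<le> B"
      proof (rule normalised[OF _ _ W(2)])
        show "1 \<in> f ` W" using w0 \<open>w0 \<noteq> 0\<close> by (intro image_eqI[of _ _ w0]) (auto simp: f_def)
        show "w ^ m = 1" if "w \<in> f ` W" for w using that W(3) w0 by (auto simp: f_def power_divide)
        fix w1 w2 w3 w4 assume "w1 \<in> f ` W" "w2 \<in> f ` W" "w3 \<in> f ` W" "w4 \<in> f ` W" and ne: "w1 \<noteq> w3" "w2 \<noteq> w4"
        then obtain v1 v2 v3 v4 where v: "v1 \<in> W" "v2 \<in> W" "v3 \<in> W" "v4 \<in> W"
          "w1 = f v1" "w2 = f v2" "w3 = f v3" "w4 = f v4" by blast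
        then obtain x where xx: "degree_at_most D x" "(v1 - v2) * (v3 - v4) = x * ((v1 - v3) * (v2 - v4))"
          using x[OF v(1-4)] ne by blast
        have "(w1 - w2) * (w3 - w4) = ((v1 - v2) * (v3 - v4)) / w0\<^sup>2"
          "(w1 - w3) * (w2 - w4) = ((v1 - v3) * (v2 - v4)) / w0\<^sup>2"
          unfolding v(5-8) f_def by (simp_all add: diff_divide_distrib[symmetric] power2_eq_square)
        then show "\<exists>x. degree_at_most D x \<and> (w1 - w2) * (w3 - w4) = x * ((w1 - w3) * (w2 - w4))"
          using xx by (intro exI[of _ x]) simp
      qed (use W(1) in simp)
      moreover have "card (f ` W) = card W" using \<open>w0 \<noteq> 0\<close> by (intro card_image inj_onI) (simp add: f_def)
      ultimately show ?thesis by simp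
    qed simp
  qed
qed

section \<open>Runs of two balanced point sets\<close>

definition orient :: "complex \<Rightarrow> complex \<Rightarrow> complex \<Rightarrow> real" where
  "orient p q r = (Re q - Re p) * (Im r - Im p) - (Im q - Im p) * (Re r - Re p)"

lemma orient_uminus: "orient (-p) (-q) (-r) = orient p q r"
  by (simp add: orient_def algebra_simps)

lemma orient_rotate: "orient p q r = orient q r p"
  by (simp add: orient_def algebra_simps)

lemma orient_swap: "orient q p r = - orient p q r"
  by (simp add: orient_def algebra_simps)

lemma convex_horizontal:
  assumes "convex K" "c \<in> K" "s \<in> K" "Im c = Im q" "Im s = Im q" "Re c \<le> Re q" "Re q \<le> Re s"
  shows "q \<in> K"
proof (cases "Re c = Re s")
  case True
  with assms have "q = c" by (intro complex_eqI) auto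
  with assms show ?thesis by simp
next
  case False
  define t where "t = (Re q - Re c) / (Re s - Re c)"
  have pos: "Re s - Re c > 0" using False assms by linarith
  have t: "0 \<le> t" "t \<le> 1" using assms pos by (auto simp: t_def field_simps)
  have "t * (Re s - Re c) = Re q - Re c" using pos by (simp add: t_def)
  then have "Re q = (1 - t) * Re c + t * Re s" by (simp add: algebra_simps)
  moreover have "Im q = (1 - t) * Im c + t * Im s" using assms by (simp add: algebra_simps)
  ultimately have "q = (1 - t) *\<^sub>R c + t *\<^sub>R s" by (intro complex_eqI) simp_all
  then show ?thesis using convexD_alt[OF assms(1-3) t] by simp
qed

text \<open>The level of \<open>q\<close> meets the chord in a point \<open>s\<close> that is not to
  the left of \<open>q\<close>, while \<open>c\<close> is not to the right of it; so
  \<open>q\<close> is between two points of \<open>K\<close>.\<close>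

lemma convex_left_of_chord:
  assumes K: "convex K" "a \<in> K" "b \<in> K" "c \<in> K"
    and h: "Im a \<le> Im q" "Im q \<le> Im b" "Im a < Im b" "Im c = Im q" "Re c \<le> Re q"
    and o: "orient a b q \<ge> 0"
  shows "q \<in> K"
proof -
  define t where "t = (Im q - Im a) / (Im b - Im a)"
  define s where "s = (1 - t) *\<^sub>R a + t *\<^sub>R b"
  have t: "0 \<le> t" "t \<le> 1" using h by (auto simp: t_def field_simps)
  have tm: "t * (Im b - Im a) = Im q - Im a" using h by (simp add: t_def)
  have "s \<in> K" using convexD_alt[OF K(1-3) t] by (simp add: s_def)
  moreover have "Im s = Im q"
    using tm by (simp add: s_def algebra_simps)
  moreover have "Re q \<le> Re s"
  proof -
    have "(Im b - Im a) * (Re q - Re a) \<le> (Re b - Re a) * (Im q - Im a)" using o by (simp add: orient_def)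
    also have "\<dots> = (Im b - Im a) * (t * (Re b - Re a))" by (simp flip: tm)
    finally have "Re q - Re a \<le> t * (Re b - Re a)" using h by (simp add: mult_le_cancel_left_pos)
    then show ?thesis by (simp add: s_def algebra_simps)
  qed
  ultimately show ?thesis by (rule convex_horizontal[OF K(1) K(4) _ h(4) _ h(5)])
qed

lemma convex_right_of_chord:
  assumes K: "convex K" "a \<in> K" "b \<in> K" "c \<in> K"
    and h: "Im a \<le> Im q" "Im q \<le> Im b" "Im a < Im b" "Im c = Im q" "Re q \<le> Re c"
    and o: "orient a b q \<le> 0"
  shows "q \<in> K"
proof -
  have "- q \<in> uminus ` K"
  proof (rule convex_left_of_chord[of _ "-b" "-a" "-c"])
    show "convex (uminus ` K)" using K(1) by (rule convex_negations)
    show "orient (- b) (- a) (- q) \<ge> 0"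
      unfolding orient_uminus using o orient_swap[of a b q] by linarith
    show "-b \<in> uminus ` K" "-a \<in> uminus ` K" "-c \<in> uminus ` K"
      using K(2-4) by (auto intro: imageI)
  qed (use h in simp_all)
  then show ?thesis by (simp add: inj_image_mem_iff)
qed

text \<open>\<open>f\<close> numbers the maximal blocks of consecutive elements on which
  \<open>c\<close> is constant. Neighbouring blocks differ in \<open>c\<close>, so the parity of the
  number encodes \<open>c\<close>. In the induction a new maximum either joins the last block or
  opens another one.\<close>

lemma finite_blocks:
  fixes H :: "real set" and c :: "real \<Rightarrow> bool"
  assumes "finite H" "H \<noteq> {}"
  shows "\<exists>(f::real \<Rightarrow> nat) b. mono_on H f \<and> f ` H = {..<b} \<and> (\<forall>s\<in>H. \<forall>t\<in>H. even (f s + f t) \<longleftrightarrow> c s = c t)"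
  using assms
proof (induction H rule: finite_linorder_max_induct)
  case empty
  then show ?case by simp
next
  case (insert t H)
  show ?case
  proof (cases "H = {}")
    case True
    then show ?thesis 
      by (intro exI[of _ "\<lambda>_. 0"] exI[of _ "Suc 0"]) (simp add: monotone_on_def lessThan_Suc)
  next
    case False
    from insert.IH[OF False] obtain f :: "real \<Rightarrow> nat" and b where f0: "mono_on H f \<and> f ` H = {..<b} \<and>
      (\<forall>s\<in>H. \<forall>t\<in>H. even (f s + f t) \<longleftrightarrow> c s = c t)" by (elim exE)
    then have f: "mono_on H f" "f ` H = {..<b}"
      "\<And>s t. s \<in> H \<Longrightarrow> t \<in> H \<Longrightarrow> even (f s + f t) \<longleftrightarrow> c s = c t"
      by simp_all
    define m where "m = Max H"
    have m: "m \<in> H" "\<And>s. s \<in> H \<Longrightarrow> s \<le> m" using insert(1) False by (auto simp: m_def)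
    have fm: "f s \<le> f m" if "s \<in> H" for s using f(1) m that by (auto simp: monotone_on_def)
    have "b > 0" using f(2) False by auto
    then have "b - 1 \<in> f ` H" using f(2) by auto
    then obtain s where "s \<in> H" "f s = b - 1" by auto
    with fm have "b - 1 \<le> f m" by force
    moreover have "f m < b" using f(2) m by auto
    ultimately have fmb: "Suc (f m) = b" by simp
    define g where "g = (\<lambda>s. if s = t then (if c t = c m then f m else Suc (f m)) else f s)"
    define b' where "b' = (if c t = c m then b else Suc b)"
    have tH: "t \<notin> H" using insert(2) by auto
    have gH: "g s = f s" if "s \<in> H" for s using that tH by (auto simp: g_def)
    have "mono_on (insert t H) g"
    proof (rule monotone_onI)
      fix x y assume xy: "x \<in> insert t H" "y \<in> insert t H" "x \<le> y"
      consider "x \<in> H" "y \<in> H" | "x \<in> H" "y = t" | "x = t" "y = t"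
        using xy insert(2) by force
      then show "g x \<le> g y"
      proof cases
        case 1
        then show ?thesis using gH f(1) xy(3) by (simp add: monotone_on_def)
      next
        case 2
        then show ?thesis using gH[OF 2(1)] fm[OF 2(1)] by (simp add: g_def)
      qed simp
    qed
    moreover have "g ` insert t H = {..<b'}"
    proof -
      have "g ` H = {..<b}" using gH f(2) by (metis image_cong)
      then have "g ` insert t H = insert (g t) {..<b}" by simp
      also have "\<dots> = {..<b'}" using fmb by (auto simp: g_def b'_def)
      finally show ?thesis .
    qed
    moreover have "even (g s + g s') \<longleftrightarrow> c s = c s'" if st: "s \<in> insert t H" "s' \<in> insert t H" for s s'
    proof -
      have gt: "even (g t + g s) \<longleftrightarrow> c t = c s" if "s \<in> H" for s
        unfolding gH[OF that] using f(3)[OF m(1) that] by (cases "c t = c m") (simp_all add: g_def, metis)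
      have gs: "even (g s + g s') \<longleftrightarrow> c s = c s'" if "s \<in> H" "s' \<in> H" for s s'
        unfolding gH[OF that(1)] gH[OF that(2)] by (rule f(3)[OF that])
      consider "s \<in> H" "s' \<in> H" | "s \<in> H" "s' = t" | "s = t" "s' \<in> H" | "s = t" "s' = t"
        using st by blast
      then show ?thesis
      proof cases
        case 2
        then show ?thesis using gt[OF 2(1)] by (metis add.commute)
      qed (use gt gs in auto)
    qed
    ultimately show ?thesis by blast
  qed
qed

text \<open>The situation after a rotation that makes the direction of the X-rays horizontal, so
  that lines are levels of \<open>Im\<close>. \<open>X\<close> and \<open>Y\<close> are the two set
  differences and act as two colours.\<close>

locale balanced_pair =
  fixes X Y :: "complex set"
  assumes finX: "finite X" and finY: "finite Y"
    and XY: "X \<inter> convex hull Y = {}" and YX: "Y \<inter> convex hull X = {}"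
    and balanced: "\<And>t. card {x \<in> X. Im x = t} = card {y \<in> Y. Im y = t}"
begin

definition same :: "complex \<Rightarrow> complex \<Rightarrow> bool" where
  "same p q \<longleftrightarrow> (p \<in> X \<longleftrightarrow> q \<in> X)"

definition other :: "complex \<Rightarrow> complex set" where
  "other p = convex hull (if p \<in> X then Y else X)"

text \<open>By balance every occupied level carries both colours, and by the hull conditions one
  colour lies entirely to the left of the other there. So \<open>rgt\<close> and \<open>lft\<close>
  divide the points into a right and a left side.\<close>

definition rgt :: "complex \<Rightarrow> bool" where
  "rgt p \<longleftrightarrow> p \<in> X \<union> Y \<and> (\<exists>q \<in> X \<union> Y. \<not> same p q \<and> Im q = Im p \<and> Re q < Re p)"

definition lft :: "complex \<Rightarrow> bool" where
  "lft p \<longleftrightarrow> p \<in> X \<union> Y \<and> (\<exists>q \<in> X \<union> Y. \<not> same p q \<and> Im q = Im p \<and> Re p < Re q)"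

lemma disj: "X \<inter> Y = {}"
  using XY hull_subset[of Y convex] by auto

lemma not_other: "p \<in> X \<union> Y \<Longrightarrow> p \<notin> other p"
  using XY YX disj by (auto simp: other_def)

lemma convex_other: "convex (other p)" by (simp add: other_def)

lemma mem_other: "q \<in> X \<union> Y \<Longrightarrow> \<not> same p q \<Longrightarrow> q \<in> other p"
  using disj hull_subset[of X convex] hull_subset[of Y convex]
  by (auto simp: other_def same_def)

lemma other_eq: "same p q \<Longrightarrow> other p = other q"
  by (simp add: other_def same_def)

lemma partner:
  assumes "p \<in> X \<union> Y"
  obtains q where "q \<in> X \<union> Y" "\<not> same p q" "Im q = Im p" "Re q \<noteq> Re p"
proof -
  have fin: "finite {x \<in> X. Im x = Im p}" "finite {x \<in> Y. Im x = Im p}" using finX finY by auto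
  have "\<exists>q\<in>X \<union> Y. \<not> same p q \<and> Im q = Im p"
  proof (cases "p \<in> X")
    case True
    then have "card {x \<in> X. Im x = Im p} \<noteq> 0" using fin by auto
    then have "{y \<in> Y. Im y = Im p} \<noteq> {}" using balanced[of "Im p"] by force
    then show ?thesis using True disj by (auto simp: same_def)
  next
    case False
    then have "p \<in> Y" using assms by auto
    then have "card {x \<in> Y. Im x = Im p} \<noteq> 0" using fin by auto
    then have "{y \<in> X. Im y = Im p} \<noteq> {}" using balanced[of "Im p"] by force
    then show ?thesis using False disj by (auto simp: same_def)
  qed
  then obtain q where q: "q\<in>X \<union> Y" "\<not> same p q" "Im q = Im p" by blast
  moreover have "Re q \<noteq> Re p"
  proof
    assume "Re q = Re p"
    with q have "p = q" by (intro complex_eqI) auto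
    with q show False by (simp add: same_def)
  qed
  ultimately show ?thesis using that by blast
qed

lemma rgt_or_lft: "p \<in> X \<union> Y \<Longrightarrow> rgt p \<or> lft p"
  using partner[of p] unfolding rgt_def lft_def by (metis linorder_neqE)

lemma not_between:
  assumes "p \<in> X \<union> Y" "q \<in> X \<union> Y" "r \<in> X \<union> Y" "Im p = Im q" "Im r = Im q"
    "\<not> same p q" "\<not> same r q" "Re p \<le> Re q" "Re q \<le> Re r"
  shows False
proof -
  have "p \<in> other q" "r \<in> other q"
    using mem_other[OF assms(1)] mem_other[OF assms(3)] assms(6,7) by (auto simp: same_def)
  then have "q \<in> other q" by (rule convex_horizontal[OF convex_other]) fact+
  then show False using not_other[OF assms(2)] by contradiction
qed

lemma rgt_line:
  assumes "rgt p" "r \<in> X \<union> Y" "Im r = Im p"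
  shows "same p r \<Longrightarrow> rgt r" "\<not> same p r \<Longrightarrow> lft r \<and> Re r < Re p" "\<not> lft p"
proof -
  obtain q where q: "q \<in> X \<union> Y" "\<not> same p q" "Im q = Im p" "Re q < Re p" "p \<in> X \<union> Y"
    using assms(1) by (auto simp: rgt_def)
  show "rgt r" if "same p r"
  proof -
    have rq: "\<not> same r q" "Im r = Im q" "Im p = Im q"
      using q(2,3) that assms(3) by (auto simp: same_def)
    then have "\<not> Re r \<le> Re q"
      using not_between[OF assms(2) q(1) q(5)] q(2,4) by auto
    then show ?thesis unfolding rgt_def using rq(1) rq(2)[symmetric] q(1) assms(2) by auto
  qed
  have *: "Re r < Re p" if "\<not> same p r" "r \<in> X \<union> Y" "Im r = Im p" for r
  proof (rule ccontr)
    assume "\<not> Re r < Re p"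
    moreover have "\<not> same q p" "\<not> same r p" using q(2) that(1) by (auto simp: same_def)
    ultimately show False using not_between[OF q(1) q(5) that(2) q(3) that(3)] q(4) by simp
  qed
  show "lft r \<and> Re r < Re p" if "\<not> same p r"
  proof
    show "Re r < Re p" using *[OF that assms(2,3)] .
    then show "lft r" unfolding lft_def using that q(5) assms(2) assms(3)[symmetric] by (auto simp: same_def)
  qed
  show "\<not> lft p"
  proof
    assume "lft p"
    then obtain r where "r \<in> X \<union> Y" "\<not> same p r" "Im r = Im p" "Re p < Re r" unfolding lft_def by blast
    then show False using *[of r] by simp
  qed
qed

text \<open>A half turn exchanges the two sides, so statements about the right side yield those
  about the left side.\<close>

lemma negated: "balanced_pair (uminus ` X) (uminus ` Y)"
proof
  have c: "card {x \<in> uminus ` A. Im x = t} = card {x \<in> A. Im x = - t}" for A :: "complex set" and t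
  proof -
    have "{x \<in> uminus ` A. Im x = t} = uminus ` {x \<in> A. Im x = - t}" by auto
    then show ?thesis by (simp add: card_image)
  qed
  show "card {x \<in> uminus ` X. Im x = t} = card {y \<in> uminus ` Y. Im y = t}" for t
    using balanced c by simp
  have h: "convex hull (uminus ` A) = uminus ` (convex hull A)" for A :: "complex set"
    using convex_hull_linear_image[of uminus A] by (simp add: bounded_linear.linear bounded_linear_minus bounded_linear_ident)
  show "uminus ` X \<inter> convex hull (uminus ` Y) = {}" "uminus ` Y \<inter> convex hull (uminus ` X) = {}"
    using XY YX by (auto simp: h)
qed (use finX finY in auto)

lemma negated_same: "balanced_pair.same (uminus ` X) (-p) (-q) = same p q"
  unfolding balanced_pair.same_def[OF negated] same_def by auto

lemma negated_rgt: "balanced_pair.rgt (uminus ` X) (uminus ` Y) (-p) = lft p"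
  unfolding balanced_pair.rgt_def[OF negated] lft_def
  by (auto simp: negated_same image_Un[symmetric])

lemma negated_lft: "balanced_pair.lft (uminus ` X) (uminus ` Y) (-p) = rgt p"
  unfolding balanced_pair.lft_def[OF negated] rgt_def
  by (auto simp: negated_same image_Un[symmetric])

end

text \<open>Horizontal displacement per unit of height, the reciprocal of the usual slope, because
  it is used for points on different levels.\<close>

definition slope :: "complex \<Rightarrow> complex \<Rightarrow> real" where
  "slope p q = (Re q - Re p) / (Im q - Im p)"

lemma orient_pos_iff_slope:
  assumes "Im p < Im q" "Im q < Im r"
  shows "0 < orient p q r \<longleftrightarrow> slope q r < slope p q"
proof -
  have "slope q r < slope p q \<longleftrightarrow> (Re r - Re q) * (Im q - Im p) < (Re q - Re p) * (Im r - Im q)"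
    using assms by (simp add: slope_def divide_less_eq less_divide_eq mult.commute)
  then show ?thesis by (simp add: orient_def algebra_simps)
qed

lemma orient_pos_slope_left:
  assumes "Im p < Im q" "Im q < Im r" "0 < orient p q r"
  shows "slope p r < slope p q"
proof -
  have "(Re r - Re p) * (Im q - Im p) < (Re q - Re p) * (Im r - Im p)"
    using assms(3) by (simp add: orient_def algebra_simps)
  moreover have "0 < Im q - Im p" "0 < Im r - Im p" using assms by auto
  ultimately show ?thesis by (simp add: slope_def divide_less_eq less_divide_eq mult.commute)
qed

lemma orient_pos_slope_right:
  assumes "Im p < Im q" "Im q < Im r" "0 < orient p q r"
  shows "slope q r < slope p r"
proof -
  have "(Re r - Re q) * (Im r - Im p) < (Re r - Re p) * (Im r - Im q)"
    using assms(3) by (simp add: orient_def algebra_simps)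
  moreover have "0 < Im r - Im q" "0 < Im r - Im p" using assms by auto
  ultimately show ?thesis by (simp add: slope_def divide_less_eq less_divide_eq mult.commute)
qed

section \<open>Orientation of points from different runs\<close>

context balanced_pair
begin

text \<open>Otherwise \<open>q\<close> would lie, on its own level, between an opposite point to its
  left and the chord, hence in the hull of the other colour.\<close>

lemma rgt_right_of_chord:
  assumes "rgt q" "a \<in> other q" "b \<in> other q" "Im a \<le> Im q" "Im q \<le> Im b" "Im a < Im b"
  shows "orient a b q < 0"
proof (rule ccontr)
  obtain c where c: "q \<in> X \<union> Y" "c \<in> X \<union> Y" "\<not> same q c" "Im c = Im q" "Re c < Re q"
    using assms(1) unfolding rgt_def by blast
  assume "\<not> orient a b q < 0"
  then have "q \<in> other q"
    using c by (intro convex_left_of_chord[OF convex_other assms(2,3) mem_other[OF c(2,3)] assms(4-6)]) auto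
  then show False using not_other[OF c(1)] by contradiction
qed

lemma lft_left_of_chord:
  assumes "lft q" "a \<in> other q" "b \<in> other q" "Im a \<le> Im q" "Im q \<le> Im b" "Im a < Im b"
  shows "0 < orient a b q"
proof (rule ccontr)
  obtain c where c: "q \<in> X \<union> Y" "c \<in> X \<union> Y" "\<not> same q c" "Im c = Im q" "Re q < Re c"
    using assms(1) unfolding lft_def by blast
  assume "\<not> 0 < orient a b q"
  then have "q \<in> other q"
    using c by (intro convex_right_of_chord[OF convex_other assms(2,3) mem_other[OF c(2,3)] assms(4-6)]) auto
  then show False using not_other[OF c(1)] by contradiction
qed

text \<open>Whatever the colour of \<open>x\<close>, the hull opposite to it reaches the level of
  \<open>p\<close> at \<open>p\<close> itself or at an oppositely coloured point to the left of
  \<open>p\<close>.\<close>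

lemma rgt_witness:
  assumes "rgt p"
  obtains a where "a \<in> other x" "Im a = Im p" "Re a \<le> Re p"
proof (cases "same x p")
  case True
  obtain q where q: "q \<in> X \<union> Y" "\<not> same p q" "Im q = Im p" "Re q < Re p"
    using assms unfolding rgt_def by blast
  then have "q \<in> other p" by (auto intro: mem_other)
  then show ?thesis using that[of q] q other_eq[OF True] by simp
next
  case False
  then show ?thesis using that[of p] mem_other[of p x] assms by (simp add: rgt_def)
qed

lemma lft_witness:
  assumes "lft p"
  obtains a where "a \<in> other x" "Im a = Im p" "Re p \<le> Re a"
proof (cases "same x p")
  case True
  obtain q where q: "q \<in> X \<union> Y" "\<not> same p q" "Im q = Im p" "Re p < Re q"
    using assms unfolding lft_def by blast
  then have "q \<in> other p" by (auto intro: mem_other)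
  then show ?thesis using that[of q] q other_eq[OF True] by simp
next
  case False
  then show ?thesis using that[of p] mem_other[of p x] assms by (simp add: lft_def)
qed

text \<open>Expresses that \<open>p\<close> lies below \<open>q\<close> in a different run of the
  right side, before runs have been numbered.\<close>

definition separated :: "complex \<Rightarrow> complex \<Rightarrow> bool" where
  "separated p q \<longleftrightarrow> rgt p \<and> rgt q \<and> Im p < Im q \<and>
     (\<not> same p q \<or> (\<exists>z. rgt z \<and> Im p < Im z \<and> Im z < Im q \<and> \<not> same z q))"

text \<open>Replaces \<open>p\<close> by a point coloured opposite to \<open>q\<close> without
  increasing the slope towards \<open>q\<close>, so that chords of the opposite hull become
  applicable. If \<open>p\<close> and \<open>q\<close> have the same colour, an intervening point
  \<open>z\<close> does this, as it lies to the right of the chord from \<open>p\<close> to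
  \<open>q\<close>.\<close>

lemma separated_before:
  assumes "separated p q"
  obtains a where "a \<in> other q" "Im p \<le> Im a" "Im a < Im q" "slope a q \<le> slope p q"
proof (cases "same p q")
  case False
  then show ?thesis using that[of p] assms mem_other[of p q]
    by (simp add: separated_def rgt_def same_def)
next
  case True
  then obtain z where z: "rgt z" "Im p < Im z" "Im z < Im q" "\<not> same z q"
    using assms unfolding separated_def by blast
  have S: "p \<in> X \<union> Y" "q \<in> X \<union> Y" "z \<in> X \<union> Y"
    using assms z(1) by (simp_all add: separated_def rgt_def)
  have "p \<in> other z" "q \<in> other z" "z \<in> other q"
    using True z(4) S by (auto intro!: mem_other simp: same_def)
  then have "orient p q z < 0" using rgt_right_of_chord[OF z(1)] z(2,3) by simp
  then have "0 < orient p z q" using orient_swap[of q p z] orient_rotate[of q p z] by simp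
  from orient_pos_slope_right[OF z(2,3) this] show ?thesis using that[of z] z \<open>z \<in> other q\<close> by simp
qed

lemma separated_after:
  assumes "separated p q"
  obtains a where "a \<in> other p" "Im p < Im a" "Im a \<le> Im q" "slope p q \<le> slope p a"
proof (cases "same p q")
  case False
  then show ?thesis using that[of q] assms mem_other[of q p]
    by (simp add: separated_def rgt_def same_def)
next
  case True
  then obtain z where z: "rgt z" "Im p < Im z" "Im z < Im q" "\<not> same z q"
    using assms unfolding separated_def by blast
  have S: "p \<in> X \<union> Y" "q \<in> X \<union> Y" "z \<in> X \<union> Y"
    using assms z(1) by (simp_all add: separated_def rgt_def)
  have "p \<in> other z" "q \<in> other z" "z \<in> other p"
    using True z(4) S by (auto intro!: mem_other simp: same_def)
  then have "orient p q z < 0" using rgt_right_of_chord[OF z(1)] z(2,3) by simp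
  then have "0 < orient p z q" using orient_swap[of q p z] orient_rotate[of q p z] by simp
  from orient_pos_slope_left[OF z(2,3) this] show ?thesis using that[of z] z \<open>z \<in> other p\<close> by simp
qed

text \<open>\<open>slope q r \<le> slope q b < slope a q \<le> slope p q\<close>, where the strict
  inequality holds because \<open>q\<close> lies to the right of the chord from \<open>a\<close> to
  \<open>b\<close> in the opposite hull.\<close>

lemma orient_rgt_rgt_rgt:
  assumes "separated p q" "separated q r"
  shows "0 < orient p q r"
proof -
  obtain a where a: "a \<in> other q" "Im p \<le> Im a" "Im a < Im q" "slope a q \<le> slope p q"
    using separated_before[OF assms(1)] .
  obtain b where b: "b \<in> other q" "Im q < Im b" "Im b \<le> Im r" "slope q r \<le> slope q b"
    using separated_after[OF assms(2)] .
  have "orient a b q < 0" using rgt_right_of_chord[OF _ a(1) b(1)] assms a b by (simp add: separated_def)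
  then have "0 < orient a q b" using orient_swap[of b a q] orient_rotate[of b a q] by simp
  then have "slope q b < slope a q" using orient_pos_iff_slope[OF a(3) b(2)] by simp
  then have "slope q r < slope p q" using a b by simp
  then show ?thesis using assms by (subst orient_pos_iff_slope) (auto simp: separated_def)
qed

text \<open>If the level of \<open>l\<close> is between those of \<open>p\<close> and
  \<open>q\<close>, these two are moved left into the hull opposite to \<open>l\<close>, which does
  not increase the area. If \<open>l\<close> is above or below, \<open>l\<close> is moved right into
  the hull opposite to the nearer of \<open>q\<close> and \<open>p\<close>.\<close>

lemma orient_rgt_rgt_lft:
  assumes pq: "separated p q" and l: "lft l"
  shows "0 < orient p q l"
proof -
  have R: "rgt p" "rgt q" "Im p < Im q" using pq by (auto simp: separated_def)
  consider "Im p \<le> Im l" "Im l \<le> Im q" | "Im q < Im l" | "Im l < Im p" by linarith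
  then show ?thesis
  proof cases
    case 1
    obtain a where a: "a \<in> other l" "Im a = Im p" "Re a \<le> Re p" using rgt_witness[OF R(1)] .
    obtain b where b: "b \<in> other l" "Im b = Im q" "Re b \<le> Re q" using rgt_witness[OF R(2)] .
    have "0 < orient a b l" using lft_left_of_chord[OF l a(1) b(1)] 1 R a b by simp
    also have "orient a b l = Re a * (Im q - Im l) + Re b * (Im l - Im p) - (Im q - Im p) * Re l"
      using a b by (simp add: orient_def algebra_simps)
    also have "\<dots> \<le> Re p * (Im q - Im l) + Re q * (Im l - Im p) - (Im q - Im p) * Re l"
      using a b 1 by (intro diff_right_mono add_mono mult_right_mono) auto
    also have "\<dots> = orient p q l" by (simp add: orient_def algebra_simps)
    finally show ?thesis .
  next
    case 2
    obtain a where a: "a \<in> other q" "Im p \<le> Im a" "Im a < Im q" "slope a q \<le> slope p q"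
      using separated_before[OF pq] .
    obtain e where e: "e \<in> other q" "Im e = Im l" "Re l \<le> Re e" using lft_witness[OF l] .
    have "orient a e q < 0" using rgt_right_of_chord[OF R(2) a(1) e(1)] a e 2 by simp
    then have "0 < orient a q e" using orient_swap[of e a q] orient_rotate[of e a q] by simp
    then have "slope q e < slope a q" using orient_pos_iff_slope[of a q e] a e 2 by simp
    moreover have "slope q l \<le> slope q e" using e 2 by (auto simp: slope_def intro: divide_right_mono)
    ultimately have "slope q l < slope p q" using a by simp
    then show ?thesis using R 2 by (subst orient_pos_iff_slope) auto
  next
    case 3
    obtain b where b: "b \<in> other p" "Im p < Im b" "Im b \<le> Im q" "slope p q \<le> slope p b"
      using separated_after[OF pq] .
    obtain e where e: "e \<in> other p" "Im e = Im l" "Re l \<le> Re e" using lft_witness[OF l] .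
    have "orient e b p < 0" using rgt_right_of_chord[OF R(1) e(1) b(1)] b e 3 by simp
    then have "0 < orient e p b" using orient_swap[of b e p] orient_rotate[of b e p] by simp
    then have "slope p b < slope e p" using orient_pos_iff_slope[of e p b] b e 3 by simp
    moreover have "slope e p \<le> slope l p" using e 3 by (auto simp: slope_def intro: divide_right_mono)
    ultimately have "slope p q < slope l p" using b by simp
    then have "0 < orient l p q" using R 3 by (subst orient_pos_iff_slope) auto
    then show ?thesis using orient_rotate[of l p q] by simp
  qed
qed

definition level_colour :: "real \<Rightarrow> bool" where
  "level_colour t \<longleftrightarrow> (\<exists>p. rgt p \<and> Im p = t \<and> p \<in> X)"

lemma rgt_colour: "rgt p \<Longrightarrow> p \<in> X \<longleftrightarrow> level_colour (Im p)"
proof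
  assume p: "rgt p" "level_colour (Im p)"
  then obtain q where q: "rgt q" "Im q = Im p" "q \<in> X" by (auto simp: level_colour_def)
  show "p \<in> X"
  proof (rule ccontr)
    assume "p \<notin> X"
    then have "lft q \<and> Re q < Re p" using q p by (intro rgt_line(2)[OF p(1)]) (auto simp: same_def)
    then show False using rgt_line(3)[OF q(1) _ refl] q by simp
  qed
qed (auto simp: level_colour_def)

lemma lft_colour: "lft p \<Longrightarrow> p \<in> X \<longleftrightarrow> \<not> level_colour (Im p)"
proof -
  assume p: "lft p"
  then obtain q where q: "q \<in> X \<union> Y" "\<not> same p q" "Im q = Im p" "Re p < Re q" "p \<in> X \<union> Y"
    unfolding lft_def by blast
  then have "rgt q" unfolding rgt_def by (intro conjI bexI[of _ p]) (auto simp: same_def)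
  then show ?thesis using rgt_colour[of q] q by (auto simp: same_def)
qed

lemma card_rgt_lft:
  "card {p \<in> X \<union> Y. rgt p \<and> Im p = t} = card {p \<in> X \<union> Y. lft p \<and> Im p = t}"
proof -
  have A: "{p \<in> X \<union> Y. rgt p \<and> Im p = t} = (if level_colour t then {x \<in> X. Im x = t} else {x \<in> Y. Im x = t})"
    using rgt_colour lft_colour rgt_or_lft disj by auto
  have B: "{p \<in> X \<union> Y. lft p \<and> Im p = t} = (if level_colour t then {x \<in> Y. Im x = t} else {x \<in> X. Im x = t})"
    using rgt_colour lft_colour rgt_or_lft disj by auto
  show ?thesis unfolding A B using balanced by simp
qed

lemma rgt_at_level:
  assumes "p \<in> X \<union> Y"
  obtains q where "rgt q" "Im q = Im p"
proof (cases "rgt p")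
  case False
  then have "lft p" using rgt_or_lft assms by blast
  then obtain q where q: "q \<in> X \<union> Y" "\<not> same p q" "Im q = Im p" "Re p < Re q"
    unfolding lft_def by blast
  then have "rgt q" using assms unfolding rgt_def by (intro conjI bexI[of _ p]) (auto simp: same_def)
  then show ?thesis using that q by blast
qed (use that in blast)

end

section \<open>Numbering the runs\<close>

lemma sum_less_sum_of_separated:
  fixes f :: "'a \<Rightarrow> real"
  assumes "finite A" "finite B" "card A = card B" "A \<noteq> {}" "\<And>a b. a \<in> A \<Longrightarrow> b \<in> B \<Longrightarrow> f b < f a"
  shows "sum f B < sum f A"
proof -
  obtain h where h: "bij_betw h A B" using finite_same_card_bij[OF assms(1-3)] by blast
  have "sum f B = (\<Sum>a\<in>A. f (h a))" using sum.reindex_bij_betw[OF h, of f] by simp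
  also have "\<dots> < sum f A"
    using assms h by (intro sum_strict_mono) (auto simp: bij_betw_def)
  finally show ?thesis .
qed

context balanced_pair
begin

text \<open>If the same colour were on the right at every level, its sum of real parts would be
  strictly larger. This yields at least two blocks of levels and hence at least four runs.\<close>

lemma level_colour_not_constant:
  assumes ne: "X \<union> Y \<noteq> {}" and sums: "(\<Sum>x\<in>X. Re x) = (\<Sum>y\<in>Y. Re y)"
  shows "\<exists>s\<in>Im ` (X \<union> Y). \<exists>t\<in>Im ` (X \<union> Y). level_colour s \<noteq> level_colour t"
proof (rule ccontr)
  assume "\<not> ?thesis"
  then have *: "level_colour (Im p) = level_colour (Im q)" if "p \<in> X \<union> Y" "q \<in> X \<union> Y" for p q
    using that by blast
  obtain p0 where "p0 \<in> X \<union> Y" using ne by blast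
  define c where "c = level_colour (Im p0)"
  have c: "level_colour (Im p) = c" if "p \<in> X \<union> Y" for p
    using *[OF that \<open>p0 \<in> X \<union> Y\<close>] by (simp add: c_def)
  define A B where "A = (if c then X else Y)" and "B = (if c then Y else X)"
  have fin: "finite A" "finite B" using finX finY by (auto simp: A_def B_def)
  have AB: "A \<union> B = X \<union> Y" by (auto simp: A_def B_def)
  have A: "rgt p" if "p \<in> A" for p
    using that c[of p] rgt_or_lft[of p] lft_colour[of p] disj by (auto simp: A_def split: if_splits)
  have lv: "card {a \<in> A. Im a = t} = card {b \<in> B. Im b = t}" for t
    using balanced[of t] by (simp add: A_def B_def)
  have less: "(\<Sum>b\<in>{b \<in> B. Im b = t}. Re b) < (\<Sum>a\<in>{a \<in> A. Im a = t}. Re a)" if t: "t \<in> Im ` (X \<union> Y)" for t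
  proof (rule sum_less_sum_of_separated)
    obtain q where q: "rgt q" "Im q = t" using t rgt_at_level by (metis imageE)
    then have "q \<in> X \<union> Y" by (simp add: rgt_def)
    with q have "q \<in> {a \<in> A. Im a = t}" using rgt_colour[OF q(1)] c[of q] by (auto simp: A_def)
    then show "{a \<in> A. Im a = t} \<noteq> {}" by blast
    fix a b assume ab: "a \<in> {a \<in> A. Im a = t}" "b \<in> {b \<in> B. Im b = t}"
    then have "\<not> same a b" using disj by (auto simp: A_def B_def same_def split: if_splits)
    moreover have "b \<in> X \<union> Y" using ab AB by auto
    ultimately show "Re b < Re a" using rgt_line(2)[OF A[of a], of b] ab by simp
  qed (use fin lv in auto)
  have grp: "(\<Sum>p\<in>C. Re p) = (\<Sum>t\<in>Im ` (X \<union> Y). \<Sum>p\<in>{p \<in> C. Im p = t}. Re p)" if "C \<subseteq> X \<union> Y" for C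
    using finX finY that by (intro sum.group[symmetric]) (auto intro: finite_subset)
  have sub: "A \<subseteq> X \<union> Y" "B \<subseteq> X \<union> Y" by (auto simp: A_def B_def)
  have "(\<Sum>t\<in>Im ` (X \<union> Y). \<Sum>b\<in>{b \<in> B. Im b = t}. Re b) < (\<Sum>t\<in>Im ` (X \<union> Y). \<Sum>a\<in>{a \<in> A. Im a = t}. Re a)"
    using finX finY ne less by (intro sum_strict_mono) blast+
  then have "(\<Sum>p\<in>B. Re p) < (\<Sum>p\<in>A. Re p)" using grp[OF sub(1)] grp[OF sub(2)] by simp
  then show False using sums by (simp add: A_def B_def split: if_splits)
qed

theorem runs:
  assumes ne: "X \<union> Y \<noteq> {}" and sums: "(\<Sum>x\<in>X. Re x) = (\<Sum>y\<in>Y. Re y)"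
  obtains m :: nat and j :: "complex \<Rightarrow> nat" where
    "even m" "4 \<le> m" "j ` (X \<union> Y) = {..<m}"
    "\<And>p q. p \<in> X \<union> Y \<Longrightarrow> q \<in> X \<union> Y \<Longrightarrow> even (j p + j q) \<longleftrightarrow> (p \<in> X \<longleftrightarrow> q \<in> X)"
    "\<And>p q r. p \<in> X \<union> Y \<Longrightarrow> q \<in> X \<union> Y \<Longrightarrow> r \<in> X \<union> Y \<Longrightarrow> j p < j q \<Longrightarrow> j q < j r \<Longrightarrow> 0 < orient p q r"
    "\<And>i t. i < m \<Longrightarrow> card {p \<in> X \<union> Y. j p = i \<and> Im p = t} = card {p \<in> X \<union> Y. j p = m - 1 - i \<and> Im p = t}"
proof -
  define S where "S = X \<union> Y"
  define H where "H = Im ` S"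
  have H: "finite H" "H \<noteq> {}" using finX finY ne by (auto simp: H_def S_def)
  obtain f :: "real \<Rightarrow> nat" and b where f0: "mono_on H f \<and> f ` H = {..<b} \<and>
      (\<forall>s\<in>H. \<forall>t\<in>H. even (f s + f t) \<longleftrightarrow> level_colour s = level_colour t)"
    using finite_blocks[OF H, of level_colour] by (elim exE)
  then have fH: "f ` H = {..<b}"
    and fpar: "\<And>s t. s \<in> H \<Longrightarrow> t \<in> H \<Longrightarrow> even (f s + f t) \<longleftrightarrow> level_colour s = level_colour t" by simp_all
  have fless: "s < t" if "f s < f t" "s \<in> H" "t \<in> H" for s t
  proof (rule ccontr)
    assume "\<not> s < t"
    then have "f t \<le> f s" using monotone_onD[of H "(\<le>)" "(\<le>)" f t s] f0 that by simp
    then show False using that(1) by simp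
  qed
  have fb: "f t < b" if "t \<in> H" for t using fH that by auto
  have b2: "2 \<le> b"
  proof (rule ccontr)
    assume "\<not> 2 \<le> b"
    then have "f s = 0" if "s \<in> H" for s using fb[OF that] by simp
    then have "level_colour s = level_colour t" if "s \<in> H" "t \<in> H" for s t using that fpar[OF that] by simp
    then show False using level_colour_not_constant[OF ne sums] unfolding H_def S_def by blast
  qed
  \<comment> \<open>Blocks are numbered upwards on the right side from 0 to \<open>b - 1\<close> and
    downwards on the left side from \<open>b\<close> to \<open>2 * b - 1\<close>, that is,
    counterclockwise. The two runs on one block of levels thus have the indices \<open>i\<close> and
    \<open>2 * b - 1 - i\<close>.\<close>
  define j where "j = (\<lambda>p. if rgt p then f (Im p) else 2 * b - 1 - f (Im p))"
  have SH: "Im p \<in> H" if "p \<in> S" for p using that by (simp add: H_def)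
  have jr: "j p = f (Im p)" "j p < b" if "p \<in> S" "rgt p" for p
    using that fb[OF SH] by (simp_all add: j_def)
  have jl: "j p + f (Im p) + 1 = 2 * b" "\<not> rgt p" "b \<le> j p" if "p \<in> S" "lft p" for p
  proof -
    show "\<not> rgt p" using rgt_line(3)[of p p] that by (auto simp: S_def)
    then show "j p + f (Im p) + 1 = 2 * b" "b \<le> j p" using fb[OF SH[OF that(1)]] by (simp_all add: j_def)
  qed
  have rl: "rgt p \<or> lft p" if "p \<in> S" for p using rgt_or_lft that by (simp add: S_def)
  have sep: "separated p q" if "p \<in> S" "q \<in> S" "rgt p" "rgt q" "f (Im p) < f (Im q)" for p q
  proof (cases "same p q")
    case False
    then show ?thesis using fless[OF that(5) SH SH] that by (simp add: separated_def)
  next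
    case True
    then have "level_colour (Im p) = level_colour (Im q)"
      using rgt_colour[OF that(3)] rgt_colour[OF that(4)] by (simp add: same_def)
    then have ev: "even (f (Im p) + f (Im q))" using fpar[OF SH SH] that by simp
    \<comment> \<open>The next block has the other colour on the right, and by parity it is not yet
      the block of \<open>q\<close>; a right point on it separates \<open>p\<close> from
      \<open>q\<close>.\<close>
    have "Suc (f (Im p)) < b" using fb[OF SH[OF that(2)]] that(5) by simp
    then obtain t where t: "t \<in> H" "f t = Suc (f (Im p))" using fH by (metis imageE lessThan_iff)
    obtain z where z: "rgt z" "Im z = t" using t(1) rgt_at_level unfolding H_def S_def by (metis imageE)
    have zS: "z \<in> S" using z by (simp add: S_def rgt_def)
    have "f t \<noteq> f (Im q)"
    proof
      assume "f t = f (Im q)"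
      then have "even (f (Im p) + Suc (f (Im p)))" using ev t(2) by (metis add.commute)
      then show False by simp
    qed
    then have "f t < f (Im q)" using t that(5) by simp
    then have "t < Im q" using fless[OF _ t(1) SH[OF that(2)]] by simp
    moreover have "Im p < t" using fless[OF _ SH[OF that(1)] t(1)] t(2) by simp
    moreover have "\<not> same z q"
    proof -
      have "odd (f (Im z) + f (Im q))" using ev t z by simp
      then have "level_colour (Im z) \<noteq> level_colour (Im q)" using fpar[OF SH[OF zS] SH[OF that(2)]] by simp
      then show ?thesis using rgt_colour[OF that(4)] rgt_colour[OF z(1)] by (simp add: same_def)
    qed
    ultimately show ?thesis using fless[OF that(5) SH SH] that z by (auto simp: separated_def)
  qed
  interpret neg: balanced_pair "uminus ` X" "uminus ` Y" by (rule negated)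
  \<comment> \<open>The same argument on the left side; the half turn makes the higher point
    \<open>p\<close> the lower one.\<close>
  have nsep: "neg.separated (-p) (-q)" if "p \<in> S" "q \<in> S" "lft p" "lft q" "f (Im q) < f (Im p)" for p q
  proof (cases "same p q")
    case False
    then show ?thesis using fless[OF that(5) SH SH] that by (simp add: neg.separated_def negated_rgt negated_same)
  next
    case True
    then have "level_colour (Im p) = level_colour (Im q)"
      using lft_colour[OF that(3)] lft_colour[OF that(4)] by (simp add: same_def)
    then have ev: "even (f (Im p) + f (Im q))" using fpar[OF SH SH] that by simp
    have "Suc (f (Im q)) < b" using fb[OF SH[OF that(1)]] that(5) by simp
    then obtain t where t: "t \<in> H" "f t = Suc (f (Im q))" using fH by (metis imageE lessThan_iff)
    obtain z' where z': "rgt z'" "Im z' = t" using t(1) rgt_at_level unfolding H_def S_def by (metis imageE)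
    then obtain z where z: "z \<in> X \<union> Y" "\<not> same z' z" "Im z = t" using rgt_def by auto
    have zl: "lft z" using rgt_line(2)[OF z'(1) z(1) _ z(2)] z z' by simp
    have zS: "z \<in> S" using z by (simp add: S_def)
    have "f t \<noteq> f (Im p)"
    proof
      assume "f t = f (Im p)"
      then have "even (f (Im q) + Suc (f (Im q)))" using ev t(2) by (metis add.commute)
      then show False by simp
    qed
    then have "f t < f (Im p)" using t that(5) by simp
    then have "t < Im p" using fless[OF _ t(1) SH[OF that(1)]] by simp
    moreover have "Im q < t" using fless[OF _ SH[OF that(2)] t(1)] t(2) by simp
    moreover have "\<not> same z q"
    proof -
      have "odd (f (Im z) + f (Im q))" using t z by simp
      then have "level_colour (Im z) \<noteq> level_colour (Im q)" using fpar[OF SH[OF zS] SH[OF that(2)]] by simp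
      then show ?thesis using lft_colour[OF that(4)] lft_colour[OF zl] by (simp add: same_def)
    qed
    ultimately show ?thesis using fless[OF that(5) SH SH] that z zl
      unfolding neg.separated_def negated_rgt negated_same
      by (intro conjI disjI2 exI[of _ "-z"]) (auto simp: negated_rgt negated_same)
  qed
  show ?thesis
  proof (rule that[of "2 * b" j, folded S_def])
    show "j ` S = {..<2 * b}"
    proof (intro equalityI subsetI)
      fix i assume "i \<in> j ` S"
      then obtain p where "p \<in> S" "i = j p" by blast
      then show "i \<in> {..<2 * b}" using rl[of p] jr[of p] jl[of p] by auto
    next
      fix i assume i: "i \<in> {..<2 * b}"
      define k where "k = (if i < b then i else 2 * b - 1 - i)"
      have "k < b" using i by (auto simp: k_def)
      then obtain t where t: "t \<in> H" "f t = k" using fH by (metis imageE lessThan_iff)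
      obtain q where q: "rgt q" "Im q = t" using t(1) rgt_at_level unfolding H_def S_def by (metis imageE)
      obtain l where l: "l \<in> X \<union> Y" "\<not> same q l" "Im l = t" using q rgt_def by auto
      have "lft l" using rgt_line(2)[OF q(1) l(1) _ l(2)] l q by simp
      have S: "q \<in> S" "l \<in> S" using q l by (simp_all add: S_def rgt_def)
      show "i \<in> j ` S"
      proof (cases "i < b")
        case True
        then have "j q = i" using jr(1)[OF S(1) q(1)] t q by (simp add: k_def)
        then show ?thesis using S by blast
      next
        case False
        then have "j l = i" using jl(1)[OF S(2) \<open>lft l\<close>] t l i by (simp add: k_def)
        then show ?thesis using S by blast
      qed
    qed
    show "even (j p + j q) \<longleftrightarrow> (p \<in> X \<longleftrightarrow> q \<in> X)" if "p \<in> S" "q \<in> S" for p q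
    proof -
      have *: "even (j p) \<longleftrightarrow> (even (f (Im p)) \<longleftrightarrow> (p \<in> X \<longleftrightarrow> level_colour (Im p)))" if "p \<in> S" for p
      proof (cases "rgt p")
        case True
        then show ?thesis using rgt_colour jr(1) that by simp
      next
        case False
        then have "lft p" using rl that by blast
        then have "even (j p + f (Im p) + 1)" "p \<in> X \<longleftrightarrow> \<not> level_colour (Im p)"
          using jl(1)[OF that] lft_colour by simp_all
        then show ?thesis by auto
      qed
      show ?thesis using *[OF that(1)] *[OF that(2)] fpar[OF SH SH, OF that] by auto
    qed
    have nlr: "\<not> (lft x \<and> rgt y)" if "x \<in> S" "y \<in> S" "j x < j y" for x y
      using jl(3)[OF that(1)] jr(2)[OF that(2)] that(3) by auto
    show "0 < orient p q r" if pqr: "p \<in> S" "q \<in> S" "r \<in> S" "j p < j q" "j q < j r" for p q r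
    proof -
      consider "rgt p" "rgt q" "rgt r" | "rgt p" "rgt q" "lft r" | "rgt p" "lft q" "lft r" | "lft p" "lft q" "lft r"
        using rl[OF pqr(1)] rl[OF pqr(2)] rl[OF pqr(3)] nlr[OF pqr(1,2,4)] nlr[OF pqr(2,3,5)] by blast
      then show ?thesis
      proof cases
        case 1
        then show ?thesis using that jr(1) by (intro orient_rgt_rgt_rgt sep) auto
      next
        case 2
        then show ?thesis using that jr(1) by (intro orient_rgt_rgt_lft sep) auto
      next
        case 3
        then have "0 < orient (-q) (-r) (-p)"
          using that jl(1)[of q] jl(1)[of r] by (intro neg.orient_rgt_rgt_lft nsep) (auto simp: negated_lft)
        then show ?thesis using orient_rotate[of p q r] by (simp add: orient_uminus)
      next
        case 4
        then have "0 < orient (-p) (-q) (-r)"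
          using that jl(1)[of q] jl(1)[of r] jl(1)[of p] by (intro neg.orient_rgt_rgt_rgt nsep) auto
        then show ?thesis by (simp add: orient_uminus)
      qed
    qed
    show "card {p \<in> S. j p = i \<and> Im p = t} = card {p \<in> S. j p = 2 * b - 1 - i \<and> Im p = t}" if i: "i < 2 * b" for i t
    proof -
      have jch: "j p = k \<longleftrightarrow> rgt p \<and> f (Im p) = k \<or> lft p \<and> f (Im p) + k + 1 = 2 * b" if "p \<in> S" for p k
      proof (cases "rgt p")
        case True
        then have "\<not> lft p" using jl(2)[OF that] by blast
        then show ?thesis using True jr(1)[OF that True] by simp
      next
        case False
        then have "lft p" using rl[OF that] by blast
        then show ?thesis using False jl(1)[OF that] by auto
      qed
      have fim: "f (Im p) < b" if "p \<in> S" for p using fb SH that by blast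
      show ?thesis
      proof (cases "f t = i \<and> i < b \<or> f t + i + 1 = 2 * b \<and> b \<le> i")
        case False
        have "{p \<in> S. j p = i \<and> Im p = t} = {}" "{p \<in> S. j p = 2 * b - 1 - i \<and> Im p = t} = {}"
          using False jch fim i by fastforce+
        then show ?thesis by (simp only: card.empty)
      next
        case True
        then consider "f t = i" "i < b" | "f t + i + 1 = 2 * b" "b \<le> i" by blast
        then show ?thesis
        proof cases
          case 1
          have "j p = i \<longleftrightarrow> rgt p" "j p = 2 * b - 1 - i \<longleftrightarrow> lft p" if "p \<in> S" "Im p = t" for p
          proof -
            have "f t = i" "f t + i + 1 \<noteq> 2 * b" "f t \<noteq> 2 * b - 1 - i" "f t + (2 * b - 1 - i) + 1 = 2 * b"
              using 1 i by linarith+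
            then show "j p = i \<longleftrightarrow> rgt p" "j p = 2 * b - 1 - i \<longleftrightarrow> lft p"
              unfolding jch[OF that(1)] that(2) by blast+
          qed
          then have "{p \<in> S. j p = i \<and> Im p = t} = {p \<in> S. rgt p \<and> Im p = t}"
            "{p \<in> S. j p = 2 * b - 1 - i \<and> Im p = t} = {p \<in> S. lft p \<and> Im p = t}" by blast+
          then show ?thesis using card_rgt_lft by (simp add: S_def)
        next
          case 2
          have "j p = i \<longleftrightarrow> lft p" "j p = 2 * b - 1 - i \<longleftrightarrow> rgt p" if "p \<in> S" "Im p = t" for p
          proof -
            have "f t \<noteq> i" "f t + i + 1 = 2 * b" "f t = 2 * b - 1 - i" "f t + (2 * b - 1 - i) + 1 \<noteq> 2 * b"
              using 2 i fim[OF that(1)] that(2) by linarith+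
            then show "j p = i \<longleftrightarrow> lft p" "j p = 2 * b - 1 - i \<longleftrightarrow> rgt p"
              unfolding jch[OF that(1)] that(2) by blast+
          qed
          then have "{p \<in> S. j p = i \<and> Im p = t} = {p \<in> S. lft p \<and> Im p = t}"
            "{p \<in> S. j p = 2 * b - 1 - i \<and> Im p = t} = {p \<in> S. rgt p \<and> Im p = t}" by blast+
          then show ?thesis using card_rgt_lft by (simp add: S_def)
        qed
      qed
    qed
  qed (use b2 in auto)
qed

end

section \<open>Cross ratios of directions\<close>

definition cyclic3 :: "nat \<Rightarrow> nat \<Rightarrow> nat \<Rightarrow> bool" where
  "cyclic3 i k l \<longleftrightarrow> i < k \<and> k < l \<or> k < l \<and> l < i \<or> l < i \<and> i < k"

text \<open>Only the last condition mentions \<open>u\<close>; this is what allows numberings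
  obtained from different directions to be compared. That condition is the reflection of the cycle
  of runs, taking \<open>i\<close> to \<open>m - 1 - i\<close> and preserving levels.\<close>

definition run_index :: "complex set \<Rightarrow> complex set \<Rightarrow> complex \<Rightarrow> nat \<Rightarrow> (complex \<Rightarrow> nat) \<Rightarrow> bool" where
  "run_index X Y u m j \<longleftrightarrow> 4 \<le> m \<and> even m \<and> j ` (X \<union> Y) = {..<m} \<and>
    (\<forall>p \<in> X \<union> Y. \<forall>q \<in> X \<union> Y. even (j p + j q) \<longleftrightarrow> (p \<in> X \<longleftrightarrow> q \<in> X)) \<and>
    (\<forall>p \<in> X \<union> Y. \<forall>q \<in> X \<union> Y. \<forall>r \<in> X \<union> Y. j p < j q \<longrightarrow> j q < j r \<longrightarrow> 0 < orient p q r) \<and>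
    (\<forall>i<m. \<forall>t. card {p \<in> X \<union> Y. j p = i \<and> Im (cnj u * p) = t} =
       card {p \<in> X \<union> Y. j p = m - 1 - i \<and> Im (cnj u * p) = t})"

lemma run_indexD:
  assumes "run_index X Y u m j"
  shows "4 \<le> m" "even m" "j ` (X \<union> Y) = {..<m}"
    "\<And>p q. p \<in> X \<union> Y \<Longrightarrow> q \<in> X \<union> Y \<Longrightarrow> even (j p + j q) \<longleftrightarrow> (p \<in> X \<longleftrightarrow> q \<in> X)"
    "\<And>p q r. p \<in> X \<union> Y \<Longrightarrow> q \<in> X \<union> Y \<Longrightarrow> r \<in> X \<union> Y \<Longrightarrow> j p < j q \<Longrightarrow> j q < j r \<Longrightarrow> 0 < orient p q r"
    "\<And>i t. i < m \<Longrightarrow> card {p \<in> X \<union> Y. j p = i \<and> Im (cnj u * p) = t} =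
       card {p \<in> X \<union> Y. j p = m - 1 - i \<and> Im (cnj u * p) = t}"
  using assms unfolding run_index_def by (elim conjE; blast)+

lemma (in balanced_pair) ex_run_index_1:
  assumes "X \<union> Y \<noteq> {}" "(\<Sum>x\<in>X. Re x) = (\<Sum>y\<in>Y. Re y)"
  shows "\<exists>m j. run_index X Y 1 m j"
proof (rule runs[OF assms], goal_cases)
  case (1 m j)
  then show ?case unfolding run_index_def complex_cnj_one mult_1 by (intro exI[of _ m] exI[of _ j] conjI ballI allI impI) 
qed

lemma orient_mult: "orient (c * p) (c * q) (c * r) = (cmod c)\<^sup>2 * orient p q r"
  unfolding orient_def cmod_power2 by (simp add: algebra_simps power2_eq_square)

text \<open>Multiplication by \<open>cnj u\<close> turns lines in direction \<open>u\<close> into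
  horizontal ones and multiplies all orientations by a positive factor.\<close>

lemma ex_run_index:
  assumes fin: "finite X" "finite Y" and ne: "X \<union> Y \<noteq> {}"
    and hull: "X \<inter> convex hull Y = {}" "Y \<inter> convex hull X = {}"
    and u: "u \<noteq> 0" and bal: "\<And>t. card {x \<in> X. Im (cnj u * x) = t} = card {y \<in> Y. Im (cnj u * y) = t}"
    and sums: "\<Sum>X = \<Sum>Y"
  shows "\<exists>m j. run_index X Y u m j"
proof -
  define \<phi> where "\<phi> = (\<lambda>z. cnj u * z)"
  have inj: "inj \<phi>" using u by (simp add: \<phi>_def inj_def)
  have lin: "linear \<phi>" by (simp add: \<phi>_def linear_times)
  have "balanced_pair (\<phi> ` X) (\<phi> ` Y)"
  proof
    show "\<phi> ` X \<inter> convex hull \<phi> ` Y = {}" "\<phi> ` Y \<inter> convex hull \<phi> ` X = {}"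
      unfolding convex_hull_linear_image[OF lin, symmetric] image_Int[OF inj, symmetric] hull by simp_all
    have c: "card {x \<in> \<phi> ` A. Im x = t} = card {x \<in> A. Im (cnj u * x) = t}" for A t
    proof -
      have "{x \<in> \<phi> ` A. Im x = t} = \<phi> ` {x \<in> A. Im (cnj u * x) = t}" unfolding \<phi>_def by auto
      then show ?thesis using inj by (simp add: card_image inj_on_subset)
    qed
    show "card {x \<in> \<phi> ` X. Im x = t} = card {y \<in> \<phi> ` Y. Im y = t}" for t
      unfolding c by (rule bal)
  qed (use fin in auto)
  then interpret b: balanced_pair "\<phi> ` X" "\<phi> ` Y" .
  have s: "(\<Sum>x\<in>\<phi> ` A. Re x) = Re (cnj u * \<Sum>A)" for A
  proof -
    have "inj_on \<phi> A" using inj by (rule inj_on_subset) simp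
    then have "(\<Sum>x\<in>\<phi> ` A. Re x) = Re (\<Sum>x\<in>A. \<phi> x)" by (simp add: sum.reindex)
    then show ?thesis unfolding \<phi>_def sum_distrib_left .
  qed
  have un: "\<phi> ` X \<union> \<phi> ` Y = \<phi> ` (X \<union> Y)" by blast
  have ne': "\<phi> ` X \<union> \<phi> ` Y \<noteq> {}" using ne by blast
  have s': "(\<Sum>x\<in>\<phi> ` X. Re x) = (\<Sum>y\<in>\<phi> ` Y. Re y)" unfolding s sums ..
  obtain m j where J: "run_index (\<phi> ` X) (\<phi> ` Y) 1 m j" using b.ex_run_index_1[OF ne' s'] by blast
  note J = run_indexD[OF J, unfolded un complex_cnj_one mult_1]
  have c: "card {p \<in> \<phi> ` (X \<union> Y). j p = i \<and> Im p = t} = card {p \<in> X \<union> Y. (j \<circ> \<phi>) p = i \<and> Im (cnj u * p) = t}" for i t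
  proof -
    have eq: "{p \<in> \<phi> ` (X \<union> Y). j p = i \<and> Im p = t} = \<phi> ` {p \<in> X \<union> Y. (j \<circ> \<phi>) p = i \<and> Im (\<phi> p) = t}"
      by auto
    have "inj_on \<phi> A" for A using inj by (rule inj_on_subset) simp
    then show ?thesis unfolding eq by (subst card_image) (simp_all only: \<phi>_def)
  qed
  have "run_index X Y u m (j \<circ> \<phi>)"
    unfolding run_index_def
  proof (intro conjI ballI allI impI)
    show "(j \<circ> \<phi>) ` (X \<union> Y) = {..<m}" using J(3) by (simp add: image_comp)
    show "even ((j \<circ> \<phi>) p + (j \<circ> \<phi>) q) \<longleftrightarrow> (p \<in> X \<longleftrightarrow> q \<in> X)" if "p \<in> X \<union> Y" "q \<in> X \<union> Y" for p q
      using J(4)[of "\<phi> p" "\<phi> q"] that inj by (simp add: inj_image_mem_iff)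
    show "0 < orient p q r" if "p \<in> X \<union> Y" "q \<in> X \<union> Y" "r \<in> X \<union> Y"
      "(j \<circ> \<phi>) p < (j \<circ> \<phi>) q" "(j \<circ> \<phi>) q < (j \<circ> \<phi>) r" for p q r
    proof -
      have "0 < orient (\<phi> p) (\<phi> q) (\<phi> r)" using that by (intro J(5)) auto
      then show ?thesis using u by (simp add: \<phi>_def orient_mult zero_less_mult_iff)
    qed
    show "card {p \<in> X \<union> Y. (j \<circ> \<phi>) p = i \<and> Im (cnj u * p) = t} =
      card {p \<in> X \<union> Y. (j \<circ> \<phi>) p = m - 1 - i \<and> Im (cnj u * p) = t}" if "i < m" for i t
      using J(6)[OF that] unfolding c .
  qed (use J(1,2) in auto)
  then show ?thesis by blast
qed

section \<open>Runs of two different directions\<close>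

lemma orient_iff_cyclic3:
  assumes "run_index X Y u m j" and S: "p \<in> X \<union> Y" "q \<in> X \<union> Y" "r \<in> X \<union> Y"
    and d: "j p \<noteq> j q" "j q \<noteq> j r" "j p \<noteq> j r"
  shows "0 < orient p q r \<longleftrightarrow> cyclic3 (j p) (j q) (j r)" "orient p q r \<noteq> 0"
proof -
  have pos: "0 < orient a b c" if "a \<in> X \<union> Y" "b \<in> X \<union> Y" "c \<in> X \<union> Y" "j a < j b" "j b < j c" for a b c
    using run_indexD(5)[OF assms(1) that] .
  have cyc: "0 < orient a b c" if "a \<in> X \<union> Y" "b \<in> X \<union> Y" "c \<in> X \<union> Y" "cyclic3 (j a) (j b) (j c)" for a b c
    using that(4) pos[OF that(1-3)] pos[OF that(2,3,1)] pos[OF that(3,1,2)] orient_rotate[of a b c] orient_rotate[of b c a]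
    unfolding cyclic3_def by auto
  have "cyclic3 (j p) (j q) (j r) \<or> cyclic3 (j q) (j p) (j r)" using d unfolding cyclic3_def by linarith
  moreover have "\<not> (cyclic3 (j p) (j q) (j r) \<and> cyclic3 (j q) (j p) (j r))" unfolding cyclic3_def by linarith
  ultimately show "0 < orient p q r \<longleftrightarrow> cyclic3 (j p) (j q) (j r)" "orient p q r \<noteq> 0"
    using cyc[OF S] cyc[OF S(2,1,3)] orient_swap[of q p r] by force+
qed

text \<open>For fixed \<open>b\<close> and \<open>c\<close>, \<open>orient\<close> is affine in its
  first argument, and both sides evaluate it at the same weighted point with the same total
  weight.\<close>

lemma orient_affine_comb:
  assumes "w + w' = v + (v'::real)" "w *\<^sub>R p + w' *\<^sub>R q = v *\<^sub>R y + v' *\<^sub>R y'"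
  shows "w * orient p b c + w' * orient q b c = v * orient y b c + v' * orient y' b c"
proof -
  have *: "s * orient a b c + s' * orient a' b c =
      (s + s') * (Re b * Im c - Im b * Re c) + (Re c - Re b) * Im (s *\<^sub>R a + s' *\<^sub>R a') - (Im c - Im b) * Re (s *\<^sub>R a + s' *\<^sub>R a')"
    for s s' a a' by (simp add: orient_def algebra_simps)
  show ?thesis unfolding * assms ..
qed

text \<open>A crossing of the segments \<open>pq\<close> and \<open>yy'\<close> prevents \<open>p, q\<close> from lying in one run: the
  crossing point would have positive orientation with respect to itself.\<close>

lemma run_index_same_partition:
  assumes J: "run_index X Y u m j" and J': "run_index X Y v m' j'"
    and S: "p \<in> X \<union> Y" "q \<in> X \<union> Y" and eq: "j p = j q"
  shows "j' p = j' q"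
proof (rule ccontr)
  assume ne: "j' p \<noteq> j' q"
  have main: False if S: "p \<in> X \<union> Y" "q \<in> X \<union> Y" and eq: "j p = j q" and less: "j' p < j' q" for p q
  proof -
    have par: "even (j a + j b) \<longleftrightarrow> (a \<in> X \<longleftrightarrow> b \<in> X)" if "a \<in> X \<union> Y" "b \<in> X \<union> Y" for a b
      using run_indexD(4)[OF J that] .
    have par': "even (j' a + j' b) \<longleftrightarrow> (a \<in> X \<longleftrightarrow> b \<in> X)" if "a \<in> X \<union> Y" "b \<in> X \<union> Y" for a b
      using run_indexD(4)[OF J' that] .
    have im: "j ` (X \<union> Y) = {..<m}" "4 \<le> m" and im': "j' ` (X \<union> Y) = {..<m'}" "even m'"
      using run_indexD(1-3)[OF J] run_indexD(1-3)[OF J'] by simp_all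
    have col: "p \<in> X \<longleftrightarrow> q \<in> X" using par[OF S] eq by simp
    then have ev: "even (j' p + j' q)" using par'[OF S] by simp
    have lt: "j' p < m'" "j' q < m'" using im' S by auto
    have "Suc (j' p) \<in> j' ` (X \<union> Y)" using im' less lt by auto
    then obtain y where y: "y \<in> X \<union> Y" "j' y = Suc (j' p)" by (metis imageE)
    have lt2: "j' y < j' q"
    proof -
      have "j' q \<noteq> Suc (j' p)" using ev by auto
      then show ?thesis using less y by simp
    qed
    \<comment> \<open>\<open>y\<close> is taken from a run between those of \<open>p\<close> and
      \<open>q\<close>, and \<open>k\<close> is the run after \<open>q\<close> or, if there is none,
      the one before \<open>p\<close>. Thus \<open>y\<close> and \<open>y'\<close> lie on different
      sides of the segment from \<open>p\<close> to \<open>q\<close>. As \<open>m'\<close> is even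
      and \<open>j' p\<close>, \<open>j' q\<close> have equal parity, the subtraction does not
      truncate.\<close>
    define k where "k = (if Suc (j' q) < m' then Suc (j' q) else j' p - 1)"
    have pm: "0 < j' p" if "\<not> Suc (j' q) < m'"
    proof (rule ccontr)
      assume "\<not> 0 < j' p"
      moreover have "Suc (j' q) = m'" using that lt by simp
      ultimately show False using ev im'(2) by auto
    qed
    have "k < m'" using lt by (auto simp: k_def)
    then obtain y' where y': "y' \<in> X \<union> Y" "j' y' = k" using im' by (metis imageE lessThan_iff)
    have odd: "odd (j' p + k)"
    proof (cases "Suc (j' q) < m'")
      case True
      then show ?thesis using ev by (simp add: k_def)
    next
      case False
      then show ?thesis using pm by (simp add: k_def)
    qed
    have cols: "(y \<in> X) \<noteq> (p \<in> X)" "(y' \<in> X) \<noteq> (p \<in> X)"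
      using par'[OF S(1) y(1)] par'[OF S(1) y'(1)] y y' odd by auto
    have c3: "cyclic3 (j' p) (j' y) (j' q)" "cyclic3 (j' p) (j' y) (j' y')"
      "cyclic3 (j' p) (j' q) (j' y')" "cyclic3 (j' y) (j' q) (j' y')"
      using lt2 y y' pm less unfolding cyclic3_def k_def by (auto split: if_splits)
    have o: "0 < orient p y q" "0 < orient p y y'" "0 < orient p q y'" "0 < orient y q y'"
      using c3 orient_iff_cyclic3(1)[OF J', of p y q] orient_iff_cyclic3(1)[OF J', of p y y']
        orient_iff_cyclic3(1)[OF J', of p q y'] orient_iff_cyclic3(1)[OF J', of y q y'] S y(1) y'(1)
      unfolding cyclic3_def by (metis less_irrefl less_trans)+
    have jne: "j p \<noteq> j y" "j p \<noteq> j y'" "j q \<noteq> j y" "j q \<noteq> j y'"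
      using cols par[OF S(1) y(1)] par[OF S(1) y'(1)] eq by (metis even_add)+
    show False
    proof (cases "j y = j y'")
      case False
      \<comment> \<open>Being in one run of \<open>j\<close>, the points \<open>p\<close> and
        \<open>q\<close> would lie on the same side of the line through \<open>y\<close> and
        \<open>y'\<close>, but \<open>j'\<close> puts them on opposite sides.\<close>
      then have "0 < orient p y y' \<longleftrightarrow> 0 < orient q y y'"
        using orient_iff_cyclic3(1)[OF J S(1) y(1) y'(1)] orient_iff_cyclic3(1)[OF J S(2) y(1) y'(1)] jne eq by simp
      then show False using o(2,4) orient_swap[of y q y'] by simp
    next
      case True
      obtain l where l: "l < m" "l \<noteq> j p" "l \<noteq> j y"
      proof -
        have "card {j p, j y} < card {..<m}" using im(2) card_insert_le_m1[of 2 "{j y}" "j p"] by simp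
        then have "\<not> {..<m} \<subseteq> {j p, j y}" by (metis card_mono finite.emptyI finite_insert leD)
        then show ?thesis using that by auto
      qed
      then obtain z where z: "z \<in> X \<union> Y" "j z = l" using im by (metis imageE lessThan_iff)
      define e where "e = (if cyclic3 (j p) (j y) l then 1 else -1 :: real)"
      have pos: "0 < e * orient a b z" if "a \<in> {p, q}" "b \<in> {y, y'}" for a b
      proof -
        have ab: "a \<in> X \<union> Y" "b \<in> X \<union> Y" "j a = j p" "j b = j y" using that S y y' eq True by auto
        have "0 < orient a b z \<longleftrightarrow> cyclic3 (j p) (j y) l" "orient a b z \<noteq> 0"
          using orient_iff_cyclic3[OF J ab(1,2) z(1)] ab(3,4) z(2) l jne by auto
        then show ?thesis by (auto simp: e_def)
      qed
      \<comment> \<open>These areas are the weights that represent the crossing point of the two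
        segments both by \<open>p\<close>, \<open>q\<close> and by \<open>y\<close>,
        \<open>y'\<close>.\<close>
      define w where "w = orient y q y'"
      define w' where "w' = orient p y y'"
      define v where "v = orient p q y'"
      define v' where "v' = orient p y q"
      have s: "w + w' = v + v'" by (simp add: w_def w'_def v_def v'_def orient_def algebra_simps)
      have r: "w *\<^sub>R p + w' *\<^sub>R q = v *\<^sub>R y + v' *\<^sub>R y'"
        by (rule complex_eqI) (simp_all add: w_def w'_def v_def v'_def orient_def algebra_simps)
      have "w * orient p y z + w' * orient q y z = v' * orient y' y z"
        using orient_affine_comb[OF s r, of y z] by (simp add: orient_def[of y y z])
      moreover have "w * orient p y' z + w' * orient q y' z = v * orient y y' z"
        using orient_affine_comb[OF s r, of y' z] by (simp add: orient_def[of y' y' z])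
      ultimately have "v * (w * orient p y z + w' * orient q y z) + v' * (w * orient p y' z + w' * orient q y' z) = 0"
        using orient_swap[of y y' z] by simp
      then have "e * (v * (w * orient p y z + w' * orient q y z) + v' * (w * orient p y' z + w' * orient q y' z)) = 0"
        by simp
      then have "v * (w * (e * orient p y z) + w' * (e * orient q y z)) + v' * (w * (e * orient p y' z) + w' * (e * orient q y' z)) = 0"
        unfolding distrib_left by (simp only: mult.left_commute[of e])
      moreover have "0 < v * (w * (e * orient p y z) + w' * (e * orient q y z)) + v' * (w * (e * orient p y' z) + w' * (e * orient q y' z))"
      proof -
        have "0 < w" "0 < w'" "0 < v" "0 < v'" using o by (simp_all add: w_def w'_def v_def v'_def)
        then show ?thesis
          by (intro add_pos_pos mult_pos_pos[of v] mult_pos_pos[of v'] mult_pos_pos[of w] mult_pos_pos[of w'] pos) simp_all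
      qed
      ultimately show False by simp
    qed
  qed
  show False using main[OF S eq] main[OF S(2,1) eq[symmetric]] ne by linarith
qed

text \<open>After subtraction of \<open>\<sigma> 0\<close> modulo \<open>m\<close> the map is
  strictly increasing from \<open>{..<m}\<close> into itself, hence the identity.\<close>

lemma cyclic_bijection_is_rotation:
  fixes \<sigma> :: "nat \<Rightarrow> nat"
  assumes bij: "bij_betw \<sigma> {..<m} {..<m}" and m: "0 < m"
    and cyc: "\<And>i k l. i < k \<Longrightarrow> k < l \<Longrightarrow> l < m \<Longrightarrow> cyclic3 (\<sigma> i) (\<sigma> k) (\<sigma> l)"
  shows "\<exists>c. \<forall>i<m. \<sigma> i = (i + c) mod m"
proof -
  define c where "c = \<sigma> 0"
  have lt: "\<sigma> i < m" if "i < m" for i using bij that by (auto simp: bij_betw_def)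
  define \<tau> where "\<tau> = (\<lambda>i. if c \<le> \<sigma> i then \<sigma> i - c else \<sigma> i + m - c)"
  have c: "c < m" using lt m by (simp add: c_def)
  have \<tau>m: "\<tau> i < m" if "i < m" for i using lt[OF that] c by (auto simp: \<tau>_def)
  have \<tau>\<sigma>: "\<sigma> i = (\<tau> i + c) mod m" if "i < m" for i using lt[OF that] c by (auto simp: \<tau>_def)
  have mono: "\<tau> k < \<tau> l" if "k < l" "l < m" for k l
  proof (cases "k = 0")
    case True
    have "\<sigma> l \<noteq> \<sigma> 0" using inj_onD[OF bij_betw_imp_inj_on[OF bij], of l 0] that m by auto
    then show ?thesis using True lt[OF that(2)] c by (auto simp: \<tau>_def c_def)
  next
    case False
    then have "cyclic3 c (\<sigma> k) (\<sigma> l)" using cyc[of 0 k l] that by (simp add: c_def)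
    then show ?thesis using lt[of k] lt[OF that(2)] that c unfolding cyclic3_def by (auto simp: \<tau>_def)
  qed
  have ge: "i \<le> \<tau> i" if "i < m" for i
    using that
  proof (induction i)
    case (Suc i)
    then show ?case using mono[of i "Suc i"] by simp
  qed simp
  have le: "\<tau> (m - 1 - i) \<le> m - 1 - i" if "i < m" for i
    using that
  proof (induction i)
    case 0
    then show ?case using \<tau>m[of "m - 1"] by simp
  next
    case (Suc i)
    then have "\<tau> (m - 1 - Suc i) < \<tau> (m - 1 - i)" by (intro mono) auto
    then show ?case using Suc by simp
  qed
  have "\<tau> i = i" if "i < m" for i using ge[OF that] le[of "m - 1 - i"] that by simp
  then show ?thesis using \<tau>\<sigma> by auto
qed

text \<open>Both numberings have the same runs, so one is a function of the other; orientations of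
  representatives force this function to preserve the cyclic order.\<close>

lemma run_index_shift:
  assumes J: "run_index X Y u m j" and J': "run_index X Y v m' j'"
  shows "m' = m" "\<exists>c. \<forall>p\<in>X \<union> Y. j' p = (j p + c) mod m"
proof -
  have im: "j ` (X \<union> Y) = {..<m}" "4 \<le> m" and im': "j' ` (X \<union> Y) = {..<m'}"
    using run_indexD(1-3)[OF J] run_indexD(1-3)[OF J'] by simp_all
  have ex: "\<exists>p. p \<in> X \<union> Y \<and> j p = i" if "i < m" for i using im that by (metis imageE lessThan_iff)
  define rep where "rep = (\<lambda>i. SOME p. p \<in> X \<union> Y \<and> j p = i)"
  have rep: "rep i \<in> X \<union> Y" "j (rep i) = i" if "i < m" for i
    using someI_ex[OF ex[OF that]] by (simp_all add: rep_def)
  define \<sigma> where "\<sigma> = j' \<circ> rep"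
  have jm: "j p < m" if "p \<in> X \<union> Y" for p using im that by blast
  have \<sigma>: "j' p = \<sigma> (j p)" if "p \<in> X \<union> Y" for p
    using run_index_same_partition[OF J J' that rep(1)[OF jm[OF that]]] rep(2)[OF jm[OF that]] by (simp add: \<sigma>_def)
  have inj: "inj_on \<sigma> {..<m}"
  proof (rule inj_onI)
    fix i k assume ik: "i \<in> {..<m}" "k \<in> {..<m}" "\<sigma> i = \<sigma> k"
    then have "j (rep i) = j (rep k)"
      using rep[of i] rep[of k] by (intro run_index_same_partition[OF J' J]) (auto simp: \<sigma>_def)
    then show "i = k" using rep[of i] rep[of k] ik by simp
  qed
  have "\<sigma> ` {..<m} = {..<m'}"
  proof -
    have "\<sigma> ` (j ` (X \<union> Y)) = j' ` (X \<union> Y)" unfolding image_image by (rule image_cong[OF refl]) (simp add: \<sigma>)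
    then show ?thesis using im im' by simp
  qed
  then have bij: "bij_betw \<sigma> {..<m} {..<m'}" using inj by (simp add: bij_betw_def)
  show mm: "m' = m" using bij_betw_same_card[OF bij] by simp
  have "\<exists>c. \<forall>i<m. \<sigma> i = (i + c) mod m"
  proof (rule cyclic_bijection_is_rotation)
    show "bij_betw \<sigma> {..<m} {..<m}" using bij mm by simp
    show "0 < m" using im by simp
    fix i k l assume ikl: "i < k" "k < l" "l < m"
    then have lt: "i < m" "k < m" "l < m" by simp_all
    have "0 < orient (rep i) (rep k) (rep l)"
      using orient_iff_cyclic3(1)[OF J rep(1)[OF lt(1)] rep(1)[OF lt(2)] rep(1)[OF lt(3)]] ikl
      unfolding rep(2)[OF lt(1)] rep(2)[OF lt(2)] rep(2)[OF lt(3)] by (simp add: cyclic3_def)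
    moreover have "\<sigma> i \<noteq> \<sigma> k" "\<sigma> k \<noteq> \<sigma> l" "\<sigma> i \<noteq> \<sigma> l"
      using inj lt ikl by (auto dest: inj_onD)
    ultimately show "cyclic3 (\<sigma> i) (\<sigma> k) (\<sigma> l)"
      using orient_iff_cyclic3(1)[OF J' rep(1)[OF lt(1)] rep(1)[OF lt(2)] rep(1)[OF lt(3)]] by (simp add: \<sigma>_def)
  qed
  then show "\<exists>c. \<forall>p\<in>X \<union> Y. j' p = (j p + c) mod m" using \<sigma> jm by metis
qed

section \<open>The first Fourier coefficient of the runs\<close>

lemma orient_cis:
  "orient (cis a) (cis b) (cis c) = 4 * sin ((b - a) / 2) * sin ((c - b) / 2) * sin ((c - a) / 2)"
proof -
  define x y where "x = (b - a) / 2" and "y = (c - b) / 2"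
  have e: "b - a = 2 * x" "c - b = 2 * y" "c - a = 2 * (x + y)" by (simp_all add: x_def y_def field_simps)
  have "orient (cis a) (cis b) (cis c) = sin (b - a) + sin (c - b) - sin (c - a)"
    by (simp add: orient_def sin_diff algebra_simps)
  also have "\<dots> = 2 * sin x * cos x + 2 * sin y * cos y - 2 * (sin x * cos y + cos x * sin y) * (cos x * cos y - sin x * sin y)"
    unfolding e sin_double by (simp add: sin_add cos_add)
  also have "\<dots> = 2 * sin x * cos x * (1 - (cos y)\<^sup>2 + (sin y)\<^sup>2) + 2 * sin y * cos y * (1 - (cos x)\<^sup>2 + (sin x)\<^sup>2)"
    by (simp add: algebra_simps power2_eq_square)
  also have "\<dots> = 4 * sin x * sin y * (sin x * cos y + cos x * sin y)"
    unfolding sin_squared_eq[symmetric] by (simp add: algebra_simps power2_eq_square)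
  finally have "orient (cis a) (cis b) (cis c) = 4 * sin x * sin y * sin (x + y)" by (simp only: sin_add)
  moreover have "(c - a) / 2 = x + y" by (simp add: x_def y_def field_simps)
  ultimately show ?thesis by (simp only: x_def[symmetric] y_def[symmetric])
qed

lemma orient_roots_pos:
  assumes "i < k" "k < l" "l < (m::nat)"
  shows "0 < orient (cis (2 * pi / m) ^ i) (cis (2 * pi / m) ^ k) (cis (2 * pi / m) ^ l)"
proof -
  have *: "0 < sin ((real b * (2 * pi / m) - real a * (2 * pi / m)) / 2)" if "a < b" "b < m" for a b
  proof (rule sin_gt_zero)
    have "real b - real a < m" "0 < real b - real a" using that by auto
    moreover have "(real b * (2 * pi / m) - real a * (2 * pi / m)) / 2 = pi * ((real b - real a) / m)"
      using that by (simp add: field_simps)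
    moreover have "(real b - real a) / m < 1" using that by simp
    then have "pi * ((real b - real a) / m) < pi * 1" by (rule mult_strict_left_mono) simp
    ultimately show "0 < (real b * (2 * pi / m) - real a * (2 * pi / m)) / 2"
      "(real b * (2 * pi / m) - real a * (2 * pi / m)) / 2 < pi" by simp_all
  qed
  show ?thesis unfolding Complex.DeMoivre orient_cis using assms by (intro mult_pos_pos * ) auto
qed

lemma sum_powers_root_of_unity:
  assumes "2 \<le> (m::nat)"
  shows "(\<Sum>i<m. cis (2 * pi / m) ^ i) = 0"
proof -
  have "cis (2 * pi / m) \<noteq> 1"
  proof
    assume "cis (2 * pi / m) = 1"
    then have "cos (2 * pi / m) = 1" by (simp add: complex_eq_iff)
    then obtain n :: int where n: "2 * pi / m = of_int n * 2 * pi" using cos_one_2pi_int[of "2 * pi / m"] by auto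
    then have "2 * pi * 1 = 2 * pi * (of_int n * of_nat m)" using assms by (simp add: field_simps)
    then have "1 = real_of_int (n * int m)" by (subst (asm) mult_cancel_left) simp
    then have "n * int m = 1" by (metis of_int_eq_1_iff)
    then have "int m dvd 1" by (metis dvd_triv_right)
    then show False using assms by simp
  qed
  moreover have "cis (2 * pi / m) ^ m = 1" using assms by (simp add: Complex.DeMoivre)
  ultimately show ?thesis by (simp add: sum_gp_strict)
qed

text \<open>A Cauchy--Binet identity for the points \<open>(1, x, y)\<close> and \<open>(1, C, D)\<close>.\<close>

lemma sum_orient_orient:
  fixes w x y C D :: "'a \<Rightarrow> real"
  assumes C: "(\<Sum>p\<in>S. w p * C p) = 0" and D: "(\<Sum>p\<in>S. w p * D p) = 0"
  shows "(\<Sum>p\<in>S. \<Sum>q\<in>S. \<Sum>r\<in>S. w p * w q * w r *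
      (orient (Complex (x p) (y p)) (Complex (x q) (y q)) (Complex (x r) (y r)) *
       orient (Complex (C p) (D p)) (Complex (C q) (D q)) (Complex (C r) (D r)))) =
    6 * (\<Sum>p\<in>S. w p) * ((\<Sum>p\<in>S. w p * x p * C p) * (\<Sum>p\<in>S. w p * y p * D p) -
      (\<Sum>p\<in>S. w p * x p * D p) * (\<Sum>p\<in>S. w p * y p * C p))"
proof -
  define G where "G = (\<lambda>p q. x p * y q - y p * x q)"
  define H where "H = (\<lambda>p q. C p * D q - D p * C q)"
  define T where "T = (\<lambda>f. \<Sum>p\<in>S. \<Sum>q\<in>S. \<Sum>r\<in>S. w p * w q * w r * (f p q r :: real))"
  have cyc: "T (\<lambda>p q r. f q r p) = T f" for f
  proof -
    have "T (\<lambda>p q r. f q r p) = (\<Sum>q\<in>S. \<Sum>p\<in>S. \<Sum>r\<in>S. w p * w q * w r * f q r p)"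
      unfolding T_def by (rule sum.swap)
    also have "\<dots> = (\<Sum>q\<in>S. \<Sum>r\<in>S. \<Sum>p\<in>S. w p * w q * w r * f q r p)"
      by (intro sum.cong refl sum.swap)
    also have "\<dots> = T f" unfolding T_def by (intro sum.cong refl) (simp add: mult_ac)
    finally show ?thesis .
  qed
  have add: "T (\<lambda>p q r. f p q r + g p q r) = T f + T g" for f g
    by (simp add: T_def sum.distrib distrib_left)
  define O' where "O' = (\<lambda>p q r. G p q + G q r + G r p)"
  have H1: "(\<Sum>p\<in>S. w p * H p q) = 0" for q
  proof -
    have "(\<Sum>p\<in>S. w p * H p q) = (\<Sum>p\<in>S. w p * C p) * D q - (\<Sum>p\<in>S. w p * D p) * C q"
      unfolding sum_distrib_right sum_subtractf[symmetric] by (intro sum.cong refl) (simp add: H_def algebra_simps)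
    then show ?thesis using C D by simp
  qed
  have H2: "(\<Sum>q\<in>S. w q * H p q) = 0" for p
  proof -
    have "H p q = - H q p" for q by (simp add: H_def)
    then have "(\<Sum>q\<in>S. w q * H p q) = - (\<Sum>q\<in>S. w q * H q p)" by (simp add: sum_negf)
    then show ?thesis using H1 by simp
  qed
  \<comment> \<open>Against \<open>H p q\<close> only the minor \<open>G p q\<close> survives: in
    the other two products one index of \<open>H\<close> does not occur in \<open>G\<close>, and the
    weighted sum of \<open>H\<close> over that index is 0.\<close>
  have z1: "T (\<lambda>p q r. G q r * H p q) = 0"
  proof -
    have "T (\<lambda>p q r. G q r * H p q) = (\<Sum>q\<in>S. \<Sum>r\<in>S. \<Sum>p\<in>S. w p * w q * w r * (G q r * H p q))"
      unfolding T_def by (subst sum.swap) (intro sum.cong refl sum.swap)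
    also have "\<dots> = (\<Sum>q\<in>S. \<Sum>r\<in>S. w q * w r * G q r * (\<Sum>p\<in>S. w p * H p q))"
      by (simp add: sum_distrib_left mult_ac)
    finally show ?thesis by (simp add: H1)
  qed
  have z2: "T (\<lambda>p q r. G r p * H p q) = 0"
  proof -
    have "T (\<lambda>p q r. G r p * H p q) = (\<Sum>p\<in>S. \<Sum>r\<in>S. \<Sum>q\<in>S. w p * w q * w r * (G r p * H p q))"
      unfolding T_def by (intro sum.cong refl sum.swap)
    also have "\<dots> = (\<Sum>p\<in>S. \<Sum>r\<in>S. w p * w r * G r p * (\<Sum>q\<in>S. w q * H p q))"
      by (simp add: sum_distrib_left mult_ac)
    finally show ?thesis by (simp add: H2)
  qed
  have z3: "T (\<lambda>p q r. G p q * H p q) = (\<Sum>p\<in>S. w p) * (\<Sum>p\<in>S. \<Sum>q\<in>S. w p * w q * (G p q * H p q))"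
    unfolding T_def by (simp add: sum_distrib_left sum_distrib_right mult_ac)
  have OH: "T (\<lambda>p q r. O' p q r * H p q) = (\<Sum>p\<in>S. w p) * (\<Sum>p\<in>S. \<Sum>q\<in>S. w p * w q * (G p q * H p q))"
    unfolding O'_def distrib_right add z1 z2 z3 by simp
  have "T (\<lambda>p q r. O' p q r * (H p q + H q r + H r p)) = 3 * T (\<lambda>p q r. O' p q r * H p q)"
  proof -
    have "O' p q r = O' q r p" for p q r by (simp add: O'_def)
    then have e: "T (\<lambda>p q r. O' p q r * H q r) = T (\<lambda>p q r. O' q r p * H q r)"
      "T (\<lambda>p q r. O' p q r * H r p) = T (\<lambda>p q r. O' r p q * H r p)" by metis+
    have "T (\<lambda>p q r. O' r p q * H r p) = T (\<lambda>p q r. O' p q r * H p q)"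
      using cyc[of "\<lambda>p q r. O' q r p * H q r"] cyc[of "\<lambda>p q r. O' p q r * H p q"] by simp
    then show ?thesis unfolding distrib_left add e cyc[of "\<lambda>p q r. O' p q r * H p q"] by simp
  qed
  also have "\<dots> = 3 * (\<Sum>p\<in>S. w p) * (\<Sum>p\<in>S. \<Sum>q\<in>S. w p * w q * (G p q * H p q))" using OH by simp
  also have "(\<Sum>p\<in>S. \<Sum>q\<in>S. w p * w q * (G p q * H p q)) =
      (\<Sum>p\<in>S. \<Sum>q\<in>S. (w p * x p * C p) * (w q * y q * D q)) - (\<Sum>p\<in>S. \<Sum>q\<in>S. (w p * x p * D p) * (w q * y q * C q))
      - (\<Sum>p\<in>S. \<Sum>q\<in>S. (w p * y p * C p) * (w q * x q * D q)) + (\<Sum>p\<in>S. \<Sum>q\<in>S. (w p * y p * D p) * (w q * x q * C q))"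
    unfolding sum_subtractf[symmetric] sum.distrib[symmetric]
    by (intro sum.cong refl) (simp add: G_def H_def algebra_simps)
  also have "\<dots> = 2 * ((\<Sum>p\<in>S. w p * x p * C p) * (\<Sum>p\<in>S. w p * y p * D p) -
      (\<Sum>p\<in>S. w p * x p * D p) * (\<Sum>p\<in>S. w p * y p * C p))"
    unfolding sum_product[symmetric] by (simp add: algebra_simps)
  finally have "T (\<lambda>p q r. O' p q r * (H p q + H q r + H r p)) = 6 * (\<Sum>p\<in>S. w p) * ((\<Sum>p\<in>S. w p * x p * C p) * (\<Sum>p\<in>S. w p * y p * D p) -
      (\<Sum>p\<in>S. w p * x p * D p) * (\<Sum>p\<in>S. w p * y p * C p))" by simp
  moreover have "orient (Complex (x p) (y p)) (Complex (x q) (y q)) (Complex (x r) (y r)) = O' p q r"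
    "orient (Complex (C p) (D p)) (Complex (C q) (D q)) (Complex (C r) (D r)) = H p q + H q r + H r p" for p q r
    by (simp_all add: orient_def O'_def G_def H_def algebra_simps)
  ultimately show ?thesis unfolding T_def by simp
qed

text \<open>\<open>m\<close> times the first Fourier coefficient of the polygon whose vertices are
  the averages of \<open>f\<close> over the runs; the division gives every run the same weight,
  whatever its size.\<close>

definition run_moment :: "complex set \<Rightarrow> (complex \<Rightarrow> nat) \<Rightarrow> nat \<Rightarrow> (complex \<Rightarrow> complex) \<Rightarrow> complex" where
  "run_moment S j m f = (\<Sum>p\<in>S. f p * cis (2 * pi / m) ^ j p / card {q \<in> S. j q = j p})"

lemma sum_over_runs:
  fixes F :: "nat \<Rightarrow> 'a::field_char_0"
  assumes "finite S" "j ` S = {..<m}"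
  shows "(\<Sum>p\<in>S. F (j p) / of_nat (card {q \<in> S. j q = j p})) = (\<Sum>i<m. F i)"
proof -
  have "(\<Sum>p\<in>S. F (j p) / of_nat (card {q \<in> S. j q = j p})) =
      (\<Sum>i<m. \<Sum>p\<in>{p \<in> S. j p = i}. F (j p) / of_nat (card {q \<in> S. j q = j p}))"
    using assms by (intro sum.group[symmetric]) auto
  also have "\<dots> = (\<Sum>i<m. F i)"
  proof (rule sum.cong[OF refl])
    fix i assume "i \<in> {..<m}"
    then have "i \<in> j ` S" using assms by simp
    then have ne: "card {p \<in> S. j p = i} \<noteq> 0" using assms(1) by auto
    have "(\<Sum>p\<in>{p \<in> S. j p = i}. F (j p) / of_nat (card {q \<in> S. j q = j p})) =
      (\<Sum>p\<in>{p \<in> S. j p = i}. F i / of_nat (card {q \<in> S. j q = i}))" by (rule sum.cong) auto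
    also have "\<dots> = F i" using ne by simp
    finally show "(\<Sum>p\<in>{p \<in> S. j p = i}. F (j p) / of_nat (card {q \<in> S. j q = j p})) = F i" .
  qed
  finally show ?thesis .
qed

text \<open>The difference of the squared moduli is -4 times a determinant, which by the preceding
  identity is a positive multiple of a sum over triples of points; each term multiplies the
  orientation of the points by that of the corresponding roots of unity. For points in three
  different runs both signs are given by the cyclic order, so no term is negative, and the runs 0,
  1, 2 contribute a positive one.\<close>

lemma run_moment_nondegenerate:
  assumes fin: "finite X" "finite Y" and J: "run_index X Y u m j"
  shows "cmod (run_moment (X \<union> Y) j m (\<lambda>p. p)) \<noteq> cmod (run_moment (X \<union> Y) j m cnj)"
proof
  assume eq: "cmod (run_moment (X \<union> Y) j m (\<lambda>p. p)) = cmod (run_moment (X \<union> Y) j m cnj)"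
  define S where "S = X \<union> Y"
  have finS: "finite S" using fin by (simp add: S_def)
  note J' = run_indexD[OF J, folded S_def]
  define z where "z = (\<lambda>p. cis (2 * pi / m) ^ j p)"
  define w where "w = (\<lambda>p. 1 / real (card {q \<in> S. j q = j p}))"
  define x y C D where "x = Re" and "y = Im" and "C = (\<lambda>p. Re (z p))" and "D = (\<lambda>p. Im (z p))"
  have wpos: "0 < w p" if "p \<in> S" for p using that finS by (auto simp: w_def card_gt_0_iff)
  have sz: "(\<Sum>p\<in>S. of_real (w p) * z p) = 0"
    using sum_over_runs[OF finS J'(3), of "\<lambda>i. cis (2 * pi / m) ^ i"] sum_powers_root_of_unity[of m] J'(1)
    by (simp add: z_def w_def)
  have sC: "(\<Sum>p\<in>S. w p * C p) = 0" using arg_cong[OF sz, of Re] by (simp add: C_def)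
  have sD: "(\<Sum>p\<in>S. w p * D p) = 0" using arg_cong[OF sz, of Im] by (simp add: D_def)
  define P1 P2 Q1 Q2 where "P1 = (\<Sum>p\<in>S. w p * x p * C p)" and "P2 = (\<Sum>p\<in>S. w p * x p * D p)"
    and "Q1 = (\<Sum>p\<in>S. w p * y p * C p)" and "Q2 = (\<Sum>p\<in>S. w p * y p * D p)"
  have A: "run_moment S j m (\<lambda>p. p) = Complex (P1 - Q2) (P2 + Q1)"
    by (rule complex_eqI)
      (simp_all add: run_moment_def P1_def P2_def Q1_def Q2_def w_def x_def y_def C_def D_def z_def
        algebra_simps diff_divide_distrib add_divide_distrib sum_subtractf sum.distrib)
  have B: "run_moment S j m cnj = Complex (P1 + Q2) (P2 - Q1)"
    by (rule complex_eqI)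
      (simp_all add: run_moment_def P1_def P2_def Q1_def Q2_def w_def x_def y_def C_def D_def z_def
        algebra_simps diff_divide_distrib add_divide_distrib sum_subtractf sum.distrib)
  have "(P1 - Q2)\<^sup>2 + (P2 + Q1)\<^sup>2 = (P1 + Q2)\<^sup>2 + (P2 - Q1)\<^sup>2"
    using arg_cong[OF eq[folded S_def], of "\<lambda>t. t\<^sup>2"] unfolding A B by (simp add: cmod_power2)
  then have det: "P1 * Q2 - P2 * Q1 = 0" by (simp add: power2_eq_square algebra_simps)
  define f where "f = (\<lambda>(p, q, r). w p * w q * w r * (orient p q r * orient (z p) (z q) (z r)))"
  have T0: "sum f (S \<times> S \<times> S) = 0"
    using sum_orient_orient[OF sC sD, of x y] det
    by (simp add: sum.cartesian_product[symmetric] f_def x_def y_def C_def D_def P1_def P2_def Q1_def Q2_def)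
  have zp: "0 < orient (z p) (z q) (z r)" if "p \<in> S" "q \<in> S" "r \<in> S" "cyclic3 (j p) (j q) (j r)" for p q r
  proof -
    have lt: "j p < m" "j q < m" "j r < m" using that J'(3) by auto
    show ?thesis
      using that(4) lt orient_roots_pos[of "j p" "j q" "j r" m] orient_roots_pos[of "j q" "j r" "j p" m]
        orient_roots_pos[of "j r" "j p" "j q" m] orient_rotate[of "z p" "z q" "z r"] orient_rotate[of "z r" "z p" "z q"]
      unfolding cyclic3_def z_def by auto
  qed
  have nn: "0 \<le> f a" if a: "a \<in> S \<times> S \<times> S" for a
  proof -
    obtain p q r where pqr: "a = (p, q, r)" "p \<in> S" "q \<in> S" "r \<in> S" using a by auto
    have "0 \<le> orient p q r * orient (z p) (z q) (z r)"
    proof (cases "j p \<noteq> j q \<and> j q \<noteq> j r \<and> j p \<noteq> j r")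
      case True
      show ?thesis
      proof (cases "cyclic3 (j p) (j q) (j r)")
        case c: True
        then show ?thesis using orient_iff_cyclic3(1)[OF J, of p q r] pqr True zp[of p q r] by (simp add: S_def)
      next
        case False
        then have c: "cyclic3 (j q) (j p) (j r)" using True unfolding cyclic3_def by linarith
        then have "0 < orient q p r" using orient_iff_cyclic3(1)[OF J, of q p r] pqr True by (simp add: S_def)
        then have "0 < orient q p r * orient (z q) (z p) (z r)" using zp[OF pqr(3,2,4) c] by simp
        then show ?thesis using orient_swap[of p q r] orient_swap[of "z p" "z q" "z r"] by simp
      qed
    next
      case False
      then have "z p = z q \<or> z q = z r \<or> z p = z r" by (auto simp: z_def)
      then have "orient (z p) (z q) (z r) = 0" by (auto simp: orient_def)
      then show ?thesis by simp
    qed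
    then show ?thesis using wpos pqr by (auto simp: f_def intro!: mult_nonneg_nonneg less_imp_le[OF wpos])
  qed
  have "0 \<in> j ` S" "1 \<in> j ` S" "2 \<in> j ` S" using J'(1,3) by auto
  then obtain p q r where pqr: "p \<in> S" "q \<in> S" "r \<in> S" "j p = 0" "j q = 1" "j r = 2"
    by (metis imageE)
  have "0 < f (p, q, r)"
    using pqr wpos J'(5)[of p q r] zp[of p q r] by (simp add: f_def cyclic3_def)
  then have "0 < sum f (S \<times> S \<times> S)"
    using nn pqr finS by (intro sum_pos2[of _ "(p, q, r)"]) auto
  then show False using T0 by simp
qed

text \<open>In the numbering belonging to \<open>v\<close>, the average heights of the runs
  \<open>i\<close> and \<open>m - 1 - i\<close> agree, and \<open>\<zeta> ^ (m - 1 - i)\<close> is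
  the conjugate of \<open>\<zeta> ^ (i + 1)\<close>; so the conjugate of the moment is \<zeta> times
  the moment. Returning to the numbering \<open>j\<close> only changes the moment by a power of
  \<zeta>.\<close>

lemma run_moment_reflection:
  assumes fin: "finite X" "finite Y" and J: "run_index X Y u m j" and J': "run_index X Y v m' j'"
  obtains \<omega> where "\<omega> ^ m = 1"
    "run_moment (X \<union> Y) j m (\<lambda>p. of_real (Im (cnj v * p))) =
     \<omega> * cnj (run_moment (X \<union> Y) j m (\<lambda>p. of_real (Im (cnj v * p))))"
proof -
  define S where "S = X \<union> Y"
  have finS: "finite S" using fin by (simp add: S_def)
  define h where "h = (\<lambda>p. Im (cnj v * p))"
  define \<zeta> where "\<zeta> = cis (2 * pi / m)"
  define t where "t = run_moment S j m (\<lambda>p. of_real (h p))"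
  note JD = run_indexD[OF J, folded S_def] and JD' = run_indexD[OF J', folded S_def]
  have [simp]: "m' = m" using run_index_shift(1)[OF J J'] .
  obtain c where c: "\<And>p. p \<in> S \<Longrightarrow> j' p = (j p + c) mod m" using run_index_shift(2)[OF J J'] by (auto simp: S_def)
  have m: "0 < m" using JD(1) by simp
  have \<zeta>m: "\<zeta> ^ m = 1" using m by (simp add: \<zeta>_def Complex.DeMoivre)
  have \<zeta>0: "\<zeta> \<noteq> 0" by (simp add: \<zeta>_def)
  have \<zeta>c: "\<zeta> * cnj \<zeta> = 1" by (simp add: \<zeta>_def cis_cnj cis_mult)
  have part: "{q \<in> S. j' q = j' p} = {q \<in> S. j q = j p}" if "p \<in> S" for p
    using run_index_same_partition[OF J J'] run_index_same_partition[OF J' J] that unfolding S_def by blast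
  define w where "w = (\<lambda>i. 1 / real (card {q \<in> S. j' q = i}))"
  define g where "g = (\<lambda>i. w i * (\<Sum>p\<in>{p \<in> S. j' p = i}. h p))"
  \<comment> \<open>Such sums depend only on how many points of a run lie on each level, and these
    numbers are preserved by the reflection.\<close>
  have fib: "(\<Sum>p\<in>{p \<in> S. j' p = i}. F (h p)) = (\<Sum>s\<in>h ` S. real (card {p \<in> S. j' p = i \<and> h p = s}) * F s)" for i and F :: "real \<Rightarrow> real"
  proof -
    have "(\<Sum>p\<in>{p \<in> S. j' p = i}. F (h p)) = (\<Sum>s\<in>h ` S. \<Sum>p\<in>{p \<in> {p \<in> S. j' p = i}. h p = s}. F (h p))"
      using finS by (intro sum.group[symmetric]) auto
    also have "\<dots> = (\<Sum>s\<in>h ` S. \<Sum>p\<in>{p \<in> S. j' p = i \<and> h p = s}. F s)"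
      by (intro sum.cong) auto
    finally show ?thesis by simp
  qed
  have sym: "(\<Sum>p\<in>{p \<in> S. j' p = i}. F (h p)) = (\<Sum>p\<in>{p \<in> S. j' p = m - 1 - i}. F (h p))" if "i < m" for i and F :: "real \<Rightarrow> real"
    unfolding fib using JD'(6)[of i] that by (simp add: h_def)
  have wsym: "w (m - 1 - i) = w i" if "i < m" for i
    using sym[OF that, of "\<lambda>_. 1"] by (simp add: w_def)
  have gsym: "g (m - 1 - i) = g i" if "i < m" for i
    using sym[OF that, of "\<lambda>s. s"] wsym[OF that] by (simp add: g_def)
  have "\<zeta> ^ c * t = (\<Sum>p\<in>S. of_real (h p) * \<zeta> ^ j' p * of_real (w (j' p)))"
  proof -
    have "\<zeta> ^ c * (of_real (h p) * \<zeta> ^ j p / of_nat (card {q \<in> S. j q = j p})) = of_real (h p) * \<zeta> ^ j' p * of_real (w (j' p))" if "p \<in> S" for p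
    proof -
      have "\<zeta> ^ (j p + c) = (\<zeta> ^ m) ^ ((j p + c) div m) * \<zeta> ^ ((j p + c) mod m)"
        by (simp add: power_mult[symmetric] power_add[symmetric])
      then have "\<zeta> ^ j' p = \<zeta> ^ j p * \<zeta> ^ c" using c[OF that] \<zeta>m by (simp add: power_add)
      then show ?thesis using part[OF that] by (simp add: w_def)
    qed
    then show ?thesis unfolding t_def run_moment_def \<zeta>_def[symmetric] sum_distrib_left by (intro sum.cong) auto
  qed
  also have "\<dots> = (\<Sum>i<m. \<Sum>p\<in>{p \<in> S. j' p = i}. of_real (h p) * \<zeta> ^ j' p * of_real (w (j' p)))"
    using finS JD'(3) by (intro sum.group[symmetric]) auto
  also have "\<dots> = (\<Sum>i<m. of_real (g i) * \<zeta> ^ i)"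
    by (intro sum.cong refl) (simp add: g_def sum_distrib_left sum_distrib_right mult_ac)
  finally have ct: "\<zeta> ^ c * t = (\<Sum>i<m. of_real (g i) * \<zeta> ^ i)" .
  have "cnj (\<zeta> ^ c * t) = (\<Sum>i<m. of_real (g i) * cnj \<zeta> ^ i)" unfolding ct by simp
  also have "\<dots> = (\<Sum>i<m. of_real (g (m - Suc i)) * cnj \<zeta> ^ (m - Suc i))"
    by (rule sum.nat_diff_reindex[symmetric])
  also have "\<dots> = (\<Sum>i<m. \<zeta> * (of_real (g i) * \<zeta> ^ i))"
  proof (rule sum.cong[OF refl])
    fix i assume "i \<in> {..<m}"
    then have i: "i < m" by simp
    have "\<zeta> ^ Suc i * cnj \<zeta> ^ (m - Suc i) * cnj \<zeta> ^ Suc i = \<zeta> ^ Suc i * cnj (\<zeta> ^ m)"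
      using i by (simp add: power_add[symmetric] mult.assoc del: power_Suc)
    also have "\<dots> = \<zeta> ^ Suc i" unfolding \<zeta>m by simp
    finally have "(\<zeta> * cnj \<zeta>) ^ Suc i * cnj \<zeta> ^ (m - Suc i) = \<zeta> ^ Suc i" unfolding power_mult_distrib by (simp only: mult_ac)
    then have "cnj \<zeta> ^ (m - Suc i) = \<zeta> ^ Suc i" unfolding \<zeta>c by simp
    then show "of_real (g (m - Suc i)) * cnj \<zeta> ^ (m - Suc i) = \<zeta> * (of_real (g i) * \<zeta> ^ i)"
      using gsym[OF i] by simp
  qed
  also have "\<dots> = \<zeta> * (\<zeta> ^ c * t)" unfolding ct sum_distrib_left ..
  finally have "cnj \<zeta> ^ c * cnj t = \<zeta> ^ Suc c * t" by simp
  then have "\<zeta> ^ c * (cnj \<zeta> ^ c * cnj t) = \<zeta> ^ c * (\<zeta> ^ Suc c * t)" by simp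
  then have "(\<zeta> * cnj \<zeta>) ^ c * cnj t = \<zeta> ^ (c + Suc c) * t"
    by (simp only: power_mult_distrib power_add mult.assoc)
  then have "cnj t = \<zeta> ^ (c + Suc c) * t" unfolding \<zeta>c by simp
  moreover have "\<zeta> ^ (c + Suc c) \<noteq> 0" using \<zeta>0 by simp
  ultimately have "t = inverse (\<zeta> ^ (c + Suc c)) * cnj t" by (metis left_inverse mult.assoc mult_1)
  moreover have "inverse (\<zeta> ^ (c + Suc c)) ^ m = 1"
    using \<zeta>m by (metis inverse_1 power_inverse power_mult mult.commute power_one)
  ultimately show ?thesis using that unfolding t_def h_def S_def by blast
qed

text \<open>Multiplied out, so that quadruples with coinciding entries need no separate
  treatment.\<close>

definition same_cross_ratios :: "'a set \<Rightarrow> ('a \<Rightarrow> complex) \<Rightarrow> ('a \<Rightarrow> complex) \<Rightarrow> bool" where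
  "same_cross_ratios U f g \<longleftrightarrow> (\<forall>a\<in>U. \<forall>b\<in>U. \<forall>c\<in>U. \<forall>d\<in>U.
     (f a - f b) * (f c - f d) * ((g a - g c) * (g b - g d)) = (f a - f c) * (f b - f d) * ((g a - g b) * (g c - g d)))"

lemma same_cross_ratiosD:
  assumes "same_cross_ratios U f g" "a \<in> U" "b \<in> U" "c \<in> U" "d \<in> U"
  shows "(f a - f b) * (f c - f d) * ((g a - g c) * (g b - g d)) = (f a - f c) * (f b - f d) * ((g a - g b) * (g c - g d))"
  using assms unfolding same_cross_ratios_def by blast

theorem cross_ratio_of_balanced_directions:
  fixes X Y U :: "complex set"
  assumes fin: "finite X" "finite Y" and ne: "X \<union> Y \<noteq> {}"
    and hull: "X \<inter> convex hull Y = {}" "Y \<inter> convex hull X = {}"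
    and bal: "\<And>u t. u \<in> U \<Longrightarrow> card {x \<in> X. Im (cnj u * x) = t} = card {y \<in> Y. Im (cnj u * y) = t}"
    and U: "pairwise (\<lambda>u v. Im (cnj u * v) \<noteq> 0) U" "0 \<notin> U" "a \<in> U" "b \<in> U" "a \<noteq> b"
  obtains m :: nat and \<omega> :: "complex \<Rightarrow> complex" where
    "0 < m" "\<And>u. u \<in> U \<Longrightarrow> \<omega> u ^ m = 1" "inj_on \<omega> U"
    "same_cross_ratios U \<omega> (\<lambda>u. cnj u / u)"
proof -
  define S where "S = X \<union> Y"
  have h: "Im (cnj u * \<Sum>X) = Im (cnj u * \<Sum>Y)" if "u \<in> U" for u
  proof -
    define h where "h = (\<lambda>p. Im (cnj u * p))"
    have *: "Im (cnj u * \<Sum>A) = (\<Sum>s\<in>h ` (X \<union> Y). real (card {p \<in> A. h p = s}) * s)" if "A \<subseteq> X \<union> Y" for A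
    proof -
      have "Im (cnj u * \<Sum>A) = (\<Sum>p\<in>A. h p)" unfolding sum_distrib_left Im_sum h_def ..
      also have "\<dots> = (\<Sum>s\<in>h ` (X \<union> Y). \<Sum>p\<in>{p \<in> A. h p = s}. h p)"
        using fin that by (intro sum.group[symmetric]) (auto intro: finite_subset)
      also have "\<dots> = (\<Sum>s\<in>h ` (X \<union> Y). \<Sum>p\<in>{p \<in> A. h p = s}. s)" by (intro sum.cong) auto
      finally show ?thesis by simp
    qed
    show ?thesis using *[of X] *[of Y] bal[OF that] by (simp add: h_def)
  qed
  \<comment> \<open>The two sums have equal heights with respect to every direction of
    \<open>U\<close>, and the heights for two nonparallel directions determine a vector.\<close>
  have sums: "\<Sum>X = \<Sum>Y"
  proof -
    define d where "d = \<Sum>X - \<Sum>Y"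
    have d: "Im (cnj a * d) = 0" "Im (cnj b * d) = 0"
      using h[OF U(3)] h[OF U(4)] by (simp_all add: d_def right_diff_distrib)
    have ab: "Im (cnj a * b) \<noteq> 0" using U by (auto simp: pairwise_def)
    have "Im (cnj a * b) *\<^sub>R d = Im (cnj a * d) *\<^sub>R b - Im (cnj b * d) *\<^sub>R a"
      by (rule complex_eqI) (simp_all add: algebra_simps)
    then have "d = 0" using d ab by simp
    then show ?thesis by (simp add: d_def)
  qed
  have nz: "u \<noteq> 0" if "u \<in> U" for u using U that by auto
  have ex: "\<exists>m j. run_index X Y u m j" if "u \<in> U" for u
    using ex_run_index[OF fin ne hull nz[OF that] bal[OF that] sums] .
  obtain m j where J: "run_index X Y a m j" using ex[OF U(3)] by blast
  have m: "0 < m" using run_indexD(1)[OF J] by simp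
  define A where "A = run_moment S j m (\<lambda>p. p)"
  define B where "B = run_moment S j m cnj"
  have AB: "cmod A \<noteq> cmod B" using run_moment_nondegenerate[OF fin J] by (simp add: A_def B_def S_def)
  define \<mu> where "\<mu> = (\<lambda>u. cnj u / u)"
  have fold_\<mu>: "cnj u / u = \<mu> u" for u by (simp add: \<mu>_def)
  have \<mu>1: "cmod (\<mu> u) = 1" if "u \<in> U" for u using nz[OF that] by (simp add: \<mu>_def norm_divide)
  have den: "cnj B * \<mu> u - cnj A \<noteq> 0" if "u \<in> U" for u
  proof
    assume "cnj B * \<mu> u - cnj A = 0"
    then have "cmod (cnj B * \<mu> u) = cmod (cnj A)" by simp
    then show False using AB \<mu>1[OF that] by (simp add: norm_mult)
  qed
  \<comment> \<open>The moment of the heights is \<open>(cnj u * A - u * B) / (2 * \<i>)\<close>.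
    Its quotient by its own conjugate, after division of both by \<open>u\<close>, is this
    fractional linear function of \<open>\<mu> u\<close>.\<close>
  define \<omega> where "\<omega> = (\<lambda>u. (A * \<mu> u - B) / (cnj B * \<mu> u - cnj A))"
  have root: "\<omega> u ^ m = 1" if u: "u \<in> U" for u
  proof -
    obtain m' j' where J': "run_index X Y u m' j'" using ex[OF u] by blast
    obtain w where w: "w ^ m = 1" "run_moment S j m (\<lambda>p. of_real (Im (cnj u * p))) =
        w * cnj (run_moment S j m (\<lambda>p. of_real (Im (cnj u * p))))"
      using run_moment_reflection[OF fin J J'] unfolding S_def by blast
    have im: "of_real (Im z) = (z - cnj z) / (2 * \<i>)" for z by (simp add: complex_eq_iff)
    have t: "run_moment S j m (\<lambda>p. of_real (Im (cnj u * p))) = (cnj u * A - u * B) / (2 * \<i>)"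
      unfolding im A_def B_def run_moment_def
      by (simp add: sum_distrib_left sum_subtractf[symmetric] sum_divide_distrib diff_divide_distrib algebra_simps)
    have "(cnj u * A - u * B) / (2 * \<i>) = w * cnj ((cnj u * A - u * B) / (2 * \<i>))"
      using w(2) unfolding t .
    also have "cnj ((cnj u * A - u * B) / (2 * \<i>)) = (cnj u * cnj B - u * cnj A) / (2 * \<i>)"
    proof -
      have "cnj (z / (2 * \<i>)) = (- cnj z) / (2 * \<i>)" for z by (simp add: divide_simps)
      from this[of "cnj u * A - u * B"] show ?thesis by simp
    qed
    finally have "(cnj u * A - u * B) / (2 * \<i>) = (w * (cnj u * cnj B - u * cnj A)) / (2 * \<i>)"
      by (simp only: times_divide_eq_right)
    then have "cnj u * A - u * B = w * (cnj u * cnj B - u * cnj A)" by simp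
    then have "(cnj u * A - u * B) / u = w * ((cnj u * cnj B - u * cnj A) / u)" by simp
    then have "A * \<mu> u - B = w * (cnj B * \<mu> u - cnj A)"
      using nz[OF u] by (simp add: \<mu>_def diff_divide_distrib mult.commute)
    then have "\<omega> u = w" using den[OF u] by (simp add: \<omega>_def)
    then show ?thesis using w(1) by simp
  qed
  \<comment> \<open>The determinant of the fractional linear map, nonzero because \<open>A\<close>
    and \<open>B\<close> have different moduli.\<close>
  define \<delta> where "\<delta> = cnj B * B - cnj A * A"
  have \<delta>: "\<delta> \<noteq> 0"
  proof
    assume "\<delta> = 0"
    then have "(cmod B)\<^sup>2 = (cmod A)\<^sup>2" unfolding \<delta>_def
      by (metis complex_norm_square eq_iff_diff_eq_0 mult.commute of_real_eq_iff)
    then show False using AB by simp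
  qed
  \<comment> \<open>Injectivity and invariance of cross ratios both come from this formula, since in
    a cross ratio the factors belonging to each argument cancel.\<close>
  have diff: "\<omega> u - \<omega> v = (\<mu> u - \<mu> v) * (\<delta> / ((cnj B * \<mu> u - cnj A) * (cnj B * \<mu> v - cnj A)))" if "u \<in> U" "v \<in> U" for u v
    using den[OF that(1)] den[OF that(2)] unfolding \<omega>_def \<delta>_def by (simp add: field_simps)
  have \<mu>inj: "\<mu> u \<noteq> \<mu> v" if "u \<in> U" "v \<in> U" "u \<noteq> v" for u v
  proof
    assume "\<mu> u = \<mu> v"
    then have "cnj u * v = u * cnj v" using nz that by (simp add: \<mu>_def field_simps)
    then have "Im (cnj u * v) = 0" by (auto simp: complex_eq_iff mult.commute)
    then show False using U(1) that by (auto simp: pairwise_def)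
  qed
  show ?thesis
  proof (rule that[OF m root])
    show "inj_on \<omega> U"
    proof (rule inj_onI, rule ccontr)
      fix u v assume uv: "u \<in> U" "v \<in> U" "\<omega> u = \<omega> v" "u \<noteq> v"
      then show False using diff[OF uv(1,2)] \<mu>inj[OF uv(1,2,4)] \<delta> den[OF uv(1)] den[OF uv(2)] by simp
    qed
    show "same_cross_ratios U \<omega> (\<lambda>u. cnj u / u)"
      unfolding same_cross_ratios_def fold_\<mu> by (simp add: diff mult_ac)
  qed
qed

section \<open>Algebraic Delone sets\<close>

lemma complex_ring_simps:
  "carrier complex_ring = UNIV" "x \<otimes>\<^bsub>complex_ring\<^esub> y = x * y" "\<one>\<^bsub>complex_ring\<^esub> = 1"
  "\<zero>\<^bsub>complex_ring\<^esub> = 0" "x \<oplus>\<^bsub>complex_ring\<^esub> y = x + y"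
  by (simp_all add: ring_of_type_algebra_def)

interpretation complex_ring: ring complex_ring
  by (rule ring_from_type_algebra)

lemma complex_ring_uminus: "\<ominus>\<^bsub>complex_ring\<^esub> x = - x"
  by (rule complex_ring.minus_equality) (simp_all add: complex_ring_simps)

lemma complex_ring_inverse: "x \<noteq> 0 \<Longrightarrow> inv\<^bsub>complex_ring\<^esub> x = inverse x"
  by (rule complex_ring.inv_unique'[symmetric]) (simp_all add: complex_ring_simps)

lemma difference_field_rat: "q \<in> \<rat> \<Longrightarrow> q \<in> difference_field \<Lambda>"
  unfolding difference_field_def by (rule generate_field.incl) simp

lemma difference_field_diff: "v \<in> \<Lambda> \<Longrightarrow> w \<in> \<Lambda> \<Longrightarrow> v - w \<in> difference_field \<Lambda>"
  unfolding difference_field_def by (rule generate_field.incl) (auto simp: difference_set_def)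

lemma difference_field_add: "x \<in> difference_field \<Lambda> \<Longrightarrow> y \<in> difference_field \<Lambda> \<Longrightarrow> x + y \<in> difference_field \<Lambda>"
  unfolding difference_field_def using generate_field.eng_add[of x complex_ring _ y] by (simp add: complex_ring_simps)

lemma difference_field_mult: "x \<in> difference_field \<Lambda> \<Longrightarrow> y \<in> difference_field \<Lambda> \<Longrightarrow> x * y \<in> difference_field \<Lambda>"
  unfolding difference_field_def using generate_field.eng_mult[of x complex_ring _ y] by (simp add: complex_ring_simps)

lemma difference_field_uminus: "x \<in> difference_field \<Lambda> \<Longrightarrow> - x \<in> difference_field \<Lambda>"
  unfolding difference_field_def using generate_field.a_inv[of x complex_ring] by (simp add: complex_ring_uminus)

lemma difference_field_minus: "x \<in> difference_field \<Lambda> \<Longrightarrow> y \<in> difference_field \<Lambda> \<Longrightarrow> x - y \<in> difference_field \<Lambda>"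
  using difference_field_add[of x \<Lambda> "- y"] difference_field_uminus[of y \<Lambda>] by simp

lemma difference_field_inverse:
  assumes "x \<in> difference_field \<Lambda>"
  shows "inverse x \<in> difference_field \<Lambda>"
proof (cases "x = 0")
  case False
  then show ?thesis using assms generate_field.m_inv[of x complex_ring]
    unfolding difference_field_def by (simp add: complex_ring_simps complex_ring_inverse)
qed (use difference_field_rat[of 0] in simp)

lemma difference_field_divide: "x \<in> difference_field \<Lambda> \<Longrightarrow> y \<in> difference_field \<Lambda> \<Longrightarrow> x / y \<in> difference_field \<Lambda>"
  unfolding divide_inverse by (intro difference_field_mult difference_field_inverse)

text \<open>The generating set is invariant under conjugation, and conjugation commutes with the
  field operations.\<close>

lemma difference_field_cnj:
  assumes "x \<in> difference_field \<Lambda>"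
  shows "cnj x \<in> difference_field \<Lambda>"
  using assms unfolding difference_field_def
proof induction
  case one
  then show ?case using difference_field_rat[of 1 \<Lambda>] by (simp add: complex_ring_simps difference_field_def)
next
  case (incl h)
  have "cnj h \<in> \<rat> \<union> (difference_set \<Lambda> \<union> cnj ` difference_set \<Lambda>)"
    using incl by (auto elim!: Rats_cases')
  then show ?case by (rule generate_field.incl)
next
  case (a_inv h)
  then show ?case using difference_field_uminus[of "cnj h" \<Lambda>] by (simp add: complex_ring_uminus difference_field_def)
next
  case (m_inv h)
  then show ?case using difference_field_inverse[of "cnj h" \<Lambda>]
    by (simp add: complex_ring_inverse complex_ring_simps difference_field_def)
next
  case (eng_add x y)
  then show ?case using difference_field_add[of "cnj x" \<Lambda> "cnj y"] by (simp add: complex_ring_simps difference_field_def)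
next
  case (eng_mult x y)
  then show ?case using difference_field_mult[of "cnj x" \<Lambda> "cnj y"] by (simp add: complex_ring_simps difference_field_def)
qed

text \<open>Reads a linear combination of powers of \<open>x\<close> as a rational polynomial at
  \<open>x\<close>. \<open>combine\<close> stops at the end of the shorter list, so nontriviality
  concerns \<open>take l Ks\<close>; the starting exponent \<open>j\<close> is general for the sake
  of the induction.\<close>

lemma combine_powers:
  assumes "set Ks \<subseteq> \<rat>"
  shows "\<exists>g :: rat poly. (g = 0 \<or> degree g < l) \<and> (g = 0 \<longrightarrow> set (take l Ks) \<subseteq> {0}) \<and>
    complex_ring.combine Ks (map ((^) x) [j..<j + l]) = x ^ j * poly (cpoly g) x"
  using assms
proof (induction Ks arbitrary: j l)
  case Nil
  show ?case by (intro exI[of _ 0]) (simp add: complex_ring_simps)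
next
  case (Cons k Ks)
  show ?case
  proof (cases l)
    case 0
    then show ?thesis by (intro exI[of _ 0]) (simp add: complex_ring_simps)
  next
    case (Suc l')
    obtain g :: "rat poly" where g: "g = 0 \<or> degree g < l'" "g = 0 \<longrightarrow> set (take l' Ks) \<subseteq> {0}"
      "complex_ring.combine Ks (map ((^) x) [Suc j..<Suc j + l']) = x ^ Suc j * poly (cpoly g) x"
      using Cons.IH[of l' "Suc j"] Cons.prems by auto
    obtain r where r: "k = of_rat r" using Cons.prems by (auto elim: Rats_cases)
    have m: "map ((^) x) [j..<j + l] = x ^ j # map ((^) x) [Suc j..<Suc j + l']"
    proof -
      have "[j..<j + l] = j # [Suc j..<Suc j + l']" using Suc upt_conv_Cons[of j "j + l"] by (simp del: upt_Suc)
      then show ?thesis by (simp only: list.map)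
    qed
    have p: "poly (cpoly (pCons r g)) x = k + x * poly (cpoly g) x"
      by (cases "r = 0 \<and> g = 0") (auto simp: r map_poly_pCons)
    have "complex_ring.combine (k # Ks) (map ((^) x) [j..<j + l]) = x ^ j * poly (cpoly (pCons r g)) x"
      unfolding m p complex_ring.combine.simps g(3) by (simp add: complex_ring_simps algebra_simps)
    moreover have "pCons r g = 0 \<or> degree (pCons r g) < l" using g(1) Suc by (auto simp: degree_pCons_eq_if)
    moreover have "pCons r g = 0 \<longrightarrow> set (take l (k # Ks)) \<subseteq> {0}" using g(2) Suc r by auto
    ultimately show ?thesis by blast
  qed
qed

text \<open>In dimension \<open>n\<close> the powers of \<open>x\<close> with exponents 0 to
  \<open>n\<close> are dependent, so one bound serves all elements.\<close>

lemma finite_dimension_degree_at_most: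
  assumes "complex_ring.finite_dimension \<rat> K" and pow: "\<And>x n. x \<in> K \<Longrightarrow> x ^ n \<in> K"
  shows "\<exists>D. \<forall>x\<in>K. degree_at_most D x"
proof -
  obtain n where n: "complex_ring.dimension n \<rat> K" using assms(1) complex_ring.finite_dimensionE' by blast
  have sub: "subfield (\<rat> :: complex set) complex_ring"
  proof (rule Subrings.field.subfieldI'[OF field_from_type_algebra])
    show "subring (\<rat> :: complex set) complex_ring"
      by (rule complex_ring.subringI) (auto simp: complex_ring_simps complex_ring_uminus)
    show "inv\<^bsub>complex_ring\<^esub> k \<in> \<rat>" if "k \<in> \<rat> - {\<zero>\<^bsub>complex_ring\<^esub>}" for k
      using that by (auto simp: complex_ring_simps complex_ring_inverse)
  qed
  have "degree_at_most n x" if x: "x \<in> K" for x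
  proof -
    define Us where "Us = map ((^) x) [0..<0 + Suc n]"
    have "\<not> complex_ring.independent \<rat> Us"
    proof
      assume "complex_ring.independent \<rat> Us"
      then have "length Us \<le> n"
        using pow[OF x] by (intro complex_ring.independent_length_le_dimension[OF sub n]) (auto simp: Us_def)
      then show False by (simp add: Us_def)
    qed
    then obtain Ks where Ks: "set Ks \<subseteq> \<rat>" "complex_ring.combine Ks Us = 0" "\<not> set (take (length Us) Ks) \<subseteq> {0}"
      using complex_ring.trivial_combine_imp_independent[OF sub, of Us] by (auto simp: complex_ring_simps)
    obtain g :: "rat poly" where g: "g = 0 \<or> degree g < Suc n" "g = 0 \<longrightarrow> set (take (Suc n) Ks) \<subseteq> {0}"
      "complex_ring.combine Ks Us = x ^ 0 * poly (cpoly g) x"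
      using combine_powers[OF Ks(1), of "Suc n" x 0] unfolding Us_def by blast
    have "g \<noteq> 0" using g(2) Ks(3) by (auto simp: Us_def)
    then show ?thesis using g Ks(2) unfolding degree_at_most_def by (intro exI[of _ g]) auto
  qed
  then show ?thesis by blast
qed

section \<open>Directions and X-rays\<close>

lemma parallel_iff:
  assumes "u \<noteq> 0" "v \<noteq> 0"
  shows "parallel u v \<longleftrightarrow> Im (cnj u * v) = 0"
proof
  assume "parallel u v"
  then show "Im (cnj u * v) = 0" by (auto simp: parallel_def)
next
  assume a: "Im (cnj u * v) = 0"
  define c where "c = Re (cnj u * v) / (cmod u)\<^sup>2"
  have "cnj u * v = of_real (Re (cnj u * v))" using a by (simp add: complex_eq_iff)
  moreover have "of_real ((cmod u)\<^sup>2) * v = u * (cnj u * v)" by (simp only: complex_norm_square mult.assoc)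
  ultimately have "of_real ((cmod u)\<^sup>2) * v = of_real (Re (cnj u * v)) * u" by (metis mult.commute)
  then have v: "v = c *\<^sub>R u" using assms(1) by (simp add: c_def scaleR_conv_of_real field_simps)
  then have "c \<noteq> 0" using assms(2) by auto
  then show "parallel u v" unfolding parallel_def using v by blast
qed

lemma parallel_slope:
  assumes "parallel u v" "u \<noteq> 0"
  shows "cnj v / v = cnj u / u"
  using assms by (auto simp: parallel_def scaleR_conv_of_real)

lemma slope_eq_imp:
  assumes "u \<noteq> 0" "v \<noteq> 0" "cnj u / u = cnj v / v"
  shows "Im (cnj u * v) = 0"
proof -
  have "cnj u * v = u * cnj v" using assms by (simp add: field_simps)
  then show ?thesis by (auto simp: complex_eq_iff mult.commute)
qed

text \<open>Normalising a difference to length 1 may leave the field, but \<open>cnj u / u\<close>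
  is not affected by real factors, and the field is closed under conjugation.\<close>

lemma direction_of_slope:
  assumes "direction_of \<Lambda> u"
  shows "cnj u / u \<in> difference_field \<Lambda>" "u \<noteq> 0"
proof -
  obtain v where v: "v \<in> difference_set \<Lambda>" "v \<noteq> 0" "parallel u v" and n: "cmod u = 1"
    using assms by (auto simp: direction_of_def)
  show u: "u \<noteq> 0" using n by auto
  have "v \<in> difference_field \<Lambda>" using v(1) difference_field_diff by (auto simp: difference_set_def)
  then show "cnj u / u \<in> difference_field \<Lambda>"
    unfolding parallel_slope[OF v(3) u, symmetric] by (intro difference_field_divide difference_field_cnj)
qed

text \<open>A homothety that maps 0 and \<open>w\<close> into \<Lambda> produces a difference that
  is a positive multiple of \<open>w\<close>.\<close>

lemma direction_of_sgn:
  assumes "algebraic_Delone \<Lambda>" "w \<in> difference_field \<Lambda>" "w \<noteq> 0"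
  shows "direction_of \<Lambda> (sgn w)"
proof -
  have "finite {0, w}" "{0, w} \<subseteq> difference_field \<Lambda>" using assms difference_field_rat[of 0] by auto
  then obtain h where h: "homothety h" "h ` {0, w} \<subseteq> \<Lambda>" using assms(1) unfolding algebraic_Delone_def by metis
  then obtain c t where c: "0 < c" "h = (\<lambda>z. of_real c * z + t)" unfolding homothety_def by blast
  have "h w - h 0 \<in> difference_set \<Lambda>" using h(2) by (auto simp: difference_set_def)
  moreover have "h w - h 0 = of_real c * w" by (simp add: c)
  ultimately have "of_real c * w \<in> difference_set \<Lambda>" by simp
  moreover have "parallel (sgn w) (of_real c * w)"
    unfolding parallel_def using assms(3) c(1)
    by (intro exI[of _ "c * cmod w"]) (simp add: sgn_div_norm scaleR_conv_of_real)
  ultimately show ?thesis unfolding direction_of_def using assms(3) c(1)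
    by (intro conjI bexI[of _ "of_real c * w"]) (auto simp: norm_sgn)
qed

lemma Delone_nonreal_difference:
  assumes "Delone \<Lambda>"
  obtains \<tau> where "\<tau> \<in> difference_field \<Lambda>" "Im \<tau> \<noteq> 0"
proof -
  obtain R where R: "0 < R" "\<And>z. ball z R \<inter> \<Lambda> \<noteq> {}"
    using assms unfolding Delone_def relatively_dense_def by blast
  obtain p where p: "p \<in> \<Lambda>" "cmod p < R" using R(2)[of 0] by (auto simp: dist_norm)
  \<comment> \<open>Points at distance less than \<open>R\<close> from 0 and from
    \<open>Complex 0 (2 * R)\<close> have different imaginary parts.\<close>
  obtain q where q: "q \<in> \<Lambda>" "cmod (Complex 0 (2 * R) - q) < R" using R(2)[of "Complex 0 (2 * R)"] by (auto simp: dist_norm)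
  have "Im p < R" using p(2) abs_Im_le_cmod[of p] by simp
  moreover have "2 * R - Im q < R" using q(2) abs_Im_le_cmod[of "Complex 0 (2 * R) - q"] by simp
  ultimately have "Im (q - p) \<noteq> 0" by simp
  then show ?thesis using that difference_field_diff[OF q(1) p(1)] by blast
qed

lemma convex_subsets_finite:
  assumes "uniform_discrete \<Lambda>" "F \<in> convex_subsets_of \<Lambda>"
  shows "finite F"
  using assms uniform_discrete_finite_iff uniform_discrete_subset unfolding convex_subsets_of_def by blast

lemma X_ray_eq_level_card:
  assumes "X_ray u F = X_ray u F'" "cmod u = 1"
  shows "card {x \<in> F. Im (cnj u * x) = t} = card {x \<in> F'. Im (cnj u * x) = t}"
proof -
  define l where "l = range (\<lambda>s::real. \<i> * of_real t * u + s *\<^sub>R u)"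
  have l: "l \<in> lines_in_direction u" unfolding lines_in_direction_def l_def by blast
  have uu: "cnj u * u = 1" using assms(2) complex_norm_square[of u] by (simp add: mult.commute)
  have "z \<in> l \<longleftrightarrow> Im (cnj u * z) = t" for z
  proof
    assume "z \<in> l"
    then obtain s :: real where "z = \<i> * of_real t * u + s *\<^sub>R u" unfolding l_def by blast
    then have "cnj u * z = (\<i> * of_real t + of_real s) * (cnj u * u)" by (simp add: scaleR_conv_of_real algebra_simps)
    then show "Im (cnj u * z) = t" by (simp add: uu)
  next
    assume z: "Im (cnj u * z) = t"
    have "z = (cnj u * z) * u" using uu by (simp add: mult.commute mult.left_commute)
    also have "cnj u * z = \<i> * of_real t + of_real (Re (cnj u * z))" using z by (simp add: complex_eq_iff)
    finally have "z = \<i> * of_real t * u + Re (cnj u * z) *\<^sub>R u"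
      by (simp add: scaleR_conv_of_real distrib_right)
    then show "z \<in> l" unfolding l_def by blast
  qed
  then have "G \<inter> l = {x \<in> G. Im (cnj u * x) = t}" for G by blast
  moreover have "card (F \<inter> l) = card (F' \<inter> l)" using fun_cong[OF assms(1), of l] l by (simp add: X_ray_def)
  ultimately show ?thesis by simp
qed

lemma not_determined_roots_of_unity:
  assumes ud: "uniform_discrete \<Lambda>" and U: "nonparallel_directions_of \<Lambda> U" "a \<in> U" "b \<in> U" "a \<noteq> b"
    and nd: "\<not> determined_by_X_rays (convex_subsets_of \<Lambda>) U"
  obtains m :: nat and \<omega> :: "complex \<Rightarrow> complex" where
    "0 < m" "\<And>u. u \<in> U \<Longrightarrow> \<omega> u ^ m = 1" "inj_on \<omega> U"
    "same_cross_ratios U \<omega> (\<lambda>u. cnj u / u)"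
proof -
  obtain F F' where F: "F \<in> convex_subsets_of \<Lambda>" "F' \<in> convex_subsets_of \<Lambda>"
    "\<And>u. u \<in> U \<Longrightarrow> X_ray u F = X_ray u F'" "F \<noteq> F'"
    using nd unfolding determined_by_X_rays_def by blast
  note fin = convex_subsets_finite[OF ud F(1)] convex_subsets_finite[OF ud F(2)]
  \<comment> \<open>A point of \<Lambda> in the hull of \<open>F'\<close> belongs to
    \<open>F'\<close>.\<close>
  have hull: "(F - F') \<inter> convex hull (F' - F) = {}" if "F \<in> convex_subsets_of \<Lambda>" "F' \<in> convex_subsets_of \<Lambda>" for F F'
  proof -
    have "F \<subseteq> \<Lambda>" "F' = convex hull F' \<inter> \<Lambda>" using that unfolding convex_subsets_of_def by blast+
    moreover have "convex hull (F' - F) \<subseteq> convex hull F'" by (intro hull_mono) blast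
    ultimately show ?thesis by blast
  qed
  have dir: "direction_of \<Lambda> u" if "u \<in> U" for u using U(1) that unfolding nonparallel_directions_of_def by blast
  have nz: "u \<noteq> 0" if "u \<in> U" for u using direction_of_slope(2)[OF dir[OF that]] .
  have bal: "card {x \<in> F - F'. Im (cnj u * x) = t} = card {y \<in> F' - F. Im (cnj u * y) = t}" if "u \<in> U" for u t
  proof -
    have "cmod u = 1" using dir[OF that] by (simp add: direction_of_def)
    then have c: "card {x \<in> F. Im (cnj u * x) = t} = card {x \<in> F'. Im (cnj u * x) = t}"
      using X_ray_eq_level_card F(3)[OF that] by blast
    have "{x \<in> F - F'. Im (cnj u * x) = t} = {x \<in> F. Im (cnj u * x) = t} - {x \<in> F'. Im (cnj u * x) = t}"
      "{x \<in> F' - F. Im (cnj u * x) = t} = {x \<in> F'. Im (cnj u * x) = t} - {x \<in> F. Im (cnj u * x) = t}" by auto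
    moreover have "card (A - B) = card (B - A)" if "card A = card B" "finite A" "finite B" for A B :: "complex set"
      using that by (metis card_Diff_subset_Int finite_Int inf_commute)
    ultimately show ?thesis using c fin by simp
  qed
  have np: "pairwise (\<lambda>u v. Im (cnj u * v) \<noteq> 0) U"
  proof (rule pairwiseI)
    fix u v assume "u \<in> U" "v \<in> U" "u \<noteq> v"
    then have "\<not> parallel u v" using U(1) unfolding nonparallel_directions_of_def pairwise_def by blast
    then show "Im (cnj u * v) \<noteq> 0" using parallel_iff nz \<open>u \<in> U\<close> \<open>v \<in> U\<close> by blast
  qed
  have "F - F' \<union> (F' - F) \<noteq> {}" using F(4) by blast
  from cross_ratio_of_balanced_directions[OF _ _ this hull[OF F(1,2)] hull[OF F(2,1)] bal np _ U(2-4)]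
  show ?thesis using fin nz that by blast
qed

text \<open>The real linear function \<open>l\<close> has the value 1 at \<open>w2\<close> and
  \<open>w3\<close>, hence 2 at \<open>- w1\<close> and at most 1 at the other five vertices of the
  hexagon.\<close>

lemma hexagon_vertex_extreme:
  assumes s: "w1 + w2 + w3 = 0" and d: "Im (cnj w2 * w3) \<noteq> 0" and c: "0 < (c::real)"
    and h: "\<And>z. h z = of_real c * z + t"
  shows "h (- w1) \<notin> convex hull (h ` {w1, w2, w3, - w2, - w3})"
proof
  define \<delta> where "\<delta> = Im (cnj w2 * w3)"
  define l where "l = (\<lambda>z. Im (cnj (w2 - w3) * z) / \<delta>)"
  have lin: "l (a *\<^sub>R x + b *\<^sub>R y) = a * l x + b * l y" for a b x y
    by (simp add: l_def add_divide_distrib[symmetric] scaleR_conv_of_real algebra_simps)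
  have lh: "l (h z) = c * l z + l t" for z
    using lin[of c z 1 t] by (simp add: h scaleR_conv_of_real)
  have l23: "l w2 = 1" "l w3 = 1"
    using d by (simp_all add: l_def \<delta>_def algebra_simps)
  have neg: "l (- z) = - l z" for z using lin[of "-1" z 0 0] by simp
  have w1: "w1 = - w2 - w3" using s by (simp add: algebra_simps eq_neg_iff_add_eq_0)
  have l1: "l w1 = - 2" using lin[of "-1" w2 "-1" w3] l23 by (simp add: w1)
  have cv: "convex {z. l z \<le> c + l t}"
  proof (rule convexI)
    fix x y and u v :: real
    assume xy: "x \<in> {z. l z \<le> c + l t}" "y \<in> {z. l z \<le> c + l t}" and uv: "0 \<le> u" "0 \<le> v" "u + v = 1"
    have "l (u *\<^sub>R x + v *\<^sub>R y) \<le> u * (c + l t) + v * (c + l t)"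
      unfolding lin using xy uv by (intro add_mono mult_left_mono) auto
    also have "\<dots> = c + l t" using uv(3) by (simp flip: distrib_right)
    finally show "u *\<^sub>R x + v *\<^sub>R y \<in> {z. l z \<le> c + l t}" by simp
  qed
  have "h ` {w1, w2, w3, - w2, - w3} \<subseteq> {z. l z \<le> c + l t}"
    using c by (auto simp: lh neg l23 l1)
  then have "convex hull (h ` {w1, w2, w3, - w2, - w3}) \<subseteq> {z. l z \<le> c + l t}"
    using cv by (rule hull_minimal)
  moreover assume "h (- w1) \<in> convex hull (h ` {w1, w2, w3, - w2, - w3})"
  ultimately have "l (h (- w1)) \<le> c + l t" by blast
  then show False using c by (simp add: lh neg l1)
qed

text \<open>A convex set stays convex when an extreme point is removed.\<close>

lemma delete_extreme_point_mem_convex_hull: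
  assumes "finite V" "p \<notin> convex hull V" "G \<subseteq> convex hull (insert p V)" "p \<notin> G"
  shows "p \<notin> convex hull G"
proof -
  have "p extreme_point_of (convex hull (insert p V))"
    by (rule extreme_point_of_convex_hull_insert[OF assms(1,2)])
  then have "convex (convex hull (insert p V) - {p})"
    by (simp add: extreme_point_of_stillconvex)
  then have "convex hull G \<subseteq> convex hull (insert p V) - {p}"
    using assms(3,4) by (intro hull_minimal) auto
  then show ?thesis by blast
qed

text \<open>Translation by \<open>w1\<close> moves \<open>w2\<close> to \<open>- w3\<close> and
  \<open>w3\<close> to \<open>- w2\<close>, and translation by twice \<open>w1\<close> moves
  \<open>- w1\<close> to \<open>w1\<close>; so a line parallel to \<open>w1\<close> meets both
  triangles in equally many vertices.\<close>

lemma hexagon_card_line: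
  assumes s: "w1 + w2 + w3 = 0" and h: "\<And>z. h z = of_real c * z + t" "c \<noteq> 0"
    and d: "w1 \<noteq> w2" "w2 \<noteq> w3" "w1 \<noteq> w3" and p: "w1 = r *\<^sub>R u" and l: "l \<in> lines_in_direction u"
  shows "card (h ` {w1, w2, w3} \<inter> l) = card (h ` {- w1, - w2, - w3} \<inter> l)"
proof -
  obtain z0 where l_eq: "l = range (\<lambda>t::real. z0 + t *\<^sub>R u)" using l unfolding lines_in_direction_def by blast
  have shift: "x + q *\<^sub>R u \<in> l \<longleftrightarrow> x \<in> l" for x q
  proof -
    have *: "x + q *\<^sub>R u \<in> l" if xl: "x \<in> l" for x q
    proof -
      obtain k :: real where "x = z0 + k *\<^sub>R u" using xl unfolding l_eq by auto
      then have "x + q *\<^sub>R u = z0 + (k + q) *\<^sub>R u" by (simp add: scaleR_add_left)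
      then show ?thesis unfolding l_eq by blast
    qed
    from *[of x q] *[of "x + q *\<^sub>R u" "- q"] show ?thesis by auto
  qed
  have inj: "h x = h y \<longleftrightarrow> x = y" for x y using h by simp
  have m1: "h (- w1) \<in> l \<longleftrightarrow> h w1 \<in> l"
    using shift[of "h (- w1)" "2 * c * r"] by (simp add: h p scaleR_conv_of_real algebra_simps)
  have w3: "w3 = - w2 - r *\<^sub>R u" using s p by (simp add: algebra_simps eq_neg_iff_add_eq_0)
  have m2: "h (- w3) \<in> l \<longleftrightarrow> h w2 \<in> l"
    using shift[of "h w2" "c * r"] by (simp add: h w3 scaleR_conv_of_real algebra_simps)
  have m3: "h (- w2) \<in> l \<longleftrightarrow> h w3 \<in> l"
    using shift[of "h w3" "c * r"] by (simp add: h w3 scaleR_conv_of_real algebra_simps)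
  define \<pi> where "\<pi> = (\<lambda>x. if x = h w1 then h (- w1) else if x = h w2 then h (- w3) else h (- w2))"
  have \<pi>: "\<pi> (h w1) = h (- w1)" "\<pi> (h w2) = h (- w3)" "\<pi> (h w3) = h (- w2)" using d by (auto simp: \<pi>_def inj)
  have "inj_on \<pi> (h ` {w1, w2, w3} \<inter> l)"
  proof (rule inj_on_subset)
    show "inj_on \<pi> (h ` {w1, w2, w3})" using d by (simp add: \<pi> inj)
  qed simp
  moreover have "\<pi> ` (h ` {w1, w2, w3} \<inter> l) = h ` {- w1, - w2, - w3} \<inter> l"
  proof (intro equalityI subsetI)
    fix y assume "y \<in> \<pi> ` (h ` {w1, w2, w3} \<inter> l)"
    then show "y \<in> h ` {- w1, - w2, - w3} \<inter> l" using \<pi> m1 m2 m3 by auto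
  next
    fix y assume y: "y \<in> h ` {- w1, - w2, - w3} \<inter> l"
    then consider "y = h (- w1)" "y \<in> l" | "y = h (- w2)" "y \<in> l" | "y = h (- w3)" "y \<in> l" by blast
    then show "y \<in> \<pi> ` (h ` {w1, w2, w3} \<inter> l)"
    proof cases
      case 1
      then show ?thesis using \<pi>(1) m1 by (intro image_eqI[of _ _ "h w1"]) auto
    next
      case 2
      then show ?thesis using \<pi>(3) m3 by (intro image_eqI[of _ _ "h w3"]) auto
    next
      case 3
      then show ?thesis using \<pi>(2) m2 by (intro image_eqI[of _ _ "h w2"]) auto
    qed
  qed
  ultimately show ?thesis using card_image by metis
qed

text \<open>Deleting alternate vertices of an affinely regular hexagon with vertices in \<open>\<Lambda>\<close>.\<close>

lemma three_directions_not_determined: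
  assumes A: "algebraic_Delone \<Lambda>" and U: "nonparallel_directions_of \<Lambda> {u1, u2, u3}" "u1 \<noteq> u2" "u1 \<noteq> u3" "u2 \<noteq> u3"
  shows "\<not> determined_by_X_rays (convex_subsets_of \<Lambda>) {u1, u2, u3}"
proof -
  have ex: "\<exists>v\<in>difference_field \<Lambda>. v \<noteq> 0 \<and> parallel u v" if "u \<in> {u1, u2, u3}" for u
  proof -
    have "direction_of \<Lambda> u" using U(1) that unfolding nonparallel_directions_of_def by blast
    then show ?thesis using difference_field_diff unfolding direction_of_def difference_set_def by blast
  qed
  obtain v1 where v1: "v1 \<in> difference_field \<Lambda>" "v1 \<noteq> 0" "parallel u1 v1" using ex[of u1] by blast
  obtain v2 where v2: "v2 \<in> difference_field \<Lambda>" "v2 \<noteq> 0" "parallel u2 v2" using ex[of u2] by blast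
  obtain v3 where v3: "v3 \<in> difference_field \<Lambda>" "v3 \<noteq> 0" "parallel u3 v3" using ex[of u3] by blast
  note v = v1(1) v2(1) v3(1) v1(2) v2(2) v3(2)
  obtain k1 where k1: "v1 = k1 *\<^sub>R u1" "k1 \<noteq> 0" using v1(3) unfolding parallel_def by blast
  obtain k2 where k2: "v2 = k2 *\<^sub>R u2" "k2 \<noteq> 0" using v2(3) unfolding parallel_def by blast
  obtain k3 where k3: "v3 = k3 *\<^sub>R u3" "k3 \<noteq> 0" using v3(3) unfolding parallel_def by blast
  note k = k1(1) k2(1) k3(1) k1(2) k2(2) k3(2)
  have unz: "u1 \<noteq> 0" "u2 \<noteq> 0" "u3 \<noteq> 0" using k v(4-6) by auto
  have np: "\<not> parallel u1 u2" "\<not> parallel u2 u3" "\<not> parallel u3 u1"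
  proof -
    have pw: "pairwise (\<lambda>u v. \<not> parallel u v) {u1, u2, u3}" using U(1) by (simp only: nonparallel_directions_of_def)
    show "\<not> parallel u1 u2" "\<not> parallel u2 u3" "\<not> parallel u3 u1"
      using pairwiseD[OF pw, of u1 u2] pairwiseD[OF pw, of u2 u3] pairwiseD[OF pw, of u3 u1] U(2-4) by simp_all
  qed
  define x where "x = (\<lambda>a b. Im (cnj a * b))"
  have xs: "x (r *\<^sub>R a) (q *\<^sub>R b) = r * q * x a b" for a b r q by (simp add: x_def algebra_simps)
  have x0: "x v1 v2 \<noteq> 0" "x v2 v3 \<noteq> 0" "x v3 v1 \<noteq> 0"
    using np parallel_iff[OF unz(1,2)] parallel_iff[OF unz(2,3)] parallel_iff[OF unz(3,1)] k
    by (simp_all add: xs) (simp_all add: x_def)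
  \<comment> \<open>The imaginary unit need not belong to the field, but it cancels in a quotient of
    two imaginary parts.\<close>
  have xK: "of_real (x a b / x a' b') \<in> difference_field \<Lambda>"
    if "a \<in> difference_field \<Lambda>" "b \<in> difference_field \<Lambda>" "a' \<in> difference_field \<Lambda>" "b' \<in> difference_field \<Lambda>" for a b a' b'
  proof -
    have e: "of_real (x a b) = (cnj a * b - cnj (cnj a * b)) / (2 * \<i>)" for a b by (simp add: x_def complex_eq_iff)
    have "of_real (x a b / x a' b') = (cnj a * b - cnj (cnj a * b)) / (cnj a' * b' - cnj (cnj a' * b'))"
      unfolding of_real_divide e by simp
    then show ?thesis using that
      by (simp only:) (intro difference_field_divide difference_field_minus difference_field_mult difference_field_cnj)
  qed
  \<comment> \<open>Any three plane vectors satisfy \<open>x v2 v3 *\<^sub>R v1 + x v3 v1 *\<^sub>R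
    v2 + x v1 v2 *\<^sub>R v3 = 0\<close>. Division by the first coefficient gives multiples of the
    vectors that sum to 0, as the hexagon requires.\<close>
  define r2 r3 where "r2 = x v3 v1 / x v2 v3" and "r3 = x v1 v2 / x v2 v3"
  define w1 w2 w3 where "w1 = v1" and "w2 = r2 *\<^sub>R v2" and "w3 = r3 *\<^sub>R v3"
  have wK: "w1 \<in> difference_field \<Lambda>" "w2 \<in> difference_field \<Lambda>" "w3 \<in> difference_field \<Lambda>"
    unfolding w1_def w2_def w3_def r2_def r3_def scaleR_conv_of_real by (intro v1(1) v2(1) v3(1) difference_field_mult xK)+
  have s: "w1 + w2 + w3 = 0"
  proof -
    have "x v2 v3 *\<^sub>R v1 + x v3 v1 *\<^sub>R v2 + x v1 v2 *\<^sub>R v3 = 0"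
      by (rule complex_eqI) (simp_all add: x_def algebra_simps)
    moreover have "x v2 v3 *\<^sub>R v1 + x v3 v1 *\<^sub>R v2 + x v1 v2 *\<^sub>R v3 = x v2 v3 *\<^sub>R (w1 + w2 + w3)"
      using x0(2) by (simp add: w1_def w2_def w3_def r2_def r3_def scaleR_add_right)
    ultimately show ?thesis using x0(2) by simp
  qed
  have s': "w2 + w3 + w1 = 0" "w3 + w1 + w2 = 0" using s by (simp_all add: add_ac)
  have xw: "x w2 w3 \<noteq> 0" "x w3 w1 \<noteq> 0" "x w1 w2 \<noteq> 0"
    using x0 xs[of 1 v1 r2 v2] xs[of r3 v3 1 v1] by (simp_all add: w1_def w2_def w3_def xs r2_def r3_def)
  have xn: "x (- a) (- b) = x a b" for a b by (simp add: x_def)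
  have wd: "w1 \<noteq> w2" "w2 \<noteq> w3" "w1 \<noteq> w3" "w1 \<noteq> - w1" "w1 \<noteq> - w2" "w1 \<noteq> - w3"
    using xw by (auto simp: x_def complex_eq_iff)
  define F where "F = {w1, w2, w3, - w1, - w2, - w3}"
  have "finite F" "F \<subseteq> difference_field \<Lambda>" unfolding F_def using wK difference_field_uminus by auto
  then obtain h where "homothety h" "h ` F \<subseteq> \<Lambda>" using A unfolding algebraic_Delone_def by metis
  then obtain c t where c: "0 < (c::real)" and h: "\<And>z. h z = of_real c * z + t" and hF: "h ` F \<subseteq> \<Lambda>"
    unfolding homothety_def by auto
  have inj: "h a = h b \<longleftrightarrow> a = b" for a b using c by (simp add: h)
  define P where "P = convex hull (h ` F)"
  define E O' where "E = h ` {w1, w2, w3}" and "O' = h ` {- w1, - w2, - w3}"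
  have FEO: "h ` F = E \<union> O'" by (auto simp: F_def E_def O'_def)
  have vert: "h (- a) \<notin> convex hull G" if "a + b + d = 0" "x b d \<noteq> 0" "F = {a, b, d, - a, - b, - d}"
    "G \<subseteq> P" "h (- a) \<notin> G" for a b d G
  proof -
    have "h (- a) \<notin> convex hull (h ` {a, b, d, - b, - d})"
      using hexagon_vertex_extreme[OF that(1) _ c h] that(2) by (simp add: x_def)
    moreover have "insert (h (- a)) (h ` {a, b, d, - b, - d}) = h ` F" unfolding that(3) by auto
    then have "G \<subseteq> convex hull (insert (h (- a)) (h ` {a, b, d, - b, - d}))" using that(4) by (simp only: P_def)
    moreover have "finite (h ` {a, b, d, - b, - d})" by simp
    ultimately show ?thesis using delete_extreme_point_mem_convex_hull[OF _ _ _ that(5)] by blast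
  qed
  \<comment> \<open>The condition on \<open>D\<close>, that none of its points is in the hull of a
    part of \<open>P\<close> avoiding it, is met by the vertices of the hexagon.\<close>
  have convex_sub: "\<Lambda> \<inter> P - D \<in> convex_subsets_of \<Lambda>"
    if "\<And>p G. p \<in> D \<Longrightarrow> G \<subseteq> P \<Longrightarrow> p \<notin> G \<Longrightarrow> p \<notin> convex hull G" for D
  proof -
    define G where "G = \<Lambda> \<inter> P - D"
    have "bounded P" unfolding P_def using \<open>finite F\<close> by (intro bounded_convex_hull finite_imp_bounded) simp
    then have "bounded G" by (rule bounded_subset) (auto simp: G_def)
    moreover have "G = convex hull G \<inter> \<Lambda>"
    proof (intro equalityI subsetI)
      fix z assume "z \<in> G"
      then show "z \<in> convex hull G \<inter> \<Lambda>" by (auto simp: G_def intro: hull_inc)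
    next
      fix z assume z: "z \<in> convex hull G \<inter> \<Lambda>"
      have "convex hull G \<subseteq> P" unfolding P_def by (intro hull_minimal) (auto simp: G_def P_def)
      then have "z \<in> \<Lambda> \<inter> P" using z by blast
      moreover have "z \<notin> D"
      proof
        assume "z \<in> D"
        then have "z \<notin> convex hull G" by (intro that) (auto simp: G_def)
        then show False using z by blast
      qed
      ultimately show "z \<in> G" by (simp add: G_def)
    qed
    ultimately show ?thesis unfolding convex_subsets_of_def G_def[symmetric] by (auto simp: G_def)
  qed
  have C1: "\<Lambda> \<inter> P - O' \<in> convex_subsets_of \<Lambda>"
  proof (rule convex_sub)
    fix p G assume pG: "p \<in> O'" "G \<subseteq> P" "p \<notin> G"
    have perm: "F = {w2, w3, w1, - w2, - w3, - w1}" "F = {w3, w1, w2, - w3, - w1, - w2}" unfolding F_def by auto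
    from pG(1) consider "p = h (- w1)" | "p = h (- w2)" | "p = h (- w3)" unfolding O'_def by blast
    then show "p \<notin> convex hull G"
      using vert[OF s xw(1) F_def pG(2)] vert[OF s'(1) xw(2) perm(1) pG(2)] vert[OF s'(2) xw(3) perm(2) pG(2)] pG(3)
      by cases auto
  qed
  have C2: "\<Lambda> \<inter> P - E \<in> convex_subsets_of \<Lambda>"
  proof (rule convex_sub)
    fix p G assume pG: "p \<in> E" "G \<subseteq> P" "p \<notin> G"
    have sn: "- w1 + - w2 + - w3 = 0" "- w2 + - w3 + - w1 = 0" "- w3 + - w1 + - w2 = 0"
    proof -
      have ng: "- a + - b + - d = 0" if "a + b + d = 0" for a b d :: complex
        using arg_cong[OF that, of uminus] by (simp only: minus_add_distrib minus_zero)
      show "- w1 + - w2 + - w3 = 0" "- w2 + - w3 + - w1 = 0" "- w3 + - w1 + - w2 = 0"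
        using ng[OF s] ng[OF s'(1)] ng[OF s'(2)] .
    qed
    have perm: "F = {- w1, - w2, - w3, - (- w1), - (- w2), - (- w3)}" "F = {- w2, - w3, - w1, - (- w2), - (- w3), - (- w1)}"
      "F = {- w3, - w1, - w2, - (- w3), - (- w1), - (- w2)}" unfolding F_def by auto
    from pG(1) consider "p = h (- (- w1))" | "p = h (- (- w2))" | "p = h (- (- w3))" unfolding E_def by auto
    then show "p \<notin> convex hull G"
      using vert[OF sn(1) _ perm(1) pG(2)] vert[OF sn(2) _ perm(2) pG(2)] vert[OF sn(3) _ perm(3) pG(2)] pG(3) xw
      by cases (auto simp: xn)
  qed
  have EO: "E \<subseteq> \<Lambda> \<inter> P" "O' \<subseteq> \<Lambda> \<inter> P" using hF hull_subset[of "h ` F" convex] unfolding P_def FEO by auto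
  have fin: "finite (\<Lambda> \<inter> P)"
  proof -
    have "finite (\<Lambda> \<inter> P - O')"
      using C1 A convex_subsets_finite unfolding algebraic_Delone_def Delone_def by blast
    then show ?thesis by (simp add: O'_def)
  qed
  have lines: "card (E \<inter> l) = card (O' \<inter> l)" if u: "u \<in> {u1, u2, u3}" and l: "l \<in> lines_in_direction u" for u l
  proof -
    have c0: "c \<noteq> 0" using c by simp
    consider "u = u1" | "u = u2" | "u = u3" using u by blast
    then show ?thesis
    proof cases
      case 1
      have "w1 = k1 *\<^sub>R u1" by (simp add: w1_def k)
      from hexagon_card_line[OF s h c0 wd(1,2,3) this] l 1 show ?thesis by (simp add: E_def O'_def)
    next
      case 2
      have "w2 = (r2 * k2) *\<^sub>R u2" by (simp add: w2_def k)
      from hexagon_card_line[OF s'(1) h c0 wd(2) wd(3)[symmetric] wd(1)[symmetric] this] l 2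
      show ?thesis by (simp add: E_def O'_def insert_commute)
    next
      case 3
      have "w3 = (r3 * k3) *\<^sub>R u3" by (simp add: w3_def k)
      from hexagon_card_line[OF s'(2) h c0 wd(3)[symmetric] wd(1) wd(2)[symmetric] this] l 3
      show ?thesis by (simp add: E_def O'_def insert_commute)
    qed
  qed
  have "X_ray u (\<Lambda> \<inter> P - O') = X_ray u (\<Lambda> \<inter> P - E)" if u: "u \<in> {u1, u2, u3}" for u
    unfolding X_ray_def
  proof (rule restrict_ext)
    fix l assume l: "l \<in> lines_in_direction u"
    have "card ((\<Lambda> \<inter> P - D) \<inter> l) = card (\<Lambda> \<inter> P \<inter> l) - card (D \<inter> l)" if "D \<subseteq> \<Lambda> \<inter> P" for D
    proof -
      have "(\<Lambda> \<inter> P - D) \<inter> l = \<Lambda> \<inter> P \<inter> l - D \<inter> l" by blast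
      then show ?thesis using fin that by (simp add: card_Diff_subset finite_subset[of "D \<inter> l" "\<Lambda> \<inter> P"] Int_mono le_infI1)
    qed
    then show "card ((\<Lambda> \<inter> P - O') \<inter> l) = card ((\<Lambda> \<inter> P - E) \<inter> l)" using lines[OF u l] EO by simp
  qed
  moreover have "\<Lambda> \<inter> P - O' \<noteq> \<Lambda> \<inter> P - E"
  proof -
    have "h w1 \<in> E" "h w1 \<notin> O'" using wd(4-6) by (auto simp: E_def O'_def inj)
    then show ?thesis using EO by blast
  qed
  ultimately show ?thesis unfolding determined_by_X_rays_def using C1 C2 by blast
qed

text \<open>For rational \<open>s\<close> the vectors \<open>1 + of_real s * \<tau>\<close> are a
  supply of pairwise nonparallel elements of the difference field, with determinants proportional to
  the differences of the parameters.\<close>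

lemma one_plus_mult_nonreal:
  assumes "Im \<tau> \<noteq> 0"
  shows "1 + of_real s * \<tau> \<noteq> 0" "Im (cnj (1 + of_real s * \<tau>) * (1 + of_real r * \<tau>)) = (r - s) * Im \<tau>"
proof -
  show "1 + of_real s * \<tau> \<noteq> 0" using assms by (cases "s = 0") (auto simp: complex_eq_iff)
  show "Im (cnj (1 + of_real s * \<tau>) * (1 + of_real r * \<tau>)) = (r - s) * Im \<tau>" by (simp add: algebra_simps)
qed

lemma sgn_parallel: "w \<noteq> 0 \<Longrightarrow> parallel (sgn w) w"
  unfolding parallel_def by (intro exI[of _ "cmod w"]) (simp add: sgn_div_norm)

lemma Im_cnj_sgn: "Im (cnj (sgn v) * sgn w) = Im (cnj v * w) / (cmod v * cmod w)"
  by (simp add: sgn_div_norm field_simps)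

lemma not_parallel_sgn:
  assumes "Im \<tau> \<noteq> 0" "s \<noteq> r"
  shows "\<not> parallel (sgn (1 + of_real s * \<tau>)) (sgn (1 + of_real r * \<tau>))"
proof -
  note nz = one_plus_mult_nonreal(1)[OF assms(1)]
  have "Im (cnj (1 + of_real s * \<tau>) * (1 + of_real r * \<tau>)) \<noteq> 0"
    unfolding one_plus_mult_nonreal(2)[OF assms(1)] using assms by simp
  then have "Im (cnj (sgn (1 + of_real s * \<tau>)) * sgn (1 + of_real r * \<tau>)) \<noteq> 0"
    unfolding Im_cnj_sgn using nz by (metis divide_eq_0_iff mult_eq_0_iff norm_eq_zero)
  moreover have "sgn (1 + of_real s * \<tau>) \<noteq> 0" "sgn (1 + of_real r * \<tau>) \<noteq> 0"
    using nz[of s] nz[of r] by (simp_all only: sgn_zero_iff not_False_eq_True)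
  ultimately show ?thesis using parallel_iff by blast
qed

lemma parallel_trans_sym:
  assumes "parallel u v" "parallel u w"
  shows "parallel v w"
proof -
  obtain a b :: real where "a \<noteq> 0" "b \<noteq> 0" "v = a *\<^sub>R u" "w = b *\<^sub>R u" using assms unfolding parallel_def by blast
  then show ?thesis unfolding parallel_def by (intro exI[of _ "b / a"]) simp
qed

lemma extend_nonparallel_directions:
  assumes A: "algebraic_Delone \<Lambda>" and U: "finite U" "nonparallel_directions_of \<Lambda> U"
  obtains v where "v \<notin> U" "nonparallel_directions_of \<Lambda> (insert v U)"
proof -
  obtain \<tau> where t: "\<tau> \<in> difference_field \<Lambda>" "Im \<tau> \<noteq> 0"
    using Delone_nonreal_difference[OF conjunct1[OF A[unfolded algebraic_Delone_def]]] .
  define d where "d = (\<lambda>s::nat. sgn (1 + of_real (real s) * \<tau>))"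
  have K: "1 + of_real (real s) * \<tau> \<in> difference_field \<Lambda>" for s
    by (intro difference_field_add difference_field_mult t difference_field_rat) auto
  have dir: "direction_of \<Lambda> (d s)" for s
    unfolding d_def by (rule direction_of_sgn[OF A K one_plus_mult_nonreal(1)[OF t(2)]])
  have np: "\<not> parallel (d s) (d r)" if "s \<noteq> r" for s r
    unfolding d_def by (rule not_parallel_sgn[OF t(2)]) (use that in simp)
  \<comment> \<open>A direction of \<open>U\<close> is parallel to at most one \<open>d s\<close>;
    if it is parallel to none, the arbitrary value of \<open>g\<close> does no harm.\<close>
  define g where "g = (\<lambda>u. SOME s. parallel u (d s))"
  obtain s where s: "s \<notin> g ` U" using U(1) infinite_UNIV_nat ex_new_if_finite by blast
  have ns: "\<not> parallel u (d s)" if "u \<in> U" for u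
  proof
    assume p: "parallel u (d s)"
    then have "parallel u (d (g u))" unfolding g_def by (rule someI)
    then have "parallel (d s) (d (g u))" using p parallel_trans_sym by blast
    moreover have "s \<noteq> g u" using s that by blast
    ultimately show False using np by blast
  qed
  have refl: "parallel u u" for u unfolding parallel_def by (intro exI[of _ 1]) simp
  have sym: "parallel v u" if "parallel u v" for u v using parallel_trans_sym[OF that refl] .
  show ?thesis
  proof (rule that)
    show "d s \<notin> U" using ns refl by blast
    show "nonparallel_directions_of \<Lambda> (insert (d s) U)"
      using U(2) dir ns sym unfolding nonparallel_directions_of_def pairwise_insert by blast
  qed
qed

lemma determined_by_X_rays_mono:
  "determined_by_X_rays \<F> U \<Longrightarrow> U \<subseteq> V \<Longrightarrow> determined_by_X_rays \<F> V"
  unfolding determined_by_X_rays_def by blast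

text \<open>Omitting directions loses information, so a smaller set may be enlarged until it has
  three elements.\<close>

lemma few_directions_not_determined:
  assumes A: "algebraic_Delone \<Lambda>" and U: "finite U" "nonparallel_directions_of \<Lambda> U" "card U < 4"
  shows "\<not> determined_by_X_rays (convex_subsets_of \<Lambda>) U"
  using U
proof (induction "3 - card U" arbitrary: U)
  case 0
  then have "card U = 3" by simp
  then obtain u1 u2 u3 where "U = {u1, u2, u3}" "u1 \<noteq> u2" "u1 \<noteq> u3" "u2 \<noteq> u3" by (auto simp: card_3_iff)
  then show ?case using three_directions_not_determined[OF A] 0 by simp
next
  case (Suc k)
  obtain v where v: "v \<notin> U" "nonparallel_directions_of \<Lambda> (insert v U)"
    using extend_nonparallel_directions[OF A Suc.prems(1,2)] .
  have "\<not> determined_by_X_rays (convex_subsets_of \<Lambda>) (insert v U)"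
    using Suc v by (intro Suc.hyps(1)) auto
  then show ?case using determined_by_X_rays_mono by blast
qed

text \<open>\<open>\<mu>\<close> is a fractional linear function of the parameter, so cross ratios
  of its values are those of the parameters.\<close>

lemma cross_ratio_slopes:
  assumes "Im \<tau> \<noteq> 0"
  defines "\<mu> \<equiv> \<lambda>s::real. cnj (1 + of_real s * \<tau>) / (1 + of_real s * \<tau>)"
  shows "\<mu> s - \<mu> r = of_real (r - s) * ((\<tau> - cnj \<tau>) / ((1 + of_real s * \<tau>) * (1 + of_real r * \<tau>)))"
proof -
  note nz = one_plus_mult_nonreal(1)[OF assms(1)]
  have "cnj (1 + of_real s * \<tau>) * (1 + of_real r * \<tau>) - cnj (1 + of_real r * \<tau>) * (1 + of_real s * \<tau>) =
      of_real (r - s) * (\<tau> - cnj \<tau>)"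
    by (simp add: algebra_simps)
  then show ?thesis unfolding \<mu>_def diff_frac_eq[OF nz nz] by (simp only: times_divide_eq_right)
qed

lemma four_directions_determined:
  assumes A: "algebraic_Delone \<Lambda>"
  shows "\<exists>U. card U = 4 \<and> nonparallel_directions_of \<Lambda> U \<and> determined_by_X_rays (convex_subsets_of \<Lambda>) U"
proof -
  obtain \<tau> where t: "\<tau> \<in> difference_field \<Lambda>" "Im \<tau> \<noteq> 0"
    using Delone_nonreal_difference[OF conjunct1[OF A[unfolded algebraic_Delone_def]]] .
  define d where "d = (\<lambda>s::real. sgn (1 + of_real s * \<tau>))"
  \<comment> \<open>Chosen so that \<open>(0 - 6) * (-1 - 3) = 8 * ((0 - (-1)) * (6 - 3))\<close>,
    that is, the cross ratio of the parameters is 8.\<close>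
  define T :: "real set" where "T = {0, 6, -1, 3}"
  define U where "U = d ` T"
  note nz = one_plus_mult_nonreal(1)[OF t(2)]
  have np: "\<not> parallel (d s) (d r)" if "s \<noteq> r" for s r
    unfolding d_def by (rule not_parallel_sgn[OF t(2) that])
  have refl: "parallel u u" for u unfolding parallel_def by (intro exI[of _ 1]) simp
  have inj: "d s = d r \<longleftrightarrow> s = r" for s r using np[of s r] refl by metis
  have "card U = card T" unfolding U_def by (intro card_image inj_onI) (simp add: inj)
  then have card: "card U = 4" by (simp add: T_def)
  have dir: "direction_of \<Lambda> (d s)" if "s \<in> T" for s
  proof -
    have "of_real s \<in> \<rat>" using that by (auto simp: T_def)
    then have "1 + of_real s * \<tau> \<in> difference_field \<Lambda>"
      by (intro difference_field_add difference_field_mult t difference_field_rat) auto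
    then show ?thesis unfolding d_def using direction_of_sgn[OF A] nz by blast
  qed
  have nU: "nonparallel_directions_of \<Lambda> U"
    unfolding nonparallel_directions_of_def U_def
  proof (intro conjI ballI pairwiseI)
    fix u v assume "u \<in> d ` T" "v \<in> d ` T" "u \<noteq> v"
    then obtain s r where "u = d s" "v = d r" "s \<noteq> r" by blast
    then show "\<not> parallel u v" using np by simp
  qed (use dir in blast)
  have mem: "d 0 \<in> U" "d 6 \<in> U" "d (-1) \<in> U" "d 3 \<in> U" by (auto simp: U_def T_def)
  have "determined_by_X_rays (convex_subsets_of \<Lambda>) U"
  proof (rule ccontr)
    assume nd: "\<not> determined_by_X_rays (convex_subsets_of \<Lambda>) U"
    have ud: "uniform_discrete \<Lambda>" using A unfolding algebraic_Delone_def Delone_def by blast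
    have "d 0 \<noteq> d 6" by (simp add: inj)
    obtain m :: nat and \<omega> :: "complex \<Rightarrow> complex" where m: "0 < m" "\<And>u. u \<in> U \<Longrightarrow> \<omega> u ^ m = 1" "inj_on \<omega> U"
      and cr: "same_cross_ratios U \<omega> (\<lambda>u. cnj u / u)"
      using not_determined_roots_of_unity[OF ud nU mem(1,2) \<open>d 0 \<noteq> d 6\<close> nd] by blast
    define \<mu> where "\<mu> = (\<lambda>s::real. cnj (1 + of_real s * \<tau>) / (1 + of_real s * \<tau>))"
    have \<mu>: "cnj (d s) / d s = \<mu> s" for s
    proof -
      have "d s \<noteq> 0" using nz[of s] by (simp add: d_def sgn_zero_iff)
      then show ?thesis unfolding \<mu>_def d_def using parallel_slope[OF sgn_parallel[OF nz[of s]]] by simp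
    qed
    define p where "p = (\<lambda>s::real. 1 + of_real s * \<tau>)"
    define q where "q = \<tau> - cnj \<tau>"
    have diff: "\<mu> s - \<mu> r = of_real (r - s) * (q / (p s * p r))" for s r
      unfolding \<mu>_def p_def q_def by (rule cross_ratio_slopes[OF t(2)])
    define e where "e = q\<^sup>2 / (p 0 * p 6 * p (-1) * p 3)"
    have "q \<noteq> 0" using t(2) by (auto simp: q_def complex_eq_iff)
    moreover have "p s \<noteq> 0" for s unfolding p_def by (rule nz)
    ultimately have e0: "e \<noteq> 0" by (simp add: e_def)
    have cancel: "x = 8 * y" if "x * (3 * e) = y * (24 * e)" for x y
    proof -
      have "x * (3 * e) = (8 * y) * (3 * e)" using that by simp
      then show ?thesis using e0 by (subst (asm) mult_right_cancel) simp_all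
    qed
    have "(\<mu> 0 - \<mu> (-1)) * (\<mu> 6 - \<mu> 3) = 3 * e" "(\<mu> 0 - \<mu> 6) * (\<mu> (-1) - \<mu> 3) = 24 * e"
      by (simp_all add: diff e_def power2_eq_square mult_ac)
    then have "(\<omega> (d 0) - \<omega> (d 6)) * (\<omega> (d (-1)) - \<omega> (d 3)) * (3 * e) =
        (\<omega> (d 0) - \<omega> (d (-1))) * (\<omega> (d 6) - \<omega> (d 3)) * (24 * e)"
      using same_cross_ratiosD[OF cr mem] unfolding \<mu> by simp
    then have "(\<omega> (d 0) - \<omega> (d 6)) * (\<omega> (d (-1)) - \<omega> (d 3)) =
        8 * ((\<omega> (d 0) - \<omega> (d (-1))) * (\<omega> (d 6) - \<omega> (d 3)))"
      by (rule cancel)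
    moreover have "\<omega> (d 0) \<noteq> \<omega> (d 6)" "\<omega> (d (-1)) \<noteq> \<omega> (d 3)"
      using inj_onD[OF m(3) _ mem(1,2)] inj_onD[OF m(3) _ mem(3,4)] by (auto simp: inj)
    ultimately show False
      using cross_ratio_of_roots_ne_8[OF m(1) m(2)[OF mem(1)] m(2)[OF mem(2)] m(2)[OF mem(3)] m(2)[OF mem(4)]] by blast
  qed
  then show ?thesis using card nU by blast
qed

lemma many_directions_determined:
  assumes A: "algebraic_Delone \<Lambda>"
  shows "\<exists>c::nat. c > 0 \<and> (\<forall>U. finite U \<and> card U = c \<and> nonparallel_directions_of \<Lambda> U \<longrightarrow>
    determined_by_X_rays (convex_subsets_of \<Lambda>) U)"
proof -
  define K where "K = difference_field \<Lambda>"
  have pow: "x ^ n \<in> K" if "x \<in> K" for x n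
    using that unfolding K_def by (induction n) (auto intro: difference_field_rat difference_field_mult)
  have fd: "ring.finite_dimension complex_ring \<rat> K"
    unfolding K_def by (rule conjunct1[OF conjunct2[OF A[unfolded algebraic_Delone_def]]])
  obtain D where D: "\<And>x. x \<in> K \<Longrightarrow> degree_at_most D x"
    using finite_dimension_degree_at_most[OF fd pow] by auto
  obtain B where B: "\<And>W m. finite W \<Longrightarrow> 0 < m \<Longrightarrow> (\<And>w. w \<in> W \<Longrightarrow> w ^ m = 1) \<Longrightarrow>
    (\<And>w1 w2 w3 w4. w1 \<in> W \<Longrightarrow> w2 \<in> W \<Longrightarrow> w3 \<in> W \<Longrightarrow> w4 \<in> W \<Longrightarrow> w1 \<noteq> w3 \<Longrightarrow> w2 \<noteq> w4 \<Longrightarrow>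
      \<exists>x. degree_at_most D x \<and> (w1 - w2) * (w3 - w4) = x * ((w1 - w3) * (w2 - w4))) \<Longrightarrow> card W \<le> B"
    using card_roots_of_unity_bounded[of D] by blast
  \<comment> \<open>More than \<open>B\<close> directions contradict the bound; \<open>B + 2\<close>
    also supplies the two distinct directions needed to start, even if \<open>B\<close> is
    0.\<close>
  have "determined_by_X_rays (convex_subsets_of \<Lambda>) U"
    if U: "finite U" "card U = B + 2" "nonparallel_directions_of \<Lambda> U" for U
  proof (rule ccontr)
    assume nd: "\<not> determined_by_X_rays (convex_subsets_of \<Lambda>) U"
    have ud: "uniform_discrete \<Lambda>" using A unfolding algebraic_Delone_def Delone_def by blast
    have "\<not> card U \<le> Suc 0" using U(2) by simp
    then obtain a b where ab: "a \<in> U" "b \<in> U" "a \<noteq> b" using U(1) card_le_Suc0_iff_eq by blast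
    obtain m :: nat and \<omega> :: "complex \<Rightarrow> complex" where m: "0 < m" "\<And>u. u \<in> U \<Longrightarrow> \<omega> u ^ m = 1" "inj_on \<omega> U"
      and cr: "same_cross_ratios U \<omega> (\<lambda>u. cnj u / u)"
      using not_determined_roots_of_unity[OF ud U(3) ab nd] by blast
    define \<mu> where "\<mu> = (\<lambda>u::complex. cnj u / u)"
    have dir: "direction_of \<Lambda> u" if "u \<in> U" for u using U(3) that unfolding nonparallel_directions_of_def by blast
    have \<mu>K: "\<mu> u \<in> K" if "u \<in> U" for u unfolding \<mu>_def K_def by (rule direction_of_slope(1)[OF dir[OF that]])
    have \<mu>ne: "\<mu> u \<noteq> \<mu> v" if "u \<in> U" "v \<in> U" "u \<noteq> v" for u v
    proof
      assume "\<mu> u = \<mu> v"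
      moreover have n: "u \<noteq> 0" "v \<noteq> 0" using direction_of_slope(2) dir that by blast+
      ultimately have "parallel u v" using slope_eq_imp parallel_iff unfolding \<mu>_def by blast
      then show False using U(3) that unfolding nonparallel_directions_of_def pairwise_def by blast
    qed
    have "card (\<omega> ` U) \<le> B"
    proof (rule B[OF _ m(1)])
      show "finite (\<omega> ` U)" using U(1) by simp
      show "w ^ m = 1" if "w \<in> \<omega> ` U" for w using that m(2) by blast
      fix w1 w2 w3 w4 assume "w1 \<in> \<omega> ` U" "w2 \<in> \<omega> ` U" "w3 \<in> \<omega> ` U" "w4 \<in> \<omega> ` U" and ne: "w1 \<noteq> w3" "w2 \<noteq> w4"
      then obtain u1 u2 u3 u4 where u: "u1 \<in> U" "u2 \<in> U" "u3 \<in> U" "u4 \<in> U"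
        "w1 = \<omega> u1" "w2 = \<omega> u2" "w3 = \<omega> u3" "w4 = \<omega> u4" by blast
      define x where "x = ((\<mu> u1 - \<mu> u2) * (\<mu> u3 - \<mu> u4)) / ((\<mu> u1 - \<mu> u3) * (\<mu> u2 - \<mu> u4))"
      have "x \<in> K" unfolding x_def K_def
        by (intro difference_field_divide difference_field_mult difference_field_minus u(1-4) \<mu>K[unfolded K_def])
      then have "degree_at_most D x" by (rule D)
      moreover have "(w1 - w2) * (w3 - w4) = x * ((w1 - w3) * (w2 - w4))"
      proof -
        have nz: "(\<mu> u1 - \<mu> u3) * (\<mu> u2 - \<mu> u4) \<noteq> 0" using \<mu>ne u ne by auto
        have "cnj u / u = \<mu> u" for u by (simp add: \<mu>_def)
        note same_cross_ratiosD[OF cr u(1-4), unfolded this u(5-8)[symmetric]]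
        then show ?thesis unfolding x_def times_divide_eq_left nonzero_eq_divide_eq[OF nz] by (simp only: mult.commute)
      qed
      ultimately show "\<exists>x. degree_at_most D x \<and> (w1 - w2) * (w3 - w4) = x * ((w1 - w3) * (w2 - w4))" by blast
    qed
    moreover have "card (\<omega> ` U) = B + 2" using card_image[OF m(3)] U(2) by simp
    ultimately show False by simp
  qed
  then show ?thesis by (intro exI[of _ "B + 2"]) simp
qed

theorem theorem5p10:
  fixes \<Lambda> :: "complex set"
  assumes "algebraic_Delone \<Lambda>"
  shows
    "((\<exists>U. card U = 4 \<and> nonparallel_directions_of \<Lambda> U \<and>
           determined_by_X_rays (convex_subsets_of \<Lambda>) U) \<and>
      (\<forall>U. finite U \<and> card U < 4 \<and> nonparallel_directions_of \<Lambda> U \<longrightarrow>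
           \<not> determined_by_X_rays (convex_subsets_of \<Lambda>) U)) \<and>
     (\<exists>c::nat. c > 0 \<and>
       (\<forall>U. finite U \<and> card U = c \<and> nonparallel_directions_of \<Lambda> U \<longrightarrow>
            determined_by_X_rays (convex_subsets_of \<Lambda>) U))"
  using four_directions_determined[OF assms] few_directions_not_determined[OF assms]
    many_directions_determined[OF assms] by blast

end
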